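(* Let $P$ be a (degenerate) Nambu-determinant Poisson bivector on $\mathbb{R}^4$ with Casimirs $a^1,a^2$. Consider the graph subcomplex of the Lichnerowicz--Poisson complex restricted to symmetric Hamiltonians on $2$ copies of $P$ (the space $\mathcal{H}^+_{4D}$), skew-symmetric vector fields on $3$ copies of $P$ (the space $\mathcal{V}^-_{4D}$), symmetric bivectors on $4$ copies of $P$, etc., with differential $d_P=[\![P,\cdot]\!]$; (skew-)symmetry is with respect to the swap $a^1\leftrightarrow a^2$. Then the corresponding homogeneous part of the first Lichnerowicz--Poisson cohomology $H^1_{\mathrm{gra}}(\mathbb{R}^4)$ is trivial; that is, every $\vec{Y}\in\mathcal{V}^-_{4D}$ with $d_P(\vec{Y})=0$ is of the form $\vec{Y}=d_P(H)$ for some $H\in\mathcal{H}^+_{4D}$.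
   Context: $[\![\cdot,\cdot]\!]$ is the Schouten bracket of multivector fields; $d_P=[\![P,\cdot]\!]$. The Nambu-determinant Poisson bivector on $\mathbb{R}^4$ is $P=\tfrac12P^{ij}\partial_i\wedge\partial_j$ with $P^{ij}=\sum_{k,l}\varrho\,\varepsilon^{ijkl}\,\partial_k a^1\,\partial_l a^2$, i.e. $\{f,g\}=\varrho\cdot\det\big(\partial(f,g,a^1,a^2)/\partial(x^1,\dots,x^4)\big)$, for smooth functions $\varrho,a^1,a^2$. A four-dimensional Nambu micro-graph on $n$ copies of $P$ and at most one sink $0$ is a weakly connected directed graph with Levi-Civita vertices $1,\dots,n$, $a^1$-Casimir vertices $n+1,\dots,2n$ and $a^2$-Casimir vertices $2n+1,\dots,3n$, the vertices $n+k$ and $2n+k$ belonging to $k$. Each Levi-Civita vertex $k$ issues four ordered edges to four distinct targets, two of which are $n+k$ and $2n+k$; the other two targets are arbitrary vertices (self-loops allowed). Casimir vertices and the sink issue no edges; the sink, if present, receives exactly one edge. The evaluation $\phi$ sends such a graph to a function (no sink) or a vector field (one sink): decorate the four ordered edges of vertex $k$ with indices $i_{k1},\dots,i_{k4}\in\{1,2,3,4\}$; form $\prod_k\varepsilon^{i_{k1}i_{k2}i_{k3}i_{k4}}$ times the product of $\varrho$ over Levi-Civita vertices, of $a^1$ over $a^1$-Casimir vertices and of $a^2$ over $a^2$-Casimir vertices, each differentiated with respect to $x^i$ for every incoming edge with index $i$, times $\partial_{x^i}$ if the edge with index $i$ enters the sink; sum over all indices. Write $\phi(\Gamma)(a^1,a^2)$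 for the resulting expression and put $\phi^{\pm}(\Gamma)=\tfrac12\big(\phi(\Gamma)(a^1,a^2)\pm\phi(\Gamma)(a^2,a^1)\big)$. $\mathcal{H}^+_{4D}$ is the real span of $\phi^+(\Gamma)$ over micro-graphs on $2$ copies of $P$ with no sink; $\mathcal{V}^-_{4D}$ is the real span of $\phi^-(\Gamma)$ over micro-graphs on $3$ copies of $P$ with one sink. The functions $\varrho,a^1,a^2$ are treated as arbitrary (generic): elements of these spaces are differential-polynomial expressions with constant coefficients, and equalities are required to hold identically for all smooth $\varrho,a^1,a^2$. *)

theory Defs
  imports "HOL-Analysis.Analysis"
begin

type_synonym scalar_field = "real^4 \<Rightarrow> real"

definition pd :: "4 \<Rightarrow> scalar_field \<Rightarrow> scalar_field" where
  "pd i f = (\<lambda>x. frechet_derivative f (at x) (axis i 1))"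

text \<open>Infinite differentiability: all iterated partial derivatives, taken in any order,
  are (Frechet) differentiable everywhere, hence also continuous.\<close>

definition smooth :: "scalar_field \<Rightarrow> bool" where
  "smooth f \<longleftrightarrow> (\<forall>is x. foldr pd is f differentiable (at x))"

text \<open>Multivector fields are elements of the Grassmann algebra over the scalar fields with
  odd generators \<open>\<xi>\<^sub>i = \<partial>\<^sub>i\<close>: the value at an index set \<open>I\<close> is the coefficient of the wedge product
  of the \<open>\<xi>\<^sub>i\<close>, \<open>i \<in> I\<close>, taken in increasing order.  The numeral \<open>4 :: 4\<close> equals \<open>0\<close>, so the
  order on the index type is \<open>4 < 1 < 2 < 3\<close>; it only serves to choose a basis.\<close>

type_synonym multivector_field = "4 set \<Rightarrow> scalar_field"

definition wedge_sign :: "4 set \<Rightarrow> 4 set \<Rightarrow> real" where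
  "wedge_sign J K = (-1) ^ card {(j, k) \<in> J \<times> K. k < j}"

definition wedge :: "multivector_field \<Rightarrow> multivector_field \<Rightarrow> multivector_field" where
  "wedge A B = (\<lambda>I x. \<Sum>J\<in>Pow I. wedge_sign J (I - J) * A J x * B (I - J) x)"

definition coord_vec :: "4 \<Rightarrow> multivector_field" where
  "coord_vec i = (\<lambda>I x. if I = {i} then 1 else 0)"

definition left_xi :: "4 \<Rightarrow> multivector_field \<Rightarrow> multivector_field" where
  "left_xi i A = (\<lambda>I x. if i \<in> I then 0 else wedge_sign {i} I * A (insert i I) x)"

definition right_xi :: "4 \<Rightarrow> multivector_field \<Rightarrow> multivector_field" where
  "right_xi i A = (\<lambda>I x. if i \<in> I then 0 else wedge_sign I {i} * A (insert i I) x)"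

definition pd_coeffs :: "4 \<Rightarrow> multivector_field \<Rightarrow> multivector_field" where
  "pd_coeffs i A = (\<lambda>I. pd i (A I))"

text \<open>The Schouten bracket as the odd Poisson bracket of the conjugate pairs \<open>(x\<^sup>i, \<xi>\<^sub>i)\<close>.
  On vector fields it is the commutator, and the bracket of a vector field \<open>X\<close> with a function
  \<open>f\<close> is \<open>X(f)\<close>.\<close>

definition schouten :: "multivector_field \<Rightarrow> multivector_field \<Rightarrow> multivector_field" where
  "schouten A B = (\<lambda>I x. \<Sum>i\<in>UNIV. wedge (right_xi i A) (pd_coeffs i B) I x
                                  - wedge (pd_coeffs i A) (left_xi i B) I x)"

definition levi_civita :: "4 \<Rightarrow> 4 \<Rightarrow> 4 \<Rightarrow> 4 \<Rightarrow> real" where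
  "levi_civita i j k l =
     (let p = (\<lambda>_. l)(1 := i, 2 := j, 3 := k)
      in if p permutes UNIV then of_int (sign p) else 0)"

definition nambu_coeff ::
    "scalar_field \<Rightarrow> scalar_field \<Rightarrow> scalar_field \<Rightarrow> 4 \<Rightarrow> 4 \<Rightarrow> scalar_field" where
  "nambu_coeff \<rho> a1 a2 i j =
     (\<lambda>x. \<Sum>k\<in>UNIV. \<Sum>l\<in>UNIV. \<rho> x * levi_civita i j k l * pd k a1 x * pd l a2 x)"

definition nambu :: "scalar_field \<Rightarrow> scalar_field \<Rightarrow> scalar_field \<Rightarrow> multivector_field" where
  "nambu \<rho> a1 a2 =
     (\<lambda>I x. 1/2 * (\<Sum>i\<in>UNIV. \<Sum>j\<in>UNIV.
        nambu_coeff \<rho> a1 a2 i j x * wedge (coord_vec i) (coord_vec j) I x))"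

text \<open>Expressions in \<open>\<rho>\<close>, \<open>a\<^sup>1\<close>, \<open>a\<^sup>2\<close> are treated as operators sending these functions to a
  multivector field; functions are multivector fields concentrated in degree \<open>0\<close>.\<close>

type_synonym field_expr =
  "scalar_field \<Rightarrow> scalar_field \<Rightarrow> scalar_field \<Rightarrow> multivector_field"

definition expr_eq :: "field_expr \<Rightarrow> field_expr \<Rightarrow> bool" where
  "expr_eq F G \<longleftrightarrow>
     (\<forall>\<rho> a1 a2. smooth \<rho> \<longrightarrow> smooth a1 \<longrightarrow> smooth a2 \<longrightarrow> F \<rho> a1 a2 = G \<rho> a1 a2)"

definition d_P :: "field_expr \<Rightarrow> field_expr" where
  "d_P F = (\<lambda>\<rho> a1 a2. schouten (nambu \<rho> a1 a2) (F \<rho> a1 a2))"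

text \<open>A micro-graph on \<open>n\<close> copies is given by the target \<open>t k e\<close> of the edge in position
  \<open>e\<close> at Levi-Civita vertex \<open>k\<close>; only the values at \<open>k \<in> {1..n}\<close> matter.  The vertex \<open>0\<close> is
  the sink.\<close>

type_synonym micrograph = "nat \<Rightarrow> 4 \<Rightarrow> nat"

definition vertices :: "nat \<Rightarrow> bool \<Rightarrow> nat set" where
  "vertices n has_sink = (if has_sink then {0..3*n} else {1..3*n})"

definition edge_rel :: "nat \<Rightarrow> micrograph \<Rightarrow> (nat \<times> nat) set" where
  "edge_rel n t = {(k, t k e) | k e. k \<in> {1..n}}"

definition weakly_connected :: "nat \<Rightarrow> bool \<Rightarrow> micrograph \<Rightarrow> bool" where
  "weakly_connected n has_sink t \<longleftrightarrow>
     (\<forall>u\<in>vertices n has_sink. \<forall>v\<in>vertices n has_sink.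
        (u, v) \<in> (edge_rel n t \<union> (edge_rel n t)\<inverse>)\<^sup>*)"

definition micrographs :: "nat \<Rightarrow> bool \<Rightarrow> micrograph set" where
  "micrographs n has_sink =
     {t. (\<forall>k\<in>{1..n}. inj (t k) \<and> range (t k) \<subseteq> vertices n has_sink
                      \<and> n + k \<in> range (t k) \<and> 2*n + k \<in> range (t k))
       \<and> (has_sink \<longrightarrow> card {(k, e). k \<in> {1..n} \<and> t k e = 0} = 1)
       \<and> weakly_connected n has_sink t}"

text \<open>Given an index \<open>\<sigma> k e\<close> on every edge, the indices on the edges entering \<open>v\<close>.
  Their order in the list is immaterial for smooth functions.\<close>

definition incoming :: "nat \<Rightarrow> micrograph \<Rightarrow> (nat \<Rightarrow> 4 \<Rightarrow> 4) \<Rightarrow> nat \<Rightarrow> 4 list" where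
  "incoming n t \<sigma> v = [\<sigma> k e. k \<leftarrow> [1..<Suc n], e \<leftarrow> [1, 2, 3, 4], t k e = v]"

definition content ::
    "nat \<Rightarrow> scalar_field \<Rightarrow> scalar_field \<Rightarrow> scalar_field \<Rightarrow> nat \<Rightarrow> scalar_field" where
  "content n \<rho> a1 a2 v = (if v \<le> n then \<rho> else if v \<le> 2*n then a1 else a2)"

text \<open>The sink contributes the factor \<open>\<partial>\<^sub>i\<close>, that is, the coefficient at \<open>I\<close> collects the
  decorations in which \<open>I\<close> is the set of indices entering the sink (\<open>I = {}\<close> without sink).\<close>

definition evaluation :: "nat \<Rightarrow> micrograph \<Rightarrow> field_expr" where
  "evaluation n t = (\<lambda>\<rho> a1 a2 I x.
     \<Sum>\<sigma>\<in>{1..n} \<rightarrow>\<^sub>E (UNIV :: (4 \<Rightarrow> 4) set).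
       (\<Prod>k\<in>{1..n}. levi_civita (\<sigma> k 1) (\<sigma> k 2) (\<sigma> k 3) (\<sigma> k 4))
       * (\<Prod>v\<in>{1..3*n}. foldr pd (incoming n t \<sigma> v) (content n \<rho> a1 a2 v) x)
       * (if set (incoming n t \<sigma> 0) = I then 1 else 0))"

definition sym_evaluation :: "nat \<Rightarrow> micrograph \<Rightarrow> field_expr" where
  "sym_evaluation n t = (\<lambda>\<rho> a1 a2 I x.
     1/2 * (evaluation n t \<rho> a1 a2 I x + evaluation n t \<rho> a2 a1 I x))"

definition skew_evaluation :: "nat \<Rightarrow> micrograph \<Rightarrow> field_expr" where
  "skew_evaluation n t = (\<lambda>\<rho> a1 a2 I x.
     1/2 * (evaluation n t \<rho> a1 a2 I x - evaluation n t \<rho> a2 a1 I x))"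

text \<open>Real linear combinations; the coefficients do not depend on \<open>\<rho>\<close>, \<open>a\<^sup>1\<close>, \<open>a\<^sup>2\<close>.\<close>

definition expr_span :: "field_expr set \<Rightarrow> field_expr set" where
  "expr_span B = {(\<lambda>\<rho> a1 a2 I x. \<Sum>F\<in>S. c F * F \<rho> a1 a2 I x) | S c. finite S \<and> S \<subseteq> B}"

definition H_plus :: "field_expr set" where
  "H_plus = expr_span (sym_evaluation 2 ` micrographs 2 False)"

definition V_minus :: "field_expr set" where
  "V_minus = expr_span (skew_evaluation 3 ` micrographs 3 True)"

end

theory Submission
  imports Defs
begin

text \<open>Putting the coordinate function \<open>x\<^sup>i\<close> into the sink turns the \<open>i\<close>-th component of an evaluation
  into a full contraction of Levi-Civita symbols (brackets) with jets.  Brackets are alternating,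
  may be permuted and satisfy the Pluecker relations; together with the permutations of vertices
  of equal content these rules reduce every skew-symmetrized graph to a combination of 61 graphs and
  8 Hamiltonian vector fields \<open>d\<^sub>P H\<close>.

  Conversely, let \<open>Y\<close> be closed.  Then \<open>Y(a\<^sup>1)\<close> and \<open>Y(a\<^sup>2)\<close> are Casimirs for every \<open>\<rho>\<close>; replacing
  \<open>\<rho>\<close> by \<open>exp(t x\<^sup>1) \<rho>\<close> and comparing powers of \<open>t\<close> shows that they vanish.  Hence \<open>Y(\<rho>) = \<rho> div Y\<close>
  as well.  At suitable polynomial jets these equations form a triangular system for the
  coefficients of the 61 graphs, so only Hamiltonian fields remain.\<close>

section \<open>Smooth functions and partial derivatives\<close>

text \<open>Expanded in graphs, \<open>d_P Y\<close> would live on four copies of P. This is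
  avoided: closedness enters only through equations for \<open>Y\<close> and its first derivatives
  at a point, so all computations stay with three copies. A Casimir need not vanish, as every
  function of a1 and a2 is one. What helps is that \<rho> is arbitrary and \<open>Y\<close> is cubic
  in it: after the substitution \<open>Y(a)\<close> becomes exp(3 t x1) times a polynomial in
  \<open>t\<close>, and the exponential is differentiated by P wherever its component P21 is
  nonzero. The reduction is strong because a bracket does not remember which Levi-Civita vertex
  issued it. Only the differentiated functions matter, so the vertices carrying \<rho>, a1 and a2
  may be permuted independently of each other. With the sink attached to vertex 1 there are 3087
  choices of the free targets; permuting the \<rho>-vertices leaves 890 to be reduced. The 61 tests
  vanish on the eight Hamiltonian fields, so the 61 graphs are independent modulo these.\<close>

lemma smooth_differentiable: "smooth f \<Longrightarrow> f differentiable (at x)"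
  unfolding smooth_def by (metis foldr.simps(1) id_apply)

lemma smooth_pd: "smooth f \<Longrightarrow> smooth (pd i f)"
  unfolding smooth_def
proof (intro allI)
  fix "is" x
  assume *: "\<forall>is x. foldr pd is f differentiable at x"
  have "foldr pd is (pd i f) = foldr pd (is @ [i]) f" by simp
  with * show "foldr pd is (pd i f) differentiable at x" by metis
qed

text \<open>Smoothness is the largest property that implies differentiability and is stable under
  \<open>pd\<close>, since iterated derivatives never leave such a class. Closure properties are
  proved below by exhibiting a suitable class.\<close>

lemma smooth_coinduct:
  assumes "P f"
    and "\<And>f x. P f \<Longrightarrow> f differentiable (at x)"
    and "\<And>f i. P f \<Longrightarrow> P (pd i f)"
  shows "smooth f"
proof -
  have "P (foldr pd is f)" for "is"
    by (induction "is") (auto intro: assms)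
  then show ?thesis unfolding smooth_def using assms(2) by blast
qed

lemma pd_eqI: "(f has_derivative f') (at x) \<Longrightarrow> pd i f x = f' (axis i 1)"
  unfolding pd_def using frechet_derivative_at by metis

lemma has_derivative_frechet:
  "f differentiable (at x) \<Longrightarrow> (f has_derivative frechet_derivative f (at x)) (at x)"
  by (simp add: frechet_derivative_works)

lemma pd_add:
  assumes "f differentiable (at x)" "g differentiable (at x)"
  shows "pd i (\<lambda>x. f x + g x) x = pd i f x + pd i g x"
  using pd_eqI[OF has_derivative_add[OF assms[THEN has_derivative_frechet]]]
  by (simp add: pd_def)

lemma pd_diff:
  assumes "f differentiable (at x)" "g differentiable (at x)"
  shows "pd i (\<lambda>x. f x - g x) x = pd i f x - pd i g x"
  using pd_eqI[OF has_derivative_diff[OF assms[THEN has_derivative_frechet]]]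
  by (simp add: pd_def)

lemma pd_mult:
  assumes "f differentiable (at x)" "g differentiable (at x)"
  shows "pd i (\<lambda>x. f x * g x) x = pd i f x * g x + f x * pd i g x"
  using pd_eqI[OF has_derivative_mult[OF assms[THEN has_derivative_frechet]]]
  by (simp add: pd_def algebra_simps)

lemma pd_const [simp]: "pd i (\<lambda>x. c) = (\<lambda>x. 0)"
  by (auto simp: pd_def)

lemma pd_cmult:
  assumes "f differentiable (at x)"
  shows "pd i (\<lambda>x. c * f x) x = c * pd i f x"
  using pd_mult[OF differentiable_const assms] by simp

lemma pd_coord: "pd i (\<lambda>x. x $ j) = (\<lambda>x. if i = j then 1 else 0)"
proof
  fix x :: "real^4"
  have "((\<lambda>x. x $ j) has_derivative (\<lambda>x. x $ j)) (at x)"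
    by (intro bounded_linear_imp_has_derivative bounded_linear_vec_nth)
  from pd_eqI[OF this] show "pd i (\<lambda>x. x $ j) x = (if i = j then 1 else 0)"
    by (auto simp: axis_def)
qed

lemma differentiable_coord: "(\<lambda>x::real^4. x $ j) differentiable (at x)"
  by (rule differentiableI, rule bounded_linear_imp_has_derivative, rule bounded_linear_vec_nth)

lemma smooth_const [simp]: "smooth (\<lambda>x. c)"
  by (rule smooth_coinduct[where P = "\<lambda>f. \<exists>c. f = (\<lambda>x. c)"]) auto

lemma smooth_coord [simp]: "smooth (\<lambda>x. x $ j)"
  by (rule smooth_coinduct[where P = "\<lambda>f. f = (\<lambda>x. x $ j) \<or> (\<exists>c. f = (\<lambda>x. c))"])
     (auto simp: pd_coord differentiable_coord)

lemma smooth_add: "smooth f \<Longrightarrow> smooth g \<Longrightarrow> smooth (\<lambda>x. f x + g x)"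
proof (rule smooth_coinduct[where P = "\<lambda>h. \<exists>f g. smooth f \<and> smooth g \<and> h = (\<lambda>x. f x + g x)"], goal_cases)
  case (3 h i)
  then obtain f g where fg: "smooth f" "smooth g" "h = (\<lambda>x. f x + g x)" by blast
  then have "pd i h = (\<lambda>x. pd i f x + pd i g x)"
    by (auto simp: pd_add smooth_differentiable)
  with fg show ?case by (blast intro: smooth_pd)
qed (auto intro: differentiable_add smooth_differentiable)

text \<open>Products alone are not stable under \<open>pd\<close>, but finite sums of products of
  smooth functions are, by the Leibniz rule. This is the invariant class behind
  \<open>smooth_mult\<close>.\<close>

inductive sum_of_products :: "scalar_field \<Rightarrow> bool" where
  base: "smooth f \<Longrightarrow> smooth g \<Longrightarrow> sum_of_products (\<lambda>x. f x * g x)"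
| add: "sum_of_products f \<Longrightarrow> sum_of_products g \<Longrightarrow> sum_of_products (\<lambda>x. f x + g x)"

lemma sum_of_products_step:
  "sum_of_products h \<Longrightarrow> (\<forall>x. h differentiable (at x)) \<and> (\<forall>i. sum_of_products (pd i h))"
proof (induction rule: sum_of_products.induct)
  case (base f g)
  then have "pd i (\<lambda>x. f x * g x) = (\<lambda>x. pd i f x * g x + f x * pd i g x)" for i
    by (auto simp: pd_mult smooth_differentiable)
  moreover have "sum_of_products (\<lambda>x. pd i f x * g x + f x * pd i g x)" for i
    using base by (intro sum_of_products.intros smooth_pd)
  ultimately show ?case
    using base by (auto intro: differentiable_mult smooth_differentiable)
next
  case (add f g)
  then have "pd i (\<lambda>x. f x + g x) = (\<lambda>x. pd i f x + pd i g x)" for i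
    by (auto simp: pd_add)
  with add show ?case
    by (auto intro!: differentiable_add sum_of_products.intros)
qed

lemma smooth_mult: "smooth f \<Longrightarrow> smooth g \<Longrightarrow> smooth (\<lambda>x. f x * g x)"
  by (rule smooth_coinduct[where P = sum_of_products])
     (auto intro: sum_of_products.base dest: sum_of_products_step)

lemma smooth_cmult: "smooth f \<Longrightarrow> smooth (\<lambda>x. c * f x)"
  by (rule smooth_mult) auto

lemma smooth_diff: "smooth f \<Longrightarrow> smooth g \<Longrightarrow> smooth (\<lambda>x. f x - g x)"
  using smooth_add[of f "\<lambda>x. (-1) * g x"] smooth_cmult[of g "-1"] by simp

lemma smooth_sum: "(\<And>i. i \<in> A \<Longrightarrow> smooth (f i)) \<Longrightarrow> smooth (\<lambda>x. \<Sum>i\<in>A. f i x)"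
  by (induction A rule: infinite_finite_induct) (auto intro: smooth_add)

lemma smooth_prod: "(\<And>i. i \<in> A \<Longrightarrow> smooth (f i)) \<Longrightarrow> smooth (\<lambda>x. \<Prod>i\<in>A. f i x)"
  by (induction A rule: infinite_finite_induct) (auto intro: smooth_mult)

lemma smooth_power: "smooth f \<Longrightarrow> smooth (\<lambda>x. f x ^ n)"
  by (induction n) (auto intro: smooth_mult)

lemma pd_sum:
  assumes "\<And>j. j \<in> A \<Longrightarrow> f j differentiable (at x)"
  shows "pd i (\<lambda>x. \<Sum>j\<in>A. f j x) x = (\<Sum>j\<in>A. pd i (f j) x)"
proof -
  have "((\<lambda>x. \<Sum>j\<in>A. f j x) has_derivative (\<lambda>h. \<Sum>j\<in>A. frechet_derivative (f j) (at x) h)) (at x)"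
    by (intro has_derivative_sum has_derivative_frechet assms)
  from pd_eqI[OF this] show ?thesis by (simp add: pd_def)
qed

text \<open>Each summand keeps the whole product and replaces one factor. This is the shape that an
  update of a single vertex takes in \<open>pd_gev\<close>.\<close>

lemma pd_prod:
  assumes "finite A" "\<And>v. v \<in> A \<Longrightarrow> smooth (c v)"
  shows "pd i (\<lambda>x. \<Prod>v\<in>A. c v x) x = (\<Sum>v\<in>A. \<Prod>w\<in>A. (if w = v then pd i (c v) else c w) x)"
  using assms
proof (induction A rule: finite_induct)
  case (insert v A)
  have "pd i (\<lambda>x. \<Prod>w\<in>insert v A. c w x) x = pd i (\<lambda>x. c v x * (\<Prod>w\<in>A. c w x)) x"
    using insert by simp
  also have "\<dots> = pd i (c v) x * (\<Prod>w\<in>A. c w x) + c v x * pd i (\<lambda>x. \<Prod>w\<in>A. c w x) x"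
    using insert by (intro pd_mult smooth_differentiable smooth_prod) auto
  also have "(\<Prod>w\<in>A. c w x) = (\<Prod>w\<in>A. (if w = v then pd i (c v) else c w) x)"
    using insert by (intro prod.cong) auto
  also have "pd i (\<lambda>x. \<Prod>w\<in>A. c w x) x = (\<Sum>u\<in>A. \<Prod>w\<in>A. (if w = u then pd i (c u) else c w) x)"
    using insert by auto
  finally have *: "pd i (\<lambda>x. \<Prod>w\<in>insert v A. c w x) x
    = pd i (c v) x * (\<Prod>w\<in>A. (if w = v then pd i (c v) else c w) x)
      + (\<Sum>u\<in>A. c v x * (\<Prod>w\<in>A. (if w = u then pd i (c u) else c w) x))"
    by (simp add: sum_distrib_left)
  have "c v x * (\<Prod>w\<in>A. (if w = u then pd i (c u) else c w) x)
      = (\<Prod>w\<in>insert v A. (if w = u then pd i (c u) else c w) x)" if "u \<in> A" for u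
  proof -
    have "v \<noteq> u" using insert that by auto
    then show ?thesis using insert by simp
  qed
  then have "(\<Sum>u\<in>A. c v x * (\<Prod>w\<in>A. (if w = u then pd i (c u) else c w) x))
      = (\<Sum>u\<in>A. \<Prod>w\<in>insert v A. (if w = u then pd i (c u) else c w) x)"
    by (intro sum.cong) auto
  with insert show ?case unfolding * by simp
qed auto

section \<open>Symmetry of second partial derivatives\<close>

lemma pd_line:
  assumes "smooth f"
  shows "((\<lambda>s. f (y + s *\<^sub>R axis i 1)) has_real_derivative pd i f (y + s *\<^sub>R axis i 1)) (at s)"
proof -
  let ?z = "y + s *\<^sub>R axis i 1"
  have "(f has_derivative frechet_derivative f (at ?z)) (at ?z)"
    by (intro has_derivative_frechet smooth_differentiable assms)
  then have "((\<lambda>s. f (y + s *\<^sub>R axis i 1)) has_derivative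
      (\<lambda>h. frechet_derivative f (at ?z) (h *\<^sub>R axis i 1))) (at s)"
    by (rule has_derivative_compose[rotated]) (auto intro!: derivative_eq_intros)
  moreover have "(\<lambda>h. frechet_derivative f (at ?z) (h *\<^sub>R axis i 1)) = (*) (pd i f ?z)"
    using linear_frechet_derivative[OF smooth_differentiable[OF assms, of ?z]]
    by (auto simp: pd_def linear_cmul)
  ultimately show ?thesis by (simp add: has_field_derivative_def)
qed

text \<open>The mean value theorem is applied to the increment in direction \<open>j\<close>, as a
  function of the displacement along \<open>i\<close>, and then to \<open>pd i f\<close> along
  \<open>j\<close>. The left side is symmetric in \<open>i\<close> and \<open>j\<close>, the right
  side is not.\<close>

lemma second_difference:
  assumes "smooth f" "h > 0"
  obtains s t where "0 < s" "s < h" "0 < t" "t < h"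
    "f (x + h *\<^sub>R axis i 1 + h *\<^sub>R axis j 1) - f (x + h *\<^sub>R axis i 1)
      - f (x + h *\<^sub>R axis j 1) + f x
     = h * h * pd j (pd i f) (x + s *\<^sub>R axis i 1 + t *\<^sub>R axis j 1)"
proof -
  let ?F = "\<lambda>s. f ((x + h *\<^sub>R axis j 1) + s *\<^sub>R axis i 1) - f (x + s *\<^sub>R axis i 1)"
  have "(?F has_real_derivative pd i f ((x + h *\<^sub>R axis j 1) + s *\<^sub>R axis i 1) - pd i f (x + s *\<^sub>R axis i 1)) (at s)" for s
    by (intro derivative_intros pd_line assms)
  from MVT2[OF \<open>h > 0\<close> this] obtain s where s: "0 < s" "s < h"
    "?F h - ?F 0 = (h - 0) * (pd i f ((x + h *\<^sub>R axis j 1) + s *\<^sub>R axis i 1) - pd i f (x + s *\<^sub>R axis i 1))"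
    by blast
  let ?G = "\<lambda>t. pd i f ((x + s *\<^sub>R axis i 1) + t *\<^sub>R axis j 1)"
  have "(?G has_real_derivative pd j (pd i f) ((x + s *\<^sub>R axis i 1) + t *\<^sub>R axis j 1)) (at t)" for t
    by (intro pd_line smooth_pd assms)
  from MVT2[OF \<open>h > 0\<close> this] obtain t where t: "0 < t" "t < h"
    "?G h - ?G 0 = (h - 0) * pd j (pd i f) ((x + s *\<^sub>R axis i 1) + t *\<^sub>R axis j 1)"
    by blast
  have "(x + h *\<^sub>R axis j 1) + s *\<^sub>R axis i 1 = (x + s *\<^sub>R axis i 1) + h *\<^sub>R axis j 1" for s
    by simp
  with s t show ?thesis
    by (intro that[of s t]) (auto simp: algebra_simps)
qed

text \<open>Both mixed derivatives represent the same second difference at points near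
  \<open>x\<close>; by continuity they agree at \<open>x\<close>.\<close>

lemma pd_commute:
  assumes "smooth f"
  shows "pd i (pd j f) = pd j (pd i f)"
proof
  fix x
  let ?A = "pd j (pd i f)" and ?B = "pd i (pd j f)"
  have cA: "isCont ?A x" and cB: "isCont ?B x"
    by (auto intro!: differentiable_imp_continuous_within smooth_differentiable smooth_pd assms)
  show "?B x = ?A x"
  proof (rule ccontr)
    assume ne: "?B x \<noteq> ?A x"
    define e where "e = \<bar>?B x - ?A x\<bar> / 2"
    have "e > 0" using ne by (simp add: e_def)
    obtain d1 where d1: "d1 > 0" "\<And>y. dist y x < d1 \<Longrightarrow> \<bar>?A y - ?A x\<bar> < e"
      using cA \<open>e > 0\<close> unfolding continuous_at_eps_delta dist_real_def by (metis dist_commute)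
    obtain d2 where d2: "d2 > 0" "\<And>y. dist y x < d2 \<Longrightarrow> \<bar>?B y - ?B x\<bar> < e"
      using cB \<open>e > 0\<close> unfolding continuous_at_eps_delta dist_real_def by (metis dist_commute)
    \<comment> \<open>Each of the two displacements is shorter than \<open>h\<close>, so the
      intermediate points lie within \<open>2 * h\<close> of \<open>x\<close>.\<close>
    define h where "h = min d1 d2 / 2"
    have h: "h > 0" "2 * h \<le> d1" "2 * h \<le> d2" using d1 d2 by (auto simp: h_def)
    have near: "dist (x + s *\<^sub>R axis k 1 + t *\<^sub>R axis l 1) x < 2 * h"
      if "0 < s" "s < h" "0 < t" "t < h" for s t and k l :: 4
    proof -
      have "dist (x + s *\<^sub>R axis k 1 + t *\<^sub>R axis l 1) x
          = norm (s *\<^sub>R axis k (1::real) + t *\<^sub>R axis l 1)"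
        by (simp add: dist_norm)
      also have "\<dots> \<le> norm (s *\<^sub>R axis k (1::real)) + norm (t *\<^sub>R axis l (1::real))"
        by (rule norm_triangle_ineq)
      also have "\<dots> = s + t" using that by simp
      finally show ?thesis using that by simp
    qed
    from second_difference[OF assms h(1), where i = i and j = j and x = x]
    obtain s t where 1: "0 < s" "s < h" "0 < t" "t < h"
      "f (x + h *\<^sub>R axis i 1 + h *\<^sub>R axis j 1) - f (x + h *\<^sub>R axis i 1)
        - f (x + h *\<^sub>R axis j 1) + f x = h * h * ?A (x + s *\<^sub>R axis i 1 + t *\<^sub>R axis j 1)"
      by blast
    from second_difference[OF assms h(1), where i = j and j = i and x = x]
    obtain s' t' where 2: "0 < s'" "s' < h" "0 < t'" "t' < h"
      "f (x + h *\<^sub>R axis j 1 + h *\<^sub>R axis i 1) - f (x + h *\<^sub>R axis j 1)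
        - f (x + h *\<^sub>R axis i 1) + f x = h * h * ?B (x + s' *\<^sub>R axis j 1 + t' *\<^sub>R axis i 1)"
      by blast
    have "x + h *\<^sub>R axis j 1 + h *\<^sub>R axis i 1 = x + h *\<^sub>R axis i 1 + h *\<^sub>R axis j 1"
      by simp
    then have "h * h * ?A (x + s *\<^sub>R axis i 1 + t *\<^sub>R axis j 1)
        = h * h * ?B (x + s' *\<^sub>R axis j 1 + t' *\<^sub>R axis i 1)"
      unfolding 1(5)[symmetric] 2(5)[symmetric] by (simp only:)
    with h(1) have "?A (x + s *\<^sub>R axis i 1 + t *\<^sub>R axis j 1) = ?B (x + s' *\<^sub>R axis j 1 + t' *\<^sub>R axis i 1)"
      by simp
    moreover have "\<bar>?A (x + s *\<^sub>R axis i 1 + t *\<^sub>R axis j 1) - ?A x\<bar> < e"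
      using near[OF 1(1-4), of i j] h by (intro d1) auto
    moreover have "\<bar>?B (x + s' *\<^sub>R axis j 1 + t' *\<^sub>R axis i 1) - ?B x\<bar> < e"
      using near[OF 2(1-4), of j i] h by (intro d2) auto
    moreover have "\<bar>b - a\<bar> \<le> \<bar>c - a\<bar> + \<bar>c - b\<bar>" for a b c :: real
      by arith
    ultimately have "\<bar>?B x - ?A x\<bar> < e + e"
      by (metis add_strict_mono order_le_less_trans)
    then show False by (simp add: e_def)
  qed
qed

section \<open>The Levi-Civita symbol\<close>

text \<open>Names the map inside \<open>levi_civita\<close>. In the index type \<open>4\<close>
  equals \<open>0\<close>, and it is the argument left over by the three updates.\<close>

definition quad :: "4 \<Rightarrow> 4 \<Rightarrow> 4 \<Rightarrow> 4 \<Rightarrow> 4 \<Rightarrow> 4" where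
  "quad i j k l = (\<lambda>_. l)(1 := i, 2 := j, 3 := k)"

lemma quad_simps [simp]: "quad i j k l 1 = i" "quad i j k l 2 = j" "quad i j k l 3 = k" "quad i j k l 4 = l"
  by (simp_all add: quad_def)

lemma quad_eqI: "f 1 = i \<Longrightarrow> f 2 = j \<Longrightarrow> f 3 = k \<Longrightarrow> f 4 = l \<Longrightarrow> f = quad i j k l"
proof (rule ext)
  fix x :: 4
  assume "f 1 = i" "f 2 = j" "f 3 = k" "f 4 = l"
  then show "f x = quad i j k l x"
    using exhaust_4[of x] by (elim disjE) (simp_all only: quad_simps)
qed

lemma levi_civita_quad:
  "levi_civita i j k l = (if quad i j k l permutes UNIV then of_int (sign (quad i j k l)) else 0)"
  by (simp add: levi_civita_def quad_def Let_def)

text \<open>Composition with a transposition preserves permutations and reverses their sign; if the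
  map is not a permutation, both symbols are zero.\<close>

lemma levi_civita_transpose:
  assumes "a \<noteq> b" "quad i j k l \<circ> Transposition.transpose a b = quad i' j' k' l'"
  shows "levi_civita i' j' k' l' = - levi_civita i j k l"
proof -
  let ?p = "quad i j k l" and ?q = "quad i' j' k' l'" and ?t = "Transposition.transpose a b"
  have t: "?t permutes UNIV" by (simp add: permutes_swap_id)
  have "?p = ?q \<circ> ?t" using assms(2)[symmetric] by (simp add: comp_assoc transpose_comp_involutory)
  then have iff: "?p permutes UNIV \<longleftrightarrow> ?q permutes UNIV"
    using permutes_compose[OF t, of ?q] permutes_compose[OF t, of ?p] assms(2) by metis
  show ?thesis
  proof (cases "?p permutes UNIV")
    case True
    have "sign ?q = sign ?p * sign ?t"
      unfolding assms(2)[symmetric] using True t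
      by (intro sign_compose) (auto simp: permutation_permutes)
    then have "sign ?q = - sign ?p" using assms(1) by (simp add: sign_swap_id)
    then show ?thesis using True iff by (simp add: levi_civita_quad)
  qed (use iff in \<open>simp add: levi_civita_quad\<close>)
qed

lemma levi_civita_swap:
  "levi_civita j i k l = - levi_civita i j k l"
  "levi_civita k j i l = - levi_civita i j k l"
  "levi_civita l j k i = - levi_civita i j k l"
  "levi_civita i k j l = - levi_civita i j k l"
  "levi_civita i l k j = - levi_civita i j k l"
  "levi_civita i j l k = - levi_civita i j k l"
       apply (rule levi_civita_transpose[of 1 2], simp, rule quad_eqI; simp add: Transposition.transpose_def)
      apply (rule levi_civita_transpose[of 1 3], simp, rule quad_eqI; simp add: Transposition.transpose_def)
     apply (rule levi_civita_transpose[of 1 4], simp, rule quad_eqI; simp add: Transposition.transpose_def)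
    apply (rule levi_civita_transpose[of 2 3], simp, rule quad_eqI; simp add: Transposition.transpose_def)
   apply (rule levi_civita_transpose[of 2 4], simp, rule quad_eqI; simp add: Transposition.transpose_def)
  apply (rule levi_civita_transpose[of 3 4], simp, rule quad_eqI; simp add: Transposition.transpose_def)
  done

lemma levi_civita_eq [simp]:
  "levi_civita i i k l = 0" "levi_civita i j i l = 0" "levi_civita i j k i = 0"
  "levi_civita i j j l = 0" "levi_civita i j k j = 0" "levi_civita i j k k = 0"
  using levi_civita_swap(1)[of i i k l] levi_civita_swap(2)[of i j i l] levi_civita_swap(3)[of i j k i]
    levi_civita_swap(4)[of i j j l] levi_civita_swap(5)[of i j k j] levi_civita_swap(6)[of i j k k]
  by simp_all

lemma levi_civita_1234: "levi_civita 1 2 3 4 = 1"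
proof -
  have "quad 1 2 3 4 = id"
    by (rule sym, rule quad_eqI) auto
  then show ?thesis by (simp add: levi_civita_quad permutes_id sign_id)
qed

lemma levi_civita_values:
  "levi_civita 1 2 3 4 = 1" "levi_civita 1 2 4 3 = -1" "levi_civita 1 3 2 4 = -1"
  "levi_civita 1 3 4 2 = 1" "levi_civita 1 4 2 3 = 1" "levi_civita 1 4 3 2 = -1"
  "levi_civita 2 1 3 4 = -1" "levi_civita 2 1 4 3 = 1" "levi_civita 2 3 1 4 = 1"
  "levi_civita 2 3 4 1 = -1" "levi_civita 2 4 1 3 = -1" "levi_civita 2 4 3 1 = 1"
  "levi_civita 3 1 2 4 = 1" "levi_civita 3 1 4 2 = -1" "levi_civita 3 2 1 4 = -1"
  "levi_civita 3 2 4 1 = 1" "levi_civita 3 4 1 2 = 1" "levi_civita 3 4 2 1 = -1"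
  "levi_civita 4 1 2 3 = -1" "levi_civita 4 1 3 2 = 1" "levi_civita 4 2 1 3 = 1"
  "levi_civita 4 2 3 1 = -1" "levi_civita 4 3 1 2 = -1" "levi_civita 4 3 2 1 = 1"
  by (simp_all only: levi_civita_1234 minus_minus
      levi_civita_swap(6)[of 1 2 4 3] levi_civita_swap(4)[of 1 3 2 4] levi_civita_swap(5)[of 1 3 4 2]
      levi_civita_swap(4)[of 1 4 2 3] levi_civita_swap(5)[of 1 4 3 2] levi_civita_swap(1)[of 2 1 3 4]
      levi_civita_swap(1)[of 2 1 4 3] levi_civita_swap(2)[of 2 3 1 4] levi_civita_swap(3)[of 2 3 4 1]
      levi_civita_swap(2)[of 2 4 1 3] levi_civita_swap(3)[of 2 4 3 1] levi_civita_swap(1)[of 3 1 2 4]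
      levi_civita_swap(1)[of 3 1 4 2] levi_civita_swap(2)[of 3 2 1 4] levi_civita_swap(3)[of 3 2 4 1]
      levi_civita_swap(2)[of 3 4 1 2] levi_civita_swap(3)[of 3 4 2 1] levi_civita_swap(1)[of 4 1 2 3]
      levi_civita_swap(1)[of 4 1 3 2] levi_civita_swap(2)[of 4 2 1 3] levi_civita_swap(3)[of 4 2 3 1]
      levi_civita_swap(2)[of 4 3 1 2] levi_civita_swap(3)[of 4 3 2 1])

text \<open>Antisymmetrization over five indices is zero in dimension four. Concretely, either two
  of the four indices \<open>i1\<close> to \<open>i4\<close> coincide and the two surviving terms
  cancel, or they exhaust the index type and \<open>j\<close> is one of them, so that a single term
  survives and equals the left side.\<close>

lemma levi_civita_plucker:
  "levi_civita i1 i2 i3 i4 * levi_civita j k l m =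
     levi_civita j i2 i3 i4 * levi_civita i1 k l m + levi_civita i1 j i3 i4 * levi_civita i2 k l m
   + levi_civita i1 i2 j i4 * levi_civita i3 k l m + levi_civita i1 i2 i3 j * levi_civita i4 k l m"
proof -
  have *: "card {i1, i2, i3, i4} = 4" if "distinct [i1, i2, i3, i4]"
    using distinct_card[OF that] by simp
  have "j \<in> {i1, i2, i3, i4}" if "distinct [i1, i2, i3, i4]"
  proof -
    have "{i1, i2, i3, i4} = UNIV"
      using *[OF that] by (intro card_subset_eq) auto
    then show ?thesis by blast
  qed
  then consider "i1 = i2" | "i1 = i3" | "i1 = i4" | "i2 = i3" | "i2 = i4" | "i3 = i4"
    | "j = i1" | "j = i2" | "j = i3" | "j = i4"
    by fastforce
  then show ?thesis
  proof cases
    case 1 then show ?thesis using levi_civita_swap(1)[of j i2 i3 i4] by simp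
  next
    case 2 then show ?thesis using levi_civita_swap(2)[of j i2 i3 i4] by simp
  next
    case 3 then show ?thesis using levi_civita_swap(3)[of j i2 i3 i4] by simp
  next
    case 4 then show ?thesis using levi_civita_swap(4)[of i1 j i3 i4] by simp
  next
    case 5 then show ?thesis using levi_civita_swap(5)[of i1 j i3 i4] by simp
  next
    case 6 then show ?thesis using levi_civita_swap(6)[of i1 i2 j i4] by simp
  qed simp_all
qed

section \<open>Evaluation of bracket graphs\<close>

type_synonym contents = "nat \<Rightarrow> scalar_field"

definition smooth_contents :: "contents \<Rightarrow> bool" where
  "smooth_contents c \<longleftrightarrow> (\<forall>v. smooth (c v))"

definition dv :: "nat \<Rightarrow> 4 \<Rightarrow> contents \<Rightarrow> contents" where
  "dv v i c = c(v := pd i (c v))"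

lemma smooth_contents_dv [simp]: "smooth_contents c \<Longrightarrow> smooth_contents (dv v i c)"
  by (auto simp: smooth_contents_def dv_def smooth_pd)

lemma dv_commute: "smooth_contents c \<Longrightarrow> dv v i (dv w j c) = dv w j (dv v i c)"
  by (cases "v = w") (auto simp: smooth_contents_def dv_def pd_commute fun_upd_twist)

fun dv4 :: "nat list \<Rightarrow> 4 \<times> 4 \<times> 4 \<times> 4 \<Rightarrow> contents \<Rightarrow> contents" where
  "dv4 vs (i, j, k, l) c = dv (vs ! 0) i (dv (vs ! 1) j (dv (vs ! 2) k (dv (vs ! 3) l c)))"

fun lc4 :: "4 \<times> 4 \<times> 4 \<times> 4 \<Rightarrow> real" where
  "lc4 (i, j, k, l) = levi_civita i j k l"

lemma smooth_contents_dv4 [simp]: "smooth_contents c \<Longrightarrow> smooth_contents (dv4 vs ix c)"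
  by (cases ix) auto

lemma dv4_dv_commute: "smooth_contents c \<Longrightarrow> dv4 vs ix (dv w j c) = dv w j (dv4 vs ix c)"
  by (cases ix) (simp add: dv_commute)

lemma dv4_commute: "smooth_contents c \<Longrightarrow> dv4 vs ix (dv4 ws jx c) = dv4 ws jx (dv4 vs ix c)"
  by (cases jx) (simp add: dv4_dv_commute)

text \<open>The bracket [p q r s] of the classical symbolic method, that is, Cayley's Omega
  operator: each vertex carries its own copy of a function, and the determinant of the four
  gradients is taken. Acting on functionals of the contents makes brackets composable by
  \<open>foldr\<close>.\<close>

definition brk :: "nat list \<Rightarrow> (contents \<Rightarrow> real) \<Rightarrow> contents \<Rightarrow> real" where
  "brk vs \<Phi> c = (\<Sum>ix\<in>UNIV. lc4 ix * \<Phi> (dv4 vs ix c))"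

text \<open>All vertices are put at the same point \<open>x\<close> only after differentiation. A
  graph is the list of its brackets; the Levi-Civita vertex that issues a bracket is not
  recorded.\<close>

definition gev :: "nat set \<Rightarrow> real^4 \<Rightarrow> nat list list \<Rightarrow> contents \<Rightarrow> real" where
  "gev V x g c = foldr brk g (\<lambda>c. \<Prod>v\<in>V. c v x) c"

lemma gev_Nil [simp]: "gev V x [] c = (\<Prod>v\<in>V. c v x)"
  by (simp add: gev_def)

lemma gev_Cons: "gev V x (b # g) c = (\<Sum>ix\<in>UNIV. lc4 ix * gev V x g (dv4 b ix c))"
  by (simp add: gev_def brk_def)

lemma gev_cong_smooth:
  assumes "\<And>c. smooth_contents c \<Longrightarrow> gev V x g c = gev V x h c" "smooth_contents c"
  shows "gev V x (b # g) c = gev V x (b # h) c"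
  using assms by (simp add: gev_Cons)

text \<open>Brackets are differential operators with constant coefficients and hence
  commute.\<close>

lemma gev_swap:
  assumes "smooth_contents c"
  shows "gev V x (a # b # g) c = gev V x (b # a # g) c"
  unfolding gev_Cons sum_distrib_left
  by (subst sum.swap) (simp add: dv4_commute assms mult.left_commute)

text \<open>As derivatives commute, exchanging two slots only renames summation indices, at the cost
  of the sign of the Levi-Civita symbol. The length condition covers the three adjacent positions in
  a bracket at once.\<close>

lemma gev_alternating:
  assumes c: "smooth_contents c" and len: "length xs + length ys = 2"
  shows "gev V x ((xs @ a # b # ys) # g) c = - gev V x ((xs @ b # a # ys) # g) c"
proof -
  consider p q where "xs = []" "ys = [p, q]" | p q where "xs = [p]" "ys = [q]"
    | p q where "xs = [p, q]" "ys = []"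
    using len by (cases xs; cases ys; cases "tl xs"; cases "tl ys") auto
  then show ?thesis
  proof cases
    case 1
    show ?thesis unfolding gev_Cons 1 sum_negf[symmetric]
      by (rule sum.reindex_bij_witness[where i = "\<lambda>(i, j, k, l). (j, i, k, l)" and j = "\<lambda>(i, j, k, l). (j, i, k, l)"])
         (auto simp: dv_commute c, subst levi_civita_swap(1), simp)
  next
    case 2
    show ?thesis unfolding gev_Cons 2 sum_negf[symmetric]
      by (rule sum.reindex_bij_witness[where i = "\<lambda>(i, j, k, l). (i, k, j, l)" and j = "\<lambda>(i, j, k, l). (i, k, j, l)"])
         (auto simp: dv_commute c, subst levi_civita_swap(4), simp)
  next
    case 3
    show ?thesis unfolding gev_Cons 3 sum_negf[symmetric]
      by (rule sum.reindex_bij_witness[where i = "\<lambda>(i, j, k, l). (i, j, l, k)" and j = "\<lambda>(i, j, k, l). (i, j, l, k)"])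
         (auto simp: dv_commute c, subst levi_civita_swap(6), simp)
  qed
qed

text \<open>The identity for the symbols exchanges the index at slot \<open>e\<close> with the index
  at one slot of the first bracket. Renaming these two summation indices exchanges the two vertices
  instead.\<close>

lemma gev_plucker:
  assumes c: "smooth_contents c"
  shows "gev V x ([p, q, r, s] # [e, t, u, w] # g) c =
      gev V x ([e, q, r, s] # [p, t, u, w] # g) c + gev V x ([p, e, r, s] # [q, t, u, w] # g) c
    + gev V x ([p, q, e, s] # [r, t, u, w] # g) c + gev V x ([p, q, r, e] # [s, t, u, w] # g) c"
proof -
  let ?G = "\<lambda>d. gev V x g d"
  let ?A = "[p, q, r, s]" and ?B = "[e, t, u, w]"
  have two: "gev V x (a # b # g) c =
      (\<Sum>(ix, jx)\<in>UNIV. lc4 ix * lc4 jx * ?G (dv4 b jx (dv4 a ix c)))" for a b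
    unfolding gev_Cons sum_distrib_left
    by (simp add: sum.cartesian_product UNIV_Times_UNIV mult.assoc flip: UNIV_Times_UNIV)
  have "gev V x (?A # ?B # g) c
      = (\<Sum>((i1,i2,i3,i4), (j,k,l,m))\<in>UNIV.
          levi_civita j i2 i3 i4 * levi_civita i1 k l m * ?G (dv4 ?B (j,k,l,m) (dv4 ?A (i1,i2,i3,i4) c)))
      + (\<Sum>((i1,i2,i3,i4), (j,k,l,m))\<in>UNIV.
          levi_civita i1 j i3 i4 * levi_civita i2 k l m * ?G (dv4 ?B (j,k,l,m) (dv4 ?A (i1,i2,i3,i4) c)))
      + (\<Sum>((i1,i2,i3,i4), (j,k,l,m))\<in>UNIV.
          levi_civita i1 i2 j i4 * levi_civita i3 k l m * ?G (dv4 ?B (j,k,l,m) (dv4 ?A (i1,i2,i3,i4) c)))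
      + (\<Sum>((i1,i2,i3,i4), (j,k,l,m))\<in>UNIV.
          levi_civita i1 i2 i3 j * levi_civita i4 k l m * ?G (dv4 ?B (j,k,l,m) (dv4 ?A (i1,i2,i3,i4) c)))"
    (is "_ = ?S1 + ?S2 + ?S3 + ?S4")
    unfolding two sum.distrib[symmetric]
  proof (intro sum.cong refl, goal_cases)
    case (1 z)
    obtain i1 i2 i3 i4 j k l m where z: "z = ((i1,i2,i3,i4), (j,k,l,m))" by (metis surj_pair)
    show ?case unfolding z
      by (simp only: prod.case lc4.simps levi_civita_plucker[of i1 i2 i3 i4 j k l m] ring_distribs)
  qed
  also have "?S1 = gev V x ([e, q, r, s] # [p, t, u, w] # g) c"
    unfolding two
    by (rule sum.reindex_bij_witness[where i = "\<lambda>((i1,i2,i3,i4), (j,k,l,m)). ((j,i2,i3,i4), (i1,k,l,m))"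
          and j = "\<lambda>((i1,i2,i3,i4), (j,k,l,m)). ((j,i2,i3,i4), (i1,k,l,m))"])
       (auto simp: dv_commute c)
  also have "?S2 = gev V x ([p, e, r, s] # [q, t, u, w] # g) c"
    unfolding two
    by (rule sum.reindex_bij_witness[where i = "\<lambda>((i1,i2,i3,i4), (j,k,l,m)). ((i1,j,i3,i4), (i2,k,l,m))"
          and j = "\<lambda>((i1,i2,i3,i4), (j,k,l,m)). ((i1,j,i3,i4), (i2,k,l,m))"])
       (auto simp: dv_commute c)
  also have "?S3 = gev V x ([p, q, e, s] # [r, t, u, w] # g) c"
    unfolding two
    by (rule sum.reindex_bij_witness[where i = "\<lambda>((i1,i2,i3,i4), (j,k,l,m)). ((i1,i2,j,i4), (i3,k,l,m))"
          and j = "\<lambda>((i1,i2,i3,i4), (j,k,l,m)). ((i1,i2,j,i4), (i3,k,l,m))"])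
       (auto simp: dv_commute c)
  also have "?S4 = gev V x ([p, q, r, e] # [s, t, u, w] # g) c"
    unfolding two
    by (rule sum.reindex_bij_witness[where i = "\<lambda>((i1,i2,i3,i4), (j,k,l,m)). ((i1,i2,i3,j), (i4,k,l,m))"
          and j = "\<lambda>((i1,i2,i3,i4), (j,k,l,m)). ((i1,i2,i3,j), (i4,k,l,m))"])
       (auto simp: dv_commute c)
  finally show ?thesis .
qed

section \<open>Renaming and separating vertices, derivatives of evaluations\<close>

lemma dv_relabel: "inj m \<Longrightarrow> dv (m v) i c \<circ> m = dv v i (c \<circ> m)"
  by (auto simp: dv_def fun_eq_iff inj_eq)

lemma dv4_relabel:
  assumes "inj m" "length b = 4"
  shows "dv4 (map m b) ix c \<circ> m = dv4 b ix (c \<circ> m)"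
  using assms by (cases ix) (simp add: dv_relabel)

text \<open>For injective \<open>m\<close>, differentiating the content of \<open>m v\<close> and
  then pulling back along \<open>m\<close> is the same as differentiating the pulled back content of
  \<open>v\<close>.\<close>

lemma gev_relabel:
  assumes "inj m" "\<forall>b\<in>set g. length b = 4"
  shows "gev (m ` V) x (map (map m) g) c = gev V x g (c \<circ> m)"
  using assms(2)
proof (induction g arbitrary: c)
  case Nil
  then show ?case using assms(1) by (simp add: prod.reindex inj_on_subset)
next
  case (Cons b g)
  have "gev (m ` V) x (map (map m) g) (dv4 (map m b) ix c) = gev V x g (dv4 b ix (c \<circ> m))" for ix
    using Cons.IH[of "dv4 (map m b) ix c"] Cons.prems dv4_relabel[OF assms(1), of b ix c]
    by (metis list.set_intros(1,2))
  then show ?case by (simp only: gev_Cons list.map)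
qed

lemma dv_other [simp]: "w \<noteq> v \<Longrightarrow> dv v i c w = c w"
  by (simp add: dv_def)

lemma dv4_other: "length b = 4 \<Longrightarrow> w \<notin> set b \<Longrightarrow> dv4 b ix c w = c w"
proof -
  assume b: "length b = 4" "w \<notin> set b"
  obtain i j k l where ix: "ix = (i, j, k, l)" by (metis surj_pair)
  have "w \<noteq> b ! n" if "n < 4" for n using b that nth_mem by metis
  then show ?thesis by (simp add: ix dv_def)
qed

text \<open>No bracket reaches \<open>W\<close>, so these contents leave all sums as
  undifferentiated factors. This detaches the vertices of P from those of the Hamiltonian in
  \<open>hamiltonian_bracket\<close>.\<close>

lemma gev_split:
  assumes "\<forall>b\<in>set g. length b = 4 \<and> set b \<subseteq> V" "finite V" "finite W" "V \<inter> W = {}"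
  shows "gev (V \<union> W) x g c = (\<Prod>w\<in>W. c w x) * gev V x g c"
  using assms(1)
proof (induction g arbitrary: c)
  case Nil
  then show ?case using assms by (simp add: prod.union_disjoint)
next
  case (Cons b g)
  have "(\<Prod>w\<in>W. dv4 b ix c w x) = (\<Prod>w\<in>W. c w x)" for ix
  proof (intro prod.cong refl)
    fix w assume "w \<in> W"
    then have "w \<notin> set b" "length b = 4" using Cons.prems assms(4) by auto
    from dv4_other[OF this(2,1)] show "dv4 b ix c w x = c w x" by simp
  qed
  then have "gev (V \<union> W) x g (dv4 b ix c) = (\<Prod>w\<in>W. c w x) * gev V x g (dv4 b ix c)" for ix
    using Cons.IH[of "dv4 b ix c"] Cons.prems by simp
  then have "gev (V \<union> W) x (b # g) c = (\<Sum>ix\<in>UNIV. lc4 ix * ((\<Prod>w\<in>W. c w x) * gev V x g (dv4 b ix c)))"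
    by (simp only: gev_Cons)
  also have "\<dots> = (\<Prod>w\<in>W. c w x) * gev V x (b # g) c"
    unfolding gev_Cons sum_distrib_left by (intro sum.cong refl) simp
  finally show ?case .
qed

lemma smooth_gev:
  assumes "smooth_contents c"
  shows "smooth (\<lambda>x. gev V x g c)"
  using assms
proof (induction g arbitrary: c)
  case Nil
  then show ?case by (auto intro!: smooth_prod simp: smooth_contents_def)
next
  case (Cons b g)
  then show ?case unfolding gev_Cons by (intro smooth_sum smooth_cmult) auto
qed

text \<open>The Leibniz rule for graphs: a further derivative acts on one vertex at a time and
  commutes with the brackets. Both the expansion of \<open>d_P H\<close> and the divergence of a
  graph field come from it.\<close>

lemma pd_gev:
  assumes "smooth_contents c" "finite V"
  shows "pd i (\<lambda>x. gev V x g c) x = (\<Sum>v\<in>V. gev V x g (dv v i c))"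
  using assms(1)
proof (induction g arbitrary: c)
  case Nil
  have "pd i (\<lambda>x. \<Prod>v\<in>V. c v x) x = (\<Sum>v\<in>V. \<Prod>w\<in>V. (if w = v then pd i (c v) else c w) x)"
    using Nil assms(2) by (intro pd_prod) (auto simp: smooth_contents_def)
  also have "\<dots> = (\<Sum>v\<in>V. \<Prod>w\<in>V. dv v i c w x)"
    by (intro sum.cong prod.cong) (auto simp: dv_def)
  finally show ?case by simp
next
  case (Cons b g)
  have "pd i (\<lambda>x. \<Sum>ix\<in>UNIV. lc4 ix * gev V x g (dv4 b ix c)) x
      = (\<Sum>ix\<in>UNIV. lc4 ix * pd i (\<lambda>x. gev V x g (dv4 b ix c)) x)"
    using Cons.prems
    by (subst pd_sum) (auto intro!: sum.cong pd_cmult smooth_differentiable smooth_cmult smooth_gev)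
  also have "\<dots> = (\<Sum>ix\<in>UNIV. lc4 ix * (\<Sum>v\<in>V. gev V x g (dv v i (dv4 b ix c))))"
    using Cons by simp
  also have "\<dots> = (\<Sum>v\<in>V. gev V x (b # g) (dv v i c))"
    unfolding gev_Cons sum_distrib_left using Cons.prems
    by (subst sum.swap) (simp add: dv4_dv_commute)
  finally show ?case by (simp add: gev_Cons)
qed

section \<open>Micro-graphs as bracket graphs\<close>

text \<open>The order is reversed because \<open>sum_decorations\<close> peels off the Levi-Civita
  vertex with the highest number, which therefore heads the list.\<close>

definition graph_of :: "nat \<Rightarrow> micrograph \<Rightarrow> nat list list" where
  "graph_of n t = map (\<lambda>k. map (t k) [1, 2, 3, 4]) (rev [1..<Suc n])"

lemma graph_of_Suc: "graph_of (Suc n) t = map (t (Suc n)) [1, 2, 3, 4] # graph_of n t"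
  by (simp add: graph_of_def)

lemma incoming_Suc:
  "incoming (Suc n) t (\<sigma>(Suc n := s)) v
     = incoming n t \<sigma> v @ [s e. e \<leftarrow> [1, 2, 3, 4], t (Suc n) e = v]"
proof -
  let ?f = "\<lambda>\<sigma> k. concat (map (\<lambda>e. if t k e = v then [\<sigma> k e] else []) [1, 2, 3, 4])"
  have "[1..<Suc (Suc n)] = [1..<Suc n] @ [Suc n]" by simp
  then have "incoming (Suc n) t (\<sigma>(Suc n := s)) v
      = concat (map (?f (\<sigma>(Suc n := s))) [1..<Suc n]) @ ?f (\<sigma>(Suc n := s)) (Suc n)"
    by (simp only: incoming_def map_append concat_append list.map concat.simps append_Nil2)
  also have "map (?f (\<sigma>(Suc n := s))) [1..<Suc n] = map (?f \<sigma>) [1..<Suc n]"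
    by (intro map_cong) auto
  finally show ?thesis by (simp only: incoming_def fun_upd_same)
qed

lemma foldr_pd_dv4:
  "(\<lambda>v. foldr pd [s e. e \<leftarrow> [1, 2, 3, 4], t e = v] (c v))
     = dv4 (map t [1, 2, 3, 4]) (s 1, s 2, s 3, s 4) c"
  by (auto simp: dv_def fun_eq_iff)

lemma sum_fun4: "(\<Sum>s\<in>(UNIV :: (4 \<Rightarrow> 'a::finite) set). F (s 1, s 2, s 3, s 4)) = (\<Sum>ix\<in>UNIV. F ix)"
proof (rule sum.reindex_bij_witness[where j = "\<lambda>s. (s 1, s 2, s 3, s 4)"
      and i = "\<lambda>(i, j, k, l) e. if e = 1 then i else if e = 2 then j else if e = 3 then k else l"])
  fix s :: "4 \<Rightarrow> 'a"
  show "(case (s 1, s 2, s 3, s 4) of (i, j, k, l) \<Rightarrow>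
      \<lambda>e. if e = 1 then i else if e = 2 then j else if e = 3 then k else l) = s"
    using exhaust_4 by (fastforce simp: fun_eq_iff)
qed auto

text \<open>A decoration of \<open>Suc n\<close> vertices consists of one of the first
  \<open>n\<close> and of four indices at the last, so the sum is an iteration of brackets.
  Generalizing over \<open>c\<close> lets the induction hypothesis absorb the derivatives issued by
  the last vertex; \<Phi> stays arbitrary to serve graphs with and without sink.\<close>

lemma sum_decorations:
  "(\<Sum>\<sigma>\<in>{1..n} \<rightarrow>\<^sub>E (UNIV :: (4 \<Rightarrow> 4) set).
      (\<Prod>k\<in>{1..n}. levi_civita (\<sigma> k 1) (\<sigma> k 2) (\<sigma> k 3) (\<sigma> k 4))
      * \<Phi> (\<lambda>v. foldr pd (incoming n t \<sigma> v) (c v)))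
   = foldr brk (graph_of n t) \<Phi> c"
proof (induction n arbitrary: c)
  case 0
  then show ?case by (simp add: graph_of_def incoming_def)
next
  case (Suc n)
  let ?lc = "\<lambda>s :: 4 \<Rightarrow> 4. levi_civita (s 1) (s 2) (s 3) (s 4)"
  let ?E = "{1..n} \<rightarrow>\<^sub>E (UNIV :: (4 \<Rightarrow> 4) set)"
  let ?b = "map (t (Suc n)) [1, 2, 3, 4]"
  have ins: "{1..Suc n} = insert (Suc n) {1..n}" by auto
  have "(\<Sum>\<sigma>\<in>{1..Suc n} \<rightarrow>\<^sub>E UNIV. (\<Prod>k\<in>{1..Suc n}. ?lc (\<sigma> k))
        * \<Phi> (\<lambda>v. foldr pd (incoming (Suc n) t \<sigma> v) (c v)))
    = (\<Sum>(s, \<sigma>)\<in>UNIV \<times> ?E. (\<Prod>k\<in>{1..Suc n}. ?lc ((\<sigma>(Suc n := s)) k))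
        * \<Phi> (\<lambda>v. foldr pd (incoming (Suc n) t (\<sigma>(Suc n := s)) v) (c v)))"
    unfolding ins PiE_insert_eq
    by (subst sum.reindex[OF inj_combinator]) (auto simp: case_prod_unfold)
  also have "\<dots> = (\<Sum>s\<in>UNIV. \<Sum>\<sigma>\<in>?E. (\<Prod>k\<in>{1..Suc n}. ?lc ((\<sigma>(Suc n := s)) k))
        * \<Phi> (\<lambda>v. foldr pd (incoming (Suc n) t (\<sigma>(Suc n := s)) v) (c v)))"
    by (simp add: sum.cartesian_product)
  also have "\<dots> = (\<Sum>s\<in>UNIV. ?lc s * (\<Sum>\<sigma>\<in>?E. (\<Prod>k\<in>{1..n}. ?lc (\<sigma> k))
        * \<Phi> (\<lambda>v. foldr pd (incoming n t \<sigma> v) (dv4 ?b (s 1, s 2, s 3, s 4) c v))))"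
    unfolding sum_distrib_left
  proof (intro sum.cong refl, goal_cases)
    case (1 s \<sigma>)
    have "(\<Prod>k\<in>{1..Suc n}. ?lc ((\<sigma>(Suc n := s)) k)) = ?lc s * (\<Prod>k\<in>{1..n}. ?lc (\<sigma> k))"
      unfolding ins by (subst prod.insert) (auto intro!: prod.cong)
    moreover have "(\<lambda>v. foldr pd (incoming (Suc n) t (\<sigma>(Suc n := s)) v) (c v))
        = (\<lambda>v. foldr pd (incoming n t \<sigma> v) (dv4 ?b (s 1, s 2, s 3, s 4) c v))"
      unfolding foldr_pd_dv4[symmetric] by (simp only: incoming_Suc foldr_append comp_apply)
    ultimately show ?case by (simp only: mult.assoc)
  qed
  also have "\<dots> = (\<Sum>s\<in>(UNIV :: (4 \<Rightarrow> 4) set). lc4 (s 1, s 2, s 3, s 4)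
      * foldr brk (graph_of n t) \<Phi> (dv4 ?b (s 1, s 2, s 3, s 4) c))"
    by (simp only: Suc.IH lc4.simps)
  also have "\<dots> = foldr brk (graph_of (Suc n) t) \<Phi> c"
    unfolding graph_of_Suc foldr.simps comp_apply brk_def[of ?b]
    by (rule sum_fun4[where F = "\<lambda>ix. lc4 ix * foldr brk (graph_of n t) \<Phi> (dv4 ?b ix c)"])
  finally show ?case .
qed

text \<open>Edges with equal indices count separately in the list, unlike in its set of entries.
  Hence the one edge into a sink gives a list with one entry.\<close>

lemma length_incoming:
  "length (incoming n t \<sigma> v) = card {(k, e). k \<in> {1..n} \<and> t k e = v}"
proof -
  let ?l = "List.product [1..<Suc n] [1, 2, 3, 4 :: 4]"
  have "incoming n t \<sigma> v = map (\<lambda>(k, e). \<sigma> k e) (filter (\<lambda>(k, e). t k e = v) ?l)"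
    unfolding incoming_def product_concat_map filter_concat map_concat map_map comp_def
    by (intro arg_cong[where f = concat] map_cong refl) (simp only: list.map filter.simps concat.simps prod.case, simp)
  moreover have "distinct ?l" by (intro distinct_product) auto
  moreover have "set (filter (\<lambda>(k, e). t k e = v) ?l) = {(k, e). k \<in> {1..n} \<and> t k e = v}"
    using UNIV_4 by auto
  ultimately show ?thesis
    using distinct_card[OF distinct_filter, of ?l "\<lambda>(k, e). t k e = v"] by simp
qed

definition cont :: "scalar_field \<Rightarrow> scalar_field \<Rightarrow> scalar_field \<Rightarrow> scalar_field \<Rightarrow> contents" where
  "cont \<rho> a b s v = (if v = 0 then s else if v \<le> 3 then \<rho> else if v \<le> 6 then a else b)"

lemma smooth_cont [simp]:
  "smooth \<rho> \<Longrightarrow> smooth a \<Longrightarrow> smooth b \<Longrightarrow> smooth s \<Longrightarrow> smooth_contents (cont \<rho> a b s)"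
  by (auto simp: smooth_contents_def cont_def)

text \<open>The only edge into the sink has some index \<open>j\<close>, and differentiating the
  \<open>i\<close>-th coordinate in direction \<open>j\<close> yields just the factor that compares
  the set of incoming indices with \<open>{i}\<close>.\<close>

lemma evaluation_sink:
  assumes "card {(k, e). k \<in> {1..3} \<and> t k e = 0} = 1"
  shows "evaluation 3 t \<rho> a b {i} x = gev {0..9} x (graph_of 3 t) (cont \<rho> a b (\<lambda>x. x $ i))"
    and "\<nexists>i. I = {i} \<Longrightarrow> evaluation 3 t \<rho> a b I x = 0"
proof -
  let ?c = "cont \<rho> a b (\<lambda>x. x $ i)"
  have one: "\<exists>j. incoming 3 t \<sigma> 0 = [j]" for \<sigma>
    using length_incoming[of 3 t \<sigma> 0] assms by (metis One_nat_def length_0_conv length_Suc_conv)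
  have "(\<Prod>v\<in>{1..3*3}. foldr pd (incoming 3 t \<sigma> v) (content 3 \<rho> a b v) x)
        * (if set (incoming 3 t \<sigma> 0) = {i} then 1 else 0)
      = (\<Prod>v\<in>{0..9}. foldr pd (incoming 3 t \<sigma> v) (?c v) x)" for \<sigma>
  proof -
    obtain j where j: "incoming 3 t \<sigma> 0 = [j]" using one by blast
    have "{0..9::nat} = insert 0 {1..9}" by auto
    then have "(\<Prod>v\<in>{0..9}. foldr pd (incoming 3 t \<sigma> v) (?c v) x)
      = foldr pd (incoming 3 t \<sigma> 0) (?c 0) x * (\<Prod>v\<in>{1..9}. foldr pd (incoming 3 t \<sigma> v) (?c v) x)"
      by simp
    also have "foldr pd (incoming 3 t \<sigma> 0) (?c 0) x = (if set (incoming 3 t \<sigma> 0) = {i} then 1 else 0)"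
      by (auto simp: j cont_def pd_coord)
    also have "(\<Prod>v\<in>{1..9}. foldr pd (incoming 3 t \<sigma> v) (?c v) x)
        = (\<Prod>v\<in>{1..3*3}. foldr pd (incoming 3 t \<sigma> v) (content 3 \<rho> a b v) x)"
      by (intro prod.cong) (auto simp: cont_def content_def)
    finally show ?thesis by simp
  qed
  then show "evaluation 3 t \<rho> a b {i} x = gev {0..9} x (graph_of 3 t) ?c"
    unfolding evaluation_def gev_def sum_decorations[symmetric] by (simp only: mult.assoc)
  show "evaluation 3 t \<rho> a b I x = 0" if "\<nexists>i. I = {i}"
  proof -
    have "set (incoming 3 t \<sigma> 0) \<noteq> I" for \<sigma>
      using one[of \<sigma>] that by force
    then show ?thesis by (simp add: evaluation_def)
  qed
qed

lemma evaluation_no_sink: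
  assumes "\<And>k e. k \<in> {1..n} \<Longrightarrow> t k e \<noteq> 0"
  shows "evaluation n t \<rho> a b {} x = gev {1..3*n} x (graph_of n t) (content n \<rho> a b)"
    and "I \<noteq> {} \<Longrightarrow> evaluation n t \<rho> a b I x = 0"
proof -
  have "{(k, e). k \<in> {1..n} \<and> t k e = 0} = {}"
    using assms by auto
  then have "length (incoming n t \<sigma> 0) = 0" for \<sigma>
    by (simp only: length_incoming card.empty)
  then have "incoming n t \<sigma> 0 = []" for \<sigma>
    by (simp only: length_0_conv)
  then show "evaluation n t \<rho> a b {} x = gev {1..3*n} x (graph_of n t) (content n \<rho> a b)"
    "I \<noteq> {} \<Longrightarrow> evaluation n t \<rho> a b I x = 0"
    by (auto simp: evaluation_def gev_def sum_decorations[symmetric])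
qed

section \<open>Brackets with the Nambu bivector\<close>

lemma wedge_sign_empty [simp]: "wedge_sign {} K = 1" "wedge_sign J {} = 1"
  by (simp_all add: wedge_sign_def)

lemma wedge_sign_single: "wedge_sign {i} {j} = (if j < i then -1 else 1)"
proof -
  have "{(k, l) \<in> {i} \<times> {j}. l < k} = (if j < i then {(i, j)} else {})" by auto
  then show ?thesis by (simp add: wedge_sign_def)
qed

lemma wedge_sign_square: "wedge_sign {i} {j} * wedge_sign {i} {j} = 1"
  by (simp add: wedge_sign_single)

lemma wedge_sign_commute: "i \<noteq> j \<Longrightarrow> wedge_sign {j} {i} = - wedge_sign {i} {j}"
  by (auto simp: wedge_sign_single)

lemma wedge_coord_vec:
  "wedge (coord_vec i) (coord_vec j) K x = (if i \<noteq> j \<and> K = {i, j} then wedge_sign {i} {j} else 0)"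
proof (cases "i \<noteq> j \<and> K = {i, j}")
  case True
  have "wedge (coord_vec i) (coord_vec j) K x = (\<Sum>J\<in>{{i}}. wedge_sign J (K - J))"
    unfolding wedge_def coord_vec_def
    by (intro sum.mono_neutral_cong_right) (use True in auto)
  moreover have "K - {i} = {j}" using True by auto
  ultimately show ?thesis using True by simp
next
  case False
  have "coord_vec i J x * coord_vec j (K - J) x = 0" if "J \<subseteq> K" for J
    using that False by (auto simp: coord_vec_def)
  then have "wedge (coord_vec i) (coord_vec j) K x = 0"
    unfolding wedge_def by (intro sum.neutral) (auto simp: mult.assoc)
  with False show ?thesis by auto
qed

lemma nambu_coeff_skew: "nambu_coeff \<rho> a b j i x = - nambu_coeff \<rho> a b i j x"
  unfolding nambu_coeff_def sum_negf[symmetric]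
  by (intro sum.cong refl) (subst levi_civita_swap(1), simp)

lemma nambu_coeff_self [simp]: "nambu_coeff \<rho> a b i i x = 0"
  using nambu_coeff_skew[of \<rho> a b i i x] by simp

text \<open>The two orders of the pair contribute equally, which cancels the factor 1/2. The sign
  compares the order of \<open>i\<close> and \<open>j\<close> with the increasing order underlying
  the basis.\<close>

lemma nambu_pair:
  assumes "i \<noteq> j"
  shows "nambu \<rho> a b {i, j} x = wedge_sign {i} {j} * nambu_coeff \<rho> a b i j x"
proof -
  let ?P = "\<lambda>i j. nambu_coeff \<rho> a b i j x"
  have "(\<Sum>k\<in>UNIV. \<Sum>l\<in>UNIV. ?P k l * wedge (coord_vec k) (coord_vec l) {i, j} x)
      = (\<Sum>(k, l)\<in>UNIV. ?P k l * wedge (coord_vec k) (coord_vec l) {i, j} x)"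
    by (simp add: sum.cartesian_product flip: UNIV_Times_UNIV)
  also have "\<dots> = (\<Sum>(k, l)\<in>{(i, j), (j, i)}. ?P k l * wedge (coord_vec k) (coord_vec l) {i, j} x)"
    by (intro sum.mono_neutral_right) (auto simp: wedge_coord_vec doubleton_eq_iff split: if_splits)
  also have "\<dots> = ?P i j * wedge_sign {i} {j} + ?P j i * wedge_sign {j} {i}"
    using assms by (simp add: wedge_coord_vec insert_commute)
  also have "\<dots> = 2 * (wedge_sign {i} {j} * ?P i j)"
    using assms by (simp add: wedge_sign_commute[of i j] nambu_coeff_skew[of \<rho> a b j i])
  finally show ?thesis by (simp add: nambu_def)
qed

lemma nambu_other:
  assumes "\<nexists>i j. i \<noteq> j \<and> K = {i, j}"
  shows "nambu \<rho> a b K = (\<lambda>x. 0)"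
proof -
  have "wedge (coord_vec i) (coord_vec j) K x = 0" for i j x
    using assms by (subst wedge_coord_vec) auto
  then show ?thesis by (simp add: nambu_def)
qed

text \<open>Removing one odd variable from the bivector leaves a vector field, and the two signs
  from the ordering of the basis cancel.\<close>

lemma right_xi_nambu:
  "right_xi m (nambu \<rho> a b) I x = (case_option 0 (\<lambda>i. nambu_coeff \<rho> a b i m x) (if \<exists>i. I = {i} then Some (THE i. I = {i}) else None))"
proof (cases "\<exists>i. I = {i}")
  case True
  then obtain i where I: "I = {i}" by blast
  have "{m, i} = {i, m}" by auto
  then show ?thesis
    unfolding right_xi_def I using nambu_pair[of i m \<rho> a b x] wedge_sign_square[of i m]
    by (auto simp: mult.assoc[symmetric])
next
  case False
  have "nambu \<rho> a b (insert m I) x = 0" if "m \<notin> I"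
  proof -
    have "\<nexists>i j. i \<noteq> j \<and> insert m I = {i, j}"
    proof
      assume "\<exists>i j. i \<noteq> j \<and> insert m I = {i, j}"
      then obtain i j where ij: "i \<noteq> j" "insert m I = {i, j}" by blast
      with that have "I = {i, j} - {m}" "m \<in> {i, j}" by auto
      then have "I = {i} \<or> I = {j}" using ij by auto
      with False show False by blast
    qed
    from nambu_other[OF this] show ?thesis by simp
  qed
  with False show ?thesis by (auto simp: right_xi_def)
qed

lemma right_xi_nambu_single [simp]: "right_xi m (nambu \<rho> a b) {i} x = nambu_coeff \<rho> a b i m x"
  by (simp add: right_xi_nambu)

lemma right_xi_nambu_other: "\<nexists>i. I = {i} \<Longrightarrow> right_xi m (nambu \<rho> a b) I x = 0"
  by (simp add: right_xi_nambu)

text \<open>A function contains no odd variable, so only the first half of the Schouten bracket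
  contributes. What remains is the Hamiltonian vector field of \<open>H {}\<close>, with dH in the
  second slot of P.\<close>

lemma schouten_nambu_function:
  assumes H: "\<And>I. I \<noteq> {} \<Longrightarrow> H I = (\<lambda>x. 0)"
  shows "schouten (nambu \<rho> a b) H {i} x = (\<Sum>m\<in>UNIV. nambu_coeff \<rho> a b i m x * pd m (H {}) x)"
    and "\<nexists>i. I = {i} \<Longrightarrow> schouten (nambu \<rho> a b) H I x = 0"
proof -
  have 1: "wedge A (pd_coeffs m H) I x = A I x * pd m (H {}) x" for A m and I :: "4 set"
  proof -
    have "wedge A (pd_coeffs m H) I x = (\<Sum>J\<in>{I}. wedge_sign J (I - J) * A J x * pd_coeffs m H (I - J) x)"
      unfolding wedge_def
    proof (intro sum.mono_neutral_right ballI)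
      fix J assume "J \<in> Pow I - {I}"
      then have "I - J \<noteq> {}" by auto
      then show "wedge_sign J (I - J) * A J x * pd_coeffs m H (I - J) x = 0"
        by (simp add: pd_coeffs_def H)
    qed auto
    then show ?thesis by (simp add: pd_coeffs_def)
  qed
  have 2: "wedge A (left_xi m H) I x = 0" for A m and I :: "4 set"
    unfolding wedge_def by (intro sum.neutral) (auto simp: left_xi_def H)
  show "schouten (nambu \<rho> a b) H {i} x = (\<Sum>m\<in>UNIV. nambu_coeff \<rho> a b i m x * pd m (H {}) x)"
    by (simp add: schouten_def 1 2)
  show "\<nexists>i. I = {i} \<Longrightarrow> schouten (nambu \<rho> a b) H I x = 0"
    by (simp add: schouten_def 1 2 right_xi_nambu_other)
qed

lemma smooth_nambu_coeff:
  "smooth \<rho> \<Longrightarrow> smooth a \<Longrightarrow> smooth b \<Longrightarrow> smooth (nambu_coeff \<rho> a b i j)"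
  unfolding nambu_coeff_def by (intro smooth_sum smooth_mult smooth_const smooth_pd)

text \<open>The right side is minus the component of the Lie derivative of P along \<open>Y\<close>.
  The sign in front removes the dependence of the coefficient on the order of the basis.\<close>

lemma schouten_nambu_vector:
  assumes Y: "\<And>I. \<nexists>i. I = {i} \<Longrightarrow> Y I = (\<lambda>x. 0)" and "i \<noteq> j"
    and "smooth \<rho>" "smooth a" "smooth b"
  shows "wedge_sign {i} {j} * schouten (nambu \<rho> a b) Y {i, j} x
    = (\<Sum>m\<in>UNIV. nambu_coeff \<rho> a b i m x * pd m (Y {j}) x - nambu_coeff \<rho> a b j m x * pd m (Y {i}) x
        - Y {m} x * pd m (nambu_coeff \<rho> a b i j) x)"
proof -
  let ?P = "nambu \<rho> a b" and ?w = "wedge_sign {i} {j}"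
  have P: "Pow {i, j} = {{}, {i}, {j}, {i, j}}" by auto
  have ne: "{i, j} - {i} = {j}" "{i, j} - {j} = {i}" "{i} \<noteq> {j}" "{i, j} \<noteq> {i}" "{i, j} \<noteq> {j}"
    using assms(2) by auto
  have npair: "\<nexists>k. {i, j} = {k}" using assms(2) by auto
  have 1: "wedge (right_xi m ?P) (pd_coeffs m Y) {i, j} x
      = ?w * (nambu_coeff \<rho> a b i m x * pd m (Y {j}) x - nambu_coeff \<rho> a b j m x * pd m (Y {i}) x)" for m
    unfolding wedge_def P using ne assms(2) npair
    by (simp add: right_xi_nambu_other pd_coeffs_def wedge_sign_commute[of i j] algebra_simps)
  have l: "left_xi m Y I x = 0" if "I \<noteq> {}" for m I
  proof (cases "m \<in> I")
    case False
    have "\<nexists>k. insert m I = {k}" using that False by auto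
    from Y[OF this] show ?thesis by (simp add: left_xi_def)
  qed (simp add: left_xi_def)
  have l0: "left_xi m Y {} x = Y {m} x" for m
    by (simp add: left_xi_def)
  have pdP: "pd m (?P {i, j}) x = ?w * pd m (nambu_coeff \<rho> a b i j) x" for m
  proof -
    have "?P {i, j} = (\<lambda>x. ?w * nambu_coeff \<rho> a b i j x)"
      using nambu_pair[OF assms(2)] by auto
    then show ?thesis
      by (simp add: pd_cmult smooth_differentiable smooth_nambu_coeff assms)
  qed
  have 2: "wedge (pd_coeffs m ?P) (left_xi m Y) {i, j} x = ?w * (Y {m} x * pd m (nambu_coeff \<rho> a b i j) x)" for m
    unfolding wedge_def P using ne assms(2)
    by (simp add: l l0 pd_coeffs_def pdP)
  show ?thesis
    unfolding schouten_def 1 2 right_diff_distrib[symmetric] sum_distrib_left[symmetric]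
    by (simp add: mult.assoc[symmetric] wedge_sign_square)
qed

section \<open>Consequences of closedness\<close>

lemma pd_cong_open:
  assumes "open U" "x \<in> U" "\<And>y. y \<in> U \<Longrightarrow> f y = g y" "f differentiable (at x)"
  shows "pd i f x = pd i g x"
  unfolding pd_def using frechet_derivative_transform_within_open[of f x U g] assms by metis

lemma pd_exp: "pd i (\<lambda>x. exp (c * x $ 1)) = (\<lambda>x. (if i = 1 then c else 0) * exp (c * x $ 1))"
proof
  fix x :: "real^4"
  have "((\<lambda>x. exp (c * x $ 1)) has_derivative (\<lambda>h. exp (c * x $ 1) * (c * h $ 1))) (at x)"
    by (auto intro!: derivative_eq_intros bounded_linear_imp_has_derivative bounded_linear_vec_nth)
  from pd_eqI[OF this] show "pd i (\<lambda>x. exp (c * x $ 1)) x = (if i = 1 then c else 0) * exp (c * x $ 1)"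
    by (auto simp: axis_def)
qed

lemma smooth_exp: "smooth (\<lambda>x. exp (c * x $ 1))"
proof (rule smooth_coinduct[where P = "\<lambda>f. \<exists>d. f = (\<lambda>x. d * exp (c * x $ 1))"], goal_cases)
  case 1
  show ?case by (rule exI[of _ 1]) simp
next
  have diff: "(\<lambda>x::real^4. exp (c * x $ 1)) differentiable (at x)" for x
    by (rule differentiableI[where f' = "\<lambda>h. exp (c * x $ 1) * (c * h $ 1)"])
       (auto intro!: derivative_eq_intros bounded_linear_imp_has_derivative bounded_linear_vec_nth)
  case (2 f x)
  then show ?case using diff by (auto intro!: differentiable_mult)
next
  have diff: "(\<lambda>x::real^4. exp (c * x $ 1)) differentiable (at x)" for x
    by (rule differentiableI[where f' = "\<lambda>h. exp (c * x $ 1) * (c * h $ 1)"])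
       (auto intro!: derivative_eq_intros bounded_linear_imp_has_derivative bounded_linear_vec_nth)
  case (3 f i)
  then obtain d where "f = (\<lambda>x. d * exp (c * x $ 1))" by blast
  then have "pd i f = (\<lambda>x. (d * (if i = 1 then c else 0)) * exp (c * x $ 1))"
    using pd_cmult[OF diff, of i d] by (auto simp: pd_exp)
  then show ?case by blast
qed

section \<open>Families of the form exp(k t x1) times a polynomial in t\<close>

text \<open>Exponents may repeat in the list, so that adding polynomials in \<open>t\<close> is
  concatenation.\<close>

definition tpoly :: "(nat \<times> scalar_field) list \<Rightarrow> real \<Rightarrow> scalar_field" where
  "tpoly L t x = (\<Sum>(n, G)\<leftarrow>L. t ^ n * G x)"

text \<open>The list of coefficients is fixed before \<open>t\<close>. The weight \<open>k\<close>
  counts the factors that have been multiplied by the exponential and is additive under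
  products.\<close>

definition exp_poly :: "real \<Rightarrow> (real \<Rightarrow> scalar_field) \<Rightarrow> bool" where
  "exp_poly k F \<longleftrightarrow> (\<exists>L. (\<forall>(n, G)\<in>set L. smooth G) \<and> (\<forall>t. F t = (\<lambda>x. exp (k * t * x $ 1) * tpoly L t x)))"

lemma tpoly_simps [simp]: "tpoly [] t x = 0" "tpoly ((n, G) # L) t x = t ^ n * G x + tpoly L t x"
  by (simp_all add: tpoly_def)

lemma tpoly_append: "tpoly (L @ M) t x = tpoly L t x + tpoly M t x"
  by (simp add: tpoly_def)

lemma smooth_tpoly: "\<forall>(n, G)\<in>set L. smooth G \<Longrightarrow> smooth (tpoly L t)"
proof (induction L)
  case Nil
  have "tpoly [] t = (\<lambda>x. 0)" by (simp add: fun_eq_iff)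
  then show ?case by simp
next
  case (Cons p L)
  obtain n G where p: "p = (n, G)" by force
  have "tpoly (p # L) t = (\<lambda>x. t ^ n * G x + tpoly L t x)" by (simp add: fun_eq_iff p)
  then show ?case using Cons by (auto intro!: smooth_add smooth_cmult simp: p)
qed

lemma exp_polyI:
  "(\<And>n G. (n, G) \<in> set L \<Longrightarrow> smooth G) \<Longrightarrow> (\<And>t x. F t x = exp (k * t * x $ 1) * tpoly L t x) \<Longrightarrow> exp_poly k F"
  unfolding exp_poly_def by (rule exI[of _ L]) auto

lemma exp_polyE:
  assumes "exp_poly k F"
  obtains L where "\<And>n G. (n, G) \<in> set L \<Longrightarrow> smooth G" "\<And>t x. F t x = exp (k * t * x $ 1) * tpoly L t x"
    "\<And>t. smooth (F t)"
proof -
  obtain L where L: "\<forall>(n, G)\<in>set L. smooth G" "\<forall>t. F t = (\<lambda>x. exp (k * t * x $ 1) * tpoly L t x)"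
    using assms unfolding exp_poly_def by blast
  then show ?thesis
    by (intro that[of L]) (auto intro!: smooth_mult smooth_exp[of "k * _"] smooth_tpoly)
qed

lemma exp_poly_const: "smooth f \<Longrightarrow> exp_poly 0 (\<lambda>t. f)"
  by (rule exp_polyI[of "[(0, f)]"]) auto

lemma exp_poly_scaled: "smooth f \<Longrightarrow> exp_poly 1 (\<lambda>t x. exp (t * x $ 1) * f x)"
  by (rule exp_polyI[of "[(0, f)]"]) auto

lemma exp_poly_0: "exp_poly k (\<lambda>t x. 0)"
  by (rule exp_polyI[of "[]"]) auto

lemma exp_poly_add: "exp_poly k F \<Longrightarrow> exp_poly k G \<Longrightarrow> exp_poly k (\<lambda>t x. F t x + G t x)"
proof (elim exp_polyE)
  fix L M
  assume *: "\<And>n G. (n, G) \<in> set L \<Longrightarrow> smooth G" "\<And>t x. F t x = exp (k * t * x $ 1) * tpoly L t x"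
    "\<And>n G. (n, G) \<in> set M \<Longrightarrow> smooth G" "\<And>t x. G t x = exp (k * t * x $ 1) * tpoly M t x"
  show ?thesis
    by (rule exp_polyI[of "L @ M"]) (use * in \<open>auto simp: tpoly_append ring_distribs\<close>)
qed

lemma tpoly_mult:
  "tpoly [(n + m, \<lambda>x. G x * H x). (n, G) \<leftarrow> L, (m, H) \<leftarrow> M] t x = tpoly L t x * tpoly M t x"
proof (induction L)
  case (Cons p L)
  obtain n G where p: "p = (n, G)" by force
  have "tpoly (map (\<lambda>(m, H). (n + m, \<lambda>x. G x * H x)) M) t x = t ^ n * G x * tpoly M t x"
    by (induction M) (auto simp: power_add ring_distribs mult_ac)
  moreover have "concat (map (\<lambda>(m, H). [(n + m, \<lambda>x. G x * H x)]) M) = map (\<lambda>(m, H). (n + m, \<lambda>x. G x * H x)) M"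
    by (induction M) auto
  ultimately show ?case using Cons by (simp add: p tpoly_append ring_distribs)
qed simp

lemma exp_poly_mult: "exp_poly k F \<Longrightarrow> exp_poly l G \<Longrightarrow> exp_poly (k + l) (\<lambda>t x. F t x * G t x)"
proof (elim exp_polyE)
  fix L M
  assume *: "\<And>n G. (n, G) \<in> set L \<Longrightarrow> smooth G" "\<And>t x. F t x = exp (k * t * x $ 1) * tpoly L t x"
    "\<And>n G. (n, G) \<in> set M \<Longrightarrow> smooth G" "\<And>t x. G t x = exp (l * t * x $ 1) * tpoly M t x"
  show ?thesis
  proof (rule exp_polyI[of "[(n + m, \<lambda>x. G x * H x). (n, G) \<leftarrow> L, (m, H) \<leftarrow> M]"])
    show "smooth G" if "(n, G) \<in> set [(n + m, \<lambda>x. G x * H x). (n, G) \<leftarrow> L, (m, H) \<leftarrow> M]" for n G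
      using that *(1,3) by (auto intro!: smooth_mult)
    show "F t x * G t x = exp ((k + l) * t * x $ 1) * tpoly [(n + m, \<lambda>x. G x * H x). (n, G) \<leftarrow> L, (m, H) \<leftarrow> M] t x" for t x
      unfolding tpoly_mult *(2,4) by (simp add: ring_distribs exp_add)
  qed
qed

lemma exp_poly_cmult: "exp_poly k F \<Longrightarrow> exp_poly k (\<lambda>t x. c * F t x)"
  using exp_poly_mult[OF exp_poly_const[of "\<lambda>x. c"], of k F] by simp

lemma exp_poly_sum: "(\<And>j. j \<in> A \<Longrightarrow> exp_poly k (F j)) \<Longrightarrow> exp_poly k (\<lambda>t x. \<Sum>j\<in>A. F j t x)"
  by (induction A rule: infinite_finite_induct) (auto intro: exp_poly_0 exp_poly_add)

lemma exp_poly_prod: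
  "finite A \<Longrightarrow> (\<And>j. j \<in> A \<Longrightarrow> exp_poly (k j) (F j)) \<Longrightarrow> exp_poly (\<Sum>j\<in>A. k j) (\<lambda>t x. \<Prod>j\<in>A. F j t x)"
  by (induction A rule: finite_induct) (auto intro: exp_poly_mult exp_poly_const[of "\<lambda>x. 1"])

lemma pd_tpoly:
  assumes "\<And>n G. (n, G) \<in> set L \<Longrightarrow> smooth G"
  shows "pd i (tpoly L t) x = tpoly (map (\<lambda>(n, G). (n, pd i G)) L) t x"
  using assms
proof (induction L)
  case Nil
  have "tpoly [] t = (\<lambda>x. 0)" by (simp add: fun_eq_iff)
  then show ?case by simp
next
  case (Cons p L)
  obtain n G where p: "p = (n, G)" by force
  have "tpoly (p # L) t = (\<lambda>x. t ^ n * G x + tpoly L t x)" by (simp add: fun_eq_iff p)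
  moreover have "smooth G" "smooth (tpoly L t)"
    using Cons.prems by (auto simp: p intro: smooth_tpoly)
  moreover have "pd i (tpoly L t) x = tpoly (map (\<lambda>(n, G). (n, pd i G)) L) t x"
    by (rule Cons.IH, rule Cons.prems, rule list.set_intros(2))
  ultimately show ?case
    by (simp add: p pd_add pd_cmult smooth_differentiable smooth_cmult)
qed

lemma pd_exp_tpoly:
  assumes "\<And>n G. (n, G) \<in> set L \<Longrightarrow> smooth G"
  shows "pd i (\<lambda>x. exp (c * x $ 1) * tpoly L t x) x
     = exp (c * x $ 1) * ((if i = 1 then c else 0) * tpoly L t x + pd i (tpoly L t) x)"
proof -
  have "smooth (tpoly L t)" using assms by (auto intro: smooth_tpoly)
  then show ?thesis
    by (subst pd_mult) (auto intro: smooth_differentiable smooth_exp simp: pd_exp algebra_simps)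
qed

text \<open>In direction 1 the derivative may fall on the exponential, which brings down
  \<open>k * t\<close> and accounts for the first half of \<open>?M\<close>, with raised
  exponents.\<close>

lemma exp_poly_pd: "exp_poly k F \<Longrightarrow> exp_poly k (\<lambda>t. pd i (F t))"
proof (elim exp_polyE)
  fix L
  assume *: "\<And>n G. (n, G) \<in> set L \<Longrightarrow> smooth G" "\<And>t x. F t x = exp (k * t * x $ 1) * tpoly L t x"
  let ?M = "map (\<lambda>(n, G). (Suc n, \<lambda>x. (if i = 1 then k else 0) * G x)) L @ map (\<lambda>(n, G). (n, pd i G)) L"
  show ?thesis
  proof (rule exp_polyI[of ?M])
    show "smooth G" if "(n, G) \<in> set ?M" for n G
      using that *(1) by (auto intro: smooth_cmult smooth_pd)
    have "tpoly (map (\<lambda>(n, G). (Suc n, \<lambda>x. (if i = 1 then k else 0) * G x)) L) t x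
        = (if i = 1 then k * t else 0) * tpoly L t x" for t x
      by (induction L) (auto simp: ring_distribs)
    moreover have "F t = (\<lambda>x. exp (k * t * x $ 1) * tpoly L t x)" for t using *(2) by auto
    ultimately show "pd i (F t) x = exp (k * t * x $ 1) * tpoly ?M t x" for t x
      using pd_exp_tpoly[of L i "k * t" t x] pd_tpoly[of L i t x] *(1)
      by (simp add: tpoly_append)
  qed
qed

text \<open>Derivatives keep the weight of each vertex, and the final product adds up the
  weights.\<close>

lemma exp_poly_gev:
  assumes "finite V" "\<And>v. v \<in> V \<Longrightarrow> exp_poly (k v) (\<lambda>t. C t v)"
  shows "exp_poly (\<Sum>v\<in>V. k v) (\<lambda>t x. gev V x g (C t))"
  using assms(2)
proof (induction g arbitrary: C)
  case Nil
  then show ?case using assms(1) by (simp add: exp_poly_prod)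
next
  case (Cons b g)
  have "exp_poly (k w) (\<lambda>t. dv v i (C t) w)"
    if "w \<in> V" "\<And>v. v \<in> V \<Longrightarrow> exp_poly (k v) (\<lambda>t. C t v)" for C :: "real \<Rightarrow> contents" and v w i
    using that by (cases "w = v") (auto simp: dv_def exp_poly_pd)
  then have "exp_poly (k w) (\<lambda>t. dv4 b ix (C t) w)" if "w \<in> V" for w ix
    using Cons.prems that by (cases ix) auto
  then have "exp_poly (\<Sum>v\<in>V. k v) (\<lambda>t x. gev V x g (dv4 b ix (C t)))" for ix
    by (intro Cons.IH)
  then show ?case unfolding gev_Cons by (intro exp_poly_sum exp_poly_cmult)
qed

text \<open>The coefficient of the highest power of \<open>t\<close> in the derivative along \<open>w\<close> comes only from the
  exponential factor, so all coefficients of \<open>F\<close> vanish by descending induction.\<close>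

lemma exp_poly_vanish:
  assumes F: "exp_poly k F" and "k \<noteq> 0" and U: "open U"
    and w: "\<And>x. x \<in> U \<Longrightarrow> w 1 x \<noteq> 0"
    and const: "\<And>t x. x \<in> U \<Longrightarrow> (\<Sum>m\<in>UNIV. w m x * pd m (F t) x) = 0"
    and x: "x \<in> U"
  shows "F 0 x = 0"
proof -
  obtain L where L: "\<And>n G. (n, G) \<in> set L \<Longrightarrow> smooth G" "\<And>t x. F t x = exp (k * t * x $ 1) * tpoly L t x"
    by (rule exp_polyE[OF F]) (rule that, assumption+)
  \<comment> \<open>Since \<open>L\<close> may repeat an exponent, the coefficient of
    \<open>t ^ n\<close> is a sum over its entries.\<close>
  define G where "G n x = (\<Sum>(m, G)\<leftarrow>L. if m = n then G x else 0)" for n x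
  obtain N where N: "\<And>n G. (n, G) \<in> set L \<Longrightarrow> n < N"
  proof -
    have "finite (fst ` set L)" by simp
    then obtain N where "\<forall>n\<in>fst ` set L. n < N" by (meson finite_nat_set_iff_bounded)
    then show ?thesis by (intro that[of N]) force
  qed
  have smG: "smooth (G n)" for n
  proof -
    have "smooth (\<lambda>x. \<Sum>(m, G)\<leftarrow>M. if m = n then G x else 0)" if "\<And>n G. (n, G) \<in> set M \<Longrightarrow> smooth G" for M
      using that
    proof (induction M)
      case (Cons p M)
      obtain l H where p: "p = (l, H)" by force
      have "smooth (\<lambda>x. if l = n then H x else 0)" using Cons.prems[of l H] by (cases "l = n") (auto simp: p)
      moreover have "smooth (\<lambda>x. \<Sum>(m, G)\<leftarrow>M. if m = n then G x else 0)"
        by (rule Cons.IH, rule Cons.prems, rule list.set_intros(2))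
      ultimately show ?case unfolding p list.map sum_list.Cons prod.case by (rule smooth_add)
    qed simp
    from this[of L] L(1) show ?thesis unfolding G_def[abs_def] by blast
  qed
  have G0: "G n = (\<lambda>x. 0)" if "n \<ge> N" for n
  proof -
    have "(\<Sum>(m, G)\<leftarrow>M. if m = n then G x else 0) = 0" if "\<And>m G. (m, G) \<in> set M \<Longrightarrow> m < n" for M :: "(nat \<times> scalar_field) list" and x
      using that
    proof (induction M)
      case (Cons p M)
      obtain l H where p: "p = (l, H)" by force
      have "(\<Sum>(m, G)\<leftarrow>M. if m = n then G x else 0) = 0"
        by (rule Cons.IH, rule Cons.prems, rule list.set_intros(2))
      moreover have "l < n" using Cons.prems[of l H] by (simp add: p)
      ultimately show ?case by (simp add: p)
    qed simp
    then show ?thesis unfolding G_def using N \<open>n \<ge> N\<close> by (metis (no_types, lifting) less_le_trans)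
  qed
  have tG: "tpoly L t y = (\<Sum>n<N. t ^ n * G n y)" for t y
  proof -
    have "tpoly M t y = (\<Sum>n<N. t ^ n * (\<Sum>(m, G)\<leftarrow>M. if m = n then G y else 0))"
      if "\<And>n G. (n, G) \<in> set M \<Longrightarrow> n < N" for M
      using that
    proof (induction M)
      case (Cons p M)
      obtain l H where p: "p = (l, H)" by force
      have "tpoly M t y = (\<Sum>n<N. t ^ n * (\<Sum>(m, G)\<leftarrow>M. if m = n then G y else 0))"
        by (rule Cons.IH, rule Cons.prems, rule list.set_intros(2))
      moreover have "(\<Sum>n<N. t ^ n * (if l = n then H y else 0)) = (\<Sum>n<N. if n = l then t ^ l * H y else 0)"
        by (intro sum.cong) auto
      moreover have "l < N" using Cons.prems[of l H] by (simp add: p)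
      ultimately show ?case by (simp add: p ring_distribs sum.distrib)
    qed simp
    then show ?thesis using N by (simp add: G_def)
  qed
  let ?W = "\<lambda>n y. \<Sum>m\<in>UNIV. w m y * pd m (G n) y"
  \<comment> \<open>The coefficient of \<open>t ^ n\<close> in the hypothesis after cancelling the
    exponential; the term with \<open>G (n - 1)\<close> arises from differentiating the
    exponential.\<close>
  have rec: "?W n y + (if n = 0 then 0 else k * w 1 y * G (n - 1) y) = 0" if y: "y \<in> U" for n y
  proof (cases "n \<le> N")
    case True
    have "(\<Sum>i\<le>N. (?W i y + (if i = 0 then 0 else k * w 1 y * G (i - 1) y)) * t ^ i) = 0" for t
    proof -
      have Ft: "F t = (\<lambda>x. exp (k * t * x $ 1) * tpoly L t x)" using L(2) by auto
      have tf: "tpoly L t = (\<lambda>y. \<Sum>n<N. t ^ n * G n y)" using tG by auto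
      have pdt: "pd m (tpoly L t) y = (\<Sum>n<N. t ^ n * pd m (G n) y)" for m
        unfolding tf
        by (subst pd_sum) (auto intro!: sum.cong pd_cmult smooth_differentiable smooth_cmult smG)
      have "0 = (\<Sum>m\<in>UNIV. w m y * pd m (F t) y)" using const[OF y] by simp
      also have "\<dots> = exp (k * t * y $ 1) * (\<Sum>m\<in>UNIV. w m y * ((if m = 1 then k * t else 0) * tpoly L t y + pd m (tpoly L t) y))"
        unfolding Ft by (simp add: pd_exp_tpoly L(1) sum_distrib_left mult.left_commute)
      finally have "0 = (\<Sum>m\<in>UNIV. w m y * ((if m = 1 then k * t else 0) * tpoly L t y + pd m (tpoly L t) y))"
        by simp
      also have "\<dots> = k * t * w 1 y * tpoly L t y + (\<Sum>m\<in>UNIV. w m y * pd m (tpoly L t) y)"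
        by (simp add: ring_distribs sum.distrib if_distrib[where f = "\<lambda>c. c * _"] if_distrib[where f = "\<lambda>c. _ * c"] cong: if_cong)
      also have "(\<Sum>m\<in>UNIV. w m y * pd m (tpoly L t) y) = (\<Sum>n<N. ?W n y * t ^ n)"
        unfolding pdt sum_distrib_left sum_distrib_right by (subst sum.swap) (simp add: mult_ac)
      also have "\<dots> = (\<Sum>n\<le>N. ?W n y * t ^ n)"
        using G0[of N] by (simp add: lessThan_Suc_atMost[symmetric])
      also have "k * t * w 1 y * tpoly L t y = (\<Sum>n<N. k * w 1 y * G n y * t ^ Suc n)"
        unfolding tG sum_distrib_left by (intro sum.cong) auto
      also have "\<dots> = (\<Sum>n\<le>N. (if n = 0 then 0 else k * w 1 y * G (n - 1) y) * t ^ n)"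
        by (subst sum.lessThan_Suc_shift[of "\<lambda>n. (if n = 0 then 0 else k * w 1 y * G (n - 1) y) * t ^ n" N, unfolded lessThan_Suc_atMost]) simp
      finally show ?thesis by (simp add: ring_distribs sum.distrib)
    qed
    then show ?thesis
      using polyfun_eq_0[of "\<lambda>i. ?W i y + (if i = 0 then 0 else k * w 1 y * G (i - 1) y)" N] True by blast
  next
    case False
    then show ?thesis using G0[of n] G0[of "n - 1"] by simp
  qed
  \<comment> \<open>The descent starts at \<open>N\<close>, where the coefficient is zero. Openness
    of \<open>U\<close> is what makes the derivatives of \<open>G (Suc n)\<close> vanish on
    \<open>U\<close> along with the function.\<close>
  have G_zero: "\<forall>y\<in>U. G n y = 0" for n
  proof (cases "n \<le> N")
    case True
    then show ?thesis
    proof (induction n rule: inc_induct)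
      case base
      then show ?case using G0 by simp
    next
      case (step n)
      show ?case
      proof
        fix y assume y: "y \<in> U"
        have "pd m (G (Suc n)) y = pd m (\<lambda>x. 0) y" for m
          using step.IH U y by (intro pd_cong_open[of U]) (auto intro: smooth_differentiable smG)
        then have "?W (Suc n) y = 0" by simp
        with rec[OF y, of "Suc n"] w[OF y] \<open>k \<noteq> 0\<close> show "G n y = 0" by simp
      qed
    qed
  qed (use G0 in auto)
  have "F 0 x = (\<Sum>n<N. 0 ^ n * G n x)" unfolding L(2) tG by simp
  also have "\<dots> = 0" using G_zero x by simp
  finally show ?thesis .
qed

section \<open>Casimirs of the Nambu bivector and closed vector fields\<close>

lemma nambu_coeff_scale: "nambu_coeff \<rho> a b i j x = \<rho> x * nambu_coeff (\<lambda>x. 1) a b i j x"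
  by (simp add: nambu_coeff_def sum_distrib_left mult.assoc)

text \<open>The antisymmetric symbol is contracted with two gradients of the same function.\<close>

lemma nambu_coeff_casimir:
  "(\<Sum>i\<in>UNIV. pd i a x * nambu_coeff \<rho> a b i j x) = 0"
  "(\<Sum>i\<in>UNIV. pd i b x * nambu_coeff \<rho> a b i j x) = 0"
proof -
  let ?A = "\<lambda>i k l. pd i a x * (\<rho> x * levi_civita i j k l * pd k a x * pd l b x)"
  let ?B = "\<lambda>i k l. pd i b x * (\<rho> x * levi_civita i j k l * pd k a x * pd l b x)"
  have "(\<Sum>i\<in>UNIV. \<Sum>k\<in>UNIV. \<Sum>l\<in>UNIV. ?A i k l) = (\<Sum>i\<in>UNIV. \<Sum>k\<in>UNIV. \<Sum>l\<in>UNIV. ?A k i l)"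
    by (rule sum.swap)
  also have "\<dots> = - (\<Sum>i\<in>UNIV. \<Sum>k\<in>UNIV. \<Sum>l\<in>UNIV. ?A i k l)"
    unfolding sum_negf[symmetric] by (intro sum.cong refl) (subst levi_civita_swap(2), simp)
  finally show "(\<Sum>i\<in>UNIV. pd i a x * nambu_coeff \<rho> a b i j x) = 0"
    by (simp add: nambu_coeff_def sum_distrib_left)
  have "(\<Sum>i\<in>UNIV. \<Sum>k\<in>UNIV. \<Sum>l\<in>UNIV. ?B i k l) = (\<Sum>k\<in>UNIV. \<Sum>i\<in>UNIV. \<Sum>l\<in>UNIV. ?B i k l)"
    by (rule sum.swap)
  also have "\<dots> = (\<Sum>k\<in>UNIV. \<Sum>i\<in>UNIV. \<Sum>l\<in>UNIV. ?B l k i)"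
    by (intro sum.cong refl sum.swap)
  also have "\<dots> = (\<Sum>i\<in>UNIV. \<Sum>k\<in>UNIV. \<Sum>l\<in>UNIV. ?B l k i)"
    by (rule sum.swap)
  also have "\<dots> = - (\<Sum>i\<in>UNIV. \<Sum>k\<in>UNIV. \<Sum>l\<in>UNIV. ?B i k l)"
    unfolding sum_negf[symmetric] by (intro sum.cong refl) (subst levi_civita_swap(3), simp)
  finally show "(\<Sum>i\<in>UNIV. pd i b x * nambu_coeff \<rho> a b i j x) = 0"
    by (simp add: nambu_coeff_def sum_distrib_left)
qed

definition vector_field :: "multivector_field \<Rightarrow> bool" where
  "vector_field Y \<longleftrightarrow> (\<forall>i. smooth (Y {i})) \<and> (\<forall>I. (\<nexists>i. I = {i}) \<longrightarrow> Y I = (\<lambda>x. 0))"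

lemma closed_components:
  assumes sm: "smooth \<rho>" "smooth a" "smooth b" and Y: "vector_field Y"
    and closed: "schouten (nambu \<rho> a b) Y = (\<lambda>I x. 0)"
  shows "(\<Sum>m\<in>UNIV. nambu_coeff \<rho> a b i m x * pd m (Y {j}) x - nambu_coeff \<rho> a b j m x * pd m (Y {i}) x
            - Y {m} x * pd m (nambu_coeff \<rho> a b i j) x) = 0"
proof (cases "i = j")
  case True
  have "nambu_coeff \<rho> a b j j = (\<lambda>x. 0)" by auto
  then show ?thesis using True by simp
next
  case False
  then show ?thesis
    using schouten_nambu_vector[of Y i j \<rho> a b x] assms by (simp add: vector_field_def)
qed

text \<open>This is the graded Jacobi identity: if P commutes with \<open>Y\<close> and with
  \<open>c\<close> under the Schouten bracket, it commutes with \<open>Y(c)\<close>, which is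
  therefore a Casimir. In coordinates, the closedness equation is contracted with the gradient of
  \<open>c\<close>.\<close>

lemma closed_tangential:
  assumes sm: "smooth \<rho>" "smooth a" "smooth b" and Y: "vector_field Y"
    and closed: "schouten (nambu \<rho> a b) Y = (\<lambda>I x. 0)"
    and c: "c = a \<or> c = b"
  shows "(\<Sum>m\<in>UNIV. nambu_coeff \<rho> a b j m x * pd m (\<lambda>x. \<Sum>i\<in>UNIV. Y {i} x * pd i c x) x) = 0"
proof -
  let ?P = "nambu_coeff \<rho> a b"
  have smc: "smooth c" using sm c by auto
  have smY: "smooth (Y {i})" for i using Y by (simp add: vector_field_def)
  have smP: "smooth (?P i j)" for i j by (rule smooth_nambu_coeff[OF sm])
  have cas: "(\<Sum>i\<in>UNIV. pd i c x * ?P i j x) = 0" for j x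
    using c nambu_coeff_casimir by auto
  have dcas: "(\<Sum>i\<in>UNIV. pd m (pd i c) x * ?P i j x + pd i c x * pd m (?P i j) x) = 0" for m j x
  proof -
    have "pd m (\<lambda>x. \<Sum>i\<in>UNIV. pd i c x * ?P i j x) x = 0" by (simp add: cas)
    moreover have "pd m (\<lambda>x. \<Sum>i\<in>UNIV. pd i c x * ?P i j x) x
        = (\<Sum>i\<in>UNIV. pd m (pd i c) x * ?P i j x + pd i c x * pd m (?P i j) x)"
      by (subst pd_sum) (auto intro!: sum.cong pd_mult smooth_differentiable smooth_mult smooth_pd smc smP)
    ultimately show ?thesis by simp
  qed
  \<comment> \<open>Differentiating the Casimir identity for \<open>c\<close> moves the derivative
    from the coefficients of P to the gradient of \<open>c\<close>.\<close>
  have swap: "(\<Sum>i\<in>UNIV. pd i c x * pd m (?P i j) x) = (\<Sum>i\<in>UNIV. ?P j i x * pd m (pd i c) x)" for m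
  proof -
    have "(\<Sum>i\<in>UNIV. pd m (pd i c) x * ?P i j x) + (\<Sum>i\<in>UNIV. pd i c x * pd m (?P i j) x) = 0"
      using dcas[of m x j] by (simp add: sum.distrib)
    moreover have "(\<Sum>i\<in>UNIV. ?P j i x * pd m (pd i c) x) = - (\<Sum>i\<in>UNIV. pd m (pd i c) x * ?P i j x)"
      unfolding sum_negf[symmetric] by (intro sum.cong refl) (subst nambu_coeff_skew, simp)
    ultimately show ?thesis by simp
  qed
  have pdY: "pd m (\<lambda>x. \<Sum>i\<in>UNIV. Y {i} x * pd i c x) x
      = (\<Sum>i\<in>UNIV. pd m (Y {i}) x * pd i c x + Y {i} x * pd m (pd i c) x)" for m
    by (subst pd_sum) (auto intro!: sum.cong pd_mult smooth_differentiable smooth_mult smooth_pd smc smY)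
  have "0 = (\<Sum>i\<in>UNIV. pd i c x * (\<Sum>m\<in>UNIV. ?P i m x * pd m (Y {j}) x - ?P j m x * pd m (Y {i}) x
            - Y {m} x * pd m (?P i j) x))"
    using closed_components[OF sm Y closed] by simp
  also have "\<dots> = (\<Sum>i\<in>UNIV. \<Sum>m\<in>UNIV. pd i c x * ?P i m x * pd m (Y {j}) x)
      - (\<Sum>i\<in>UNIV. \<Sum>m\<in>UNIV. ?P j m x * (pd m (Y {i}) x * pd i c x))
      - (\<Sum>i\<in>UNIV. \<Sum>m\<in>UNIV. Y {m} x * (pd i c x * pd m (?P i j) x))"
    by (simp add: sum_distrib_left sum_subtractf ring_distribs mult_ac)
  also have "(\<Sum>i\<in>UNIV. \<Sum>m\<in>UNIV. pd i c x * ?P i m x * pd m (Y {j}) x)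
      = (\<Sum>m\<in>UNIV. (\<Sum>i\<in>UNIV. pd i c x * ?P i m x) * pd m (Y {j}) x)"
    by (subst sum.swap) (simp add: sum_distrib_right)
  also have "\<dots> = 0" by (simp add: cas)
  also have "(\<Sum>i\<in>UNIV. \<Sum>m\<in>UNIV. Y {m} x * (pd i c x * pd m (?P i j) x))
      = (\<Sum>m\<in>UNIV. Y {m} x * (\<Sum>i\<in>UNIV. pd i c x * pd m (?P i j) x))"
    by (subst sum.swap) (simp add: sum_distrib_left)
  also have "\<dots> = (\<Sum>m\<in>UNIV. Y {m} x * (\<Sum>i\<in>UNIV. ?P j i x * pd m (pd i c) x))"
    by (simp only: swap)
  also have "\<dots> = (\<Sum>m\<in>UNIV. \<Sum>i\<in>UNIV. ?P j i x * (Y {m} x * pd i (pd m c) x))"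
    by (simp add: sum_distrib_left mult_ac pd_commute[OF smc])
  also have "\<dots> = (\<Sum>m\<in>UNIV. \<Sum>i\<in>UNIV. ?P j m x * (Y {i} x * pd m (pd i c) x))"
    by (rule sum.swap)
  also have "(\<Sum>i\<in>UNIV. \<Sum>m\<in>UNIV. ?P j m x * (pd m (Y {i}) x * pd i c x))
      = (\<Sum>m\<in>UNIV. \<Sum>i\<in>UNIV. ?P j m x * (pd m (Y {i}) x * pd i c x))"
    by (rule sum.swap)
  finally show ?thesis
    unfolding pdY by (simp add: sum_distrib_left sum.distrib distrib_left)
qed

lemma open_nonzero:
  assumes "smooth f"
  shows "open {x. f x \<noteq> 0}"
proof -
  have "continuous_on UNIV f"
    by (intro continuous_at_imp_continuous_on ballI differentiable_imp_continuous_within smooth_differentiable assms)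
  then show ?thesis by (intro open_Collect_neq continuous_on_const)
qed

text \<open>Rescaling \<rho> multiplies P by a factor that is nonzero on \<open>U\<close>. So the
  whole family \<open>Y(c)\<close> is annihilated by a single field that does not depend on
  \<open>t\<close>: row 2 of the bivector for \<rho> = 1. Its entry in direction 1 is nonzero, as
  \<open>exp_poly_vanish\<close> demands. The weight 3 counts the copies of \<rho>.\<close>

lemma closed_annihilates:
  assumes sm: "smooth \<rho>" "smooth a" "smooth b" and c: "c = a \<or> c = b"
    and Y: "\<And>\<rho>. smooth \<rho> \<Longrightarrow> vector_field (Y \<rho>)"
    and closed: "\<And>\<rho>. smooth \<rho> \<Longrightarrow> schouten (nambu \<rho> a b) (Y \<rho>) = (\<lambda>I x. 0)"
    and poly: "\<And>i. exp_poly 3 (\<lambda>t. Y (\<lambda>x. exp (t * x $ 1) * \<rho> x) {i})"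
    and x: "\<rho> x \<noteq> 0" "nambu_coeff (\<lambda>x. 1) a b 2 1 x \<noteq> 0"
  shows "(\<Sum>i\<in>UNIV. Y \<rho> {i} x * pd i c x) = 0"
proof -
  define U where "U = {x. \<rho> x \<noteq> 0} \<inter> {x. nambu_coeff (\<lambda>x. 1) a b 2 1 x \<noteq> 0}"
  let ?r = "\<lambda>t x. exp (t * x $ 1) * \<rho> x"
  have smc: "smooth c" using sm c by auto
  have "open U"
    unfolding U_def by (intro open_Int open_nonzero sm smooth_nambu_coeff smooth_const)
  have "exp_poly (3 + 0) (\<lambda>t x. \<Sum>i\<in>UNIV. Y (?r t) {i} x * pd i c x)"
    by (intro exp_poly_sum exp_poly_mult poly exp_poly_const smooth_pd smc)
  then have ep: "exp_poly 3 (\<lambda>t x. \<Sum>i\<in>UNIV. Y (?r t) {i} x * pd i c x)" by simp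
  have "(\<lambda>x. \<Sum>i\<in>UNIV. Y (?r 0) {i} x * pd i c x) x = 0"
  proof (rule exp_poly_vanish[OF ep _ \<open>open U\<close>, where w = "\<lambda>m. nambu_coeff (\<lambda>x. 1) a b 2 m"])
    fix t y assume y: "y \<in> U"
    have smr: "smooth (?r t)" by (intro smooth_mult smooth_exp sm)
    have "(\<Sum>m\<in>UNIV. nambu_coeff (?r t) a b 2 m y * pd m (\<lambda>x. \<Sum>i\<in>UNIV. Y (?r t) {i} x * pd i c x) y) = 0"
      by (rule closed_tangential[OF smr sm(2,3) Y[OF smr] closed[OF smr] c])
    then have "?r t y * (\<Sum>m\<in>UNIV. nambu_coeff (\<lambda>x. 1) a b 2 m y * pd m (\<lambda>x. \<Sum>i\<in>UNIV. Y (?r t) {i} x * pd i c x) y) = 0"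
      by (simp add: nambu_coeff_scale[of "?r t"] sum_distrib_left mult.assoc)
    then show "(\<Sum>m\<in>UNIV. nambu_coeff (\<lambda>x. 1) a b 2 m y * pd m (\<lambda>x. \<Sum>i\<in>UNIV. Y (?r t) {i} x * pd i c x) y) = 0"
      using y by (simp add: U_def)
  qed (use x in \<open>auto simp: U_def\<close>)
  then show ?thesis by simp
qed

text \<open>With da = dx3 and db = dx4 at the point, only P12 and P21 survive there, and
  \<open>Y(a)\<close> is the third component. The (1,2)-component of closedness contains the
  divergence in directions 1 and 2 and the derivative of P12 along \<open>Y\<close>. The second
  derivatives of \<open>a\<close> and \<open>b\<close> in the latter are eliminated by
  differentiating \<open>Y(a) = 0\<close> in direction 3 and \<open>Y(b) = 0\<close> in direction 4,
  which supplies the other two terms of the divergence.\<close>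

lemma closed_at_normal_point:
  assumes sm: "smooth \<rho>" "smooth a" "smooth b"
    and Y: "\<And>\<rho>. smooth \<rho> \<Longrightarrow> vector_field (Y \<rho>)"
    and closed: "\<And>\<rho>. smooth \<rho> \<Longrightarrow> schouten (nambu \<rho> a b) (Y \<rho>) = (\<lambda>I x. 0)"
    and poly: "\<And>i. exp_poly 3 (\<lambda>t. Y (\<lambda>x. exp (t * x $ 1) * \<rho> x) {i})"
    and x: "\<rho> x = 1" "\<And>k. pd k a x = (if k = 3 then 1 else 0)" "\<And>k. pd k b x = (if k = 4 then 1 else 0)"
  shows "Y \<rho> {3} x = 0"
    and "(\<Sum>i\<in>UNIV. Y \<rho> {i} x * pd i \<rho> x - pd i (Y \<rho> {i}) x) = 0"
proof -
  let ?P = "nambu_coeff \<rho> a b"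
  let ?w = "nambu_coeff (\<lambda>x. 1) a b 2 1"
  define U where "U = {x. \<rho> x \<noteq> 0} \<inter> {x. ?w x \<noteq> 0}"
  have Px: "?P i j x = levi_civita i j 3 4" for i j
    by (simp add: nambu_coeff_def x if_distrib[where f = "\<lambda>c. c * _"] if_distrib[where f = "\<lambda>c. _ * c"] cong: if_cong)
  have wx: "?w x = -1"
    using Px[of 2 1] nambu_coeff_scale[of \<rho> a b 2 1 x] x(1) by (simp add: levi_civita_values)
  have "open U"
    unfolding U_def by (intro open_Int open_nonzero sm smooth_nambu_coeff smooth_const)
  have xU: "x \<in> U" using x(1) wx by (simp add: U_def)
  have smY: "smooth (Y \<rho> {i})" for i using Y[OF sm(1)] by (simp add: vector_field_def)
  \<comment> \<open>Holds on a neighbourhood of the point, so that it can be differentiated in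
    \<open>dann\<close>.\<close>
  have ann: "(\<Sum>i\<in>UNIV. Y \<rho> {i} y * pd i c y) = 0" if "c = a \<or> c = b" "y \<in> U" for c y
    by (rule closed_annihilates[OF sm that(1) Y closed poly]) (use that(2) in \<open>auto simp: U_def\<close>)
  have "(\<Sum>i\<in>UNIV. Y \<rho> {i} x * pd i a x) = Y \<rho> {3} x"
    by (simp add: x if_distrib[where f = "\<lambda>c. _ * c"] cong: if_cong)
  with ann[of a x] xU show "Y \<rho> {3} x = 0" by simp
  have dann: "(\<Sum>i\<in>UNIV. pd k (Y \<rho> {i}) x * pd i c x + Y \<rho> {i} x * pd i (pd k c) x) = 0"
    if "c = a \<or> c = b" for c k
  proof -
    have smc: "smooth c" using sm that by auto
    have "pd k (\<lambda>y. \<Sum>i\<in>UNIV. Y \<rho> {i} y * pd i c y) x = pd k (\<lambda>y. 0) x"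
      by (rule pd_cong_open[OF \<open>open U\<close> xU])
         (auto intro!: ann that smooth_differentiable smooth_sum smooth_mult smooth_pd smc smY)
    moreover have "pd k (\<lambda>y. \<Sum>i\<in>UNIV. Y \<rho> {i} y * pd i c y) x
      = (\<Sum>i\<in>UNIV. pd k (Y \<rho> {i}) x * pd i c x + Y \<rho> {i} x * pd k (pd i c) x)"
      by (subst pd_sum) (auto intro!: sum.cong pd_mult smooth_differentiable smooth_mult smooth_pd smc smY)
    ultimately show ?thesis by (simp add: pd_commute[OF smc])
  qed
  have d3: "pd 3 (Y \<rho> {3}) x + (\<Sum>i\<in>UNIV. Y \<rho> {i} x * pd i (pd 3 a) x) = 0"
    using dann[of a 3]
    by (simp add: sum.distrib x if_distrib[where f = "\<lambda>c. _ * c"] cong: if_cong)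
  have d4: "pd 4 (Y \<rho> {4}) x + (\<Sum>i\<in>UNIV. Y \<rho> {i} x * pd i (pd 4 b) x) = 0"
    using dann[of b 4]
    by (simp add: sum.distrib x if_distrib[where f = "\<lambda>c. _ * c"] cong: if_cong)
  have P12: "?P 1 2 = (\<lambda>x. \<rho> x * (pd 3 a x * pd 4 b x - pd 4 a x * pd 3 b x))"
    by (simp add: nambu_coeff_def sum_4 levi_civita_values fun_eq_iff algebra_simps)
  have pdP: "pd m (?P 1 2) x = pd m \<rho> x + pd m (pd 3 a) x + pd m (pd 4 b) x" for m
    unfolding P12
    by (simp add: pd_mult pd_diff smooth_differentiable smooth_mult smooth_diff smooth_pd sm x)
  have "(\<Sum>m\<in>UNIV. ?P 1 m x * pd m (Y \<rho> {2}) x - ?P 2 m x * pd m (Y \<rho> {1}) x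
            - Y \<rho> {m} x * pd m (?P 1 2) x) = 0"
    by (rule closed_components[OF sm Y[OF sm(1)] closed[OF sm(1)]])
  then have "pd 2 (Y \<rho> {2}) x + pd 1 (Y \<rho> {1}) x - (\<Sum>m\<in>UNIV. Y \<rho> {m} x * pd m (?P 1 2) x) = 0"
    unfolding sum_subtractf Px by (simp add: sum_4 levi_civita_values)
  then show "(\<Sum>i\<in>UNIV. Y \<rho> {i} x * pd i \<rho> x - pd i (Y \<rho> {i}) x) = 0"
    using d3 d4 unfolding pdP by (simp add: sum_subtractf sum.distrib ring_distribs sum_4)
qed

section \<open>Evaluation on polynomials\<close>

text \<open>A free copy of the index type, so that evaluation by rewriting can match on directions
  and decide their equality.\<close>

datatype idx = E1 | E2 | E3 | E4

primrec dir :: "idx \<Rightarrow> 4" where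
  "dir E1 = 1" | "dir E2 = 2" | "dir E3 = 3" | "dir E4 = 4"

lemma dir_eq_iff [simp]: "dir i = dir j \<longleftrightarrow> i = j"
  by (cases i; cases j) auto

lemma dir_surj: "\<exists>i. dir i = k"
  using exhaust_4[of k] by (metis dir.simps)

text \<open>Divided powers, so that differentiation does not produce coefficients.\<close>

definition monomial :: "idx list \<Rightarrow> scalar_field" where
  "monomial js x = (\<Prod>i\<in>{E1, E2, E3, E4}. x $ dir i ^ count_list js i / fact (count_list js i))"

type_synonym poly = "idx list list"

definition pfun :: "poly \<Rightarrow> scalar_field" where
  "pfun p x = (\<Sum>js\<leftarrow>p. monomial js x)"

fun der :: "idx \<Rightarrow> poly \<Rightarrow> poly" where
  "der i [] = []"
| "der i (js # p) = (if List.member js i then remove1 i js # der i p else der i p)"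

fun const_term :: "poly \<Rightarrow> int" where
  "const_term [] = 0"
| "const_term ([] # p) = 1 + const_term p"
| "const_term ((j # js) # p) = const_term p"

lemma smooth_monomial: "smooth (monomial js)"
  unfolding monomial_def[abs_def] divide_inverse by (intro smooth_prod smooth_mult smooth_power smooth_coord smooth_const)

lemma pd_power_coord:
  "pd i (\<lambda>x. x $ j ^ n / fact n) = (\<lambda>x. if i = j \<and> n > 0 then x $ j ^ (n - 1) / fact (n - 1) else 0)"
proof
  fix x :: "real^4"
  have "((\<lambda>x. x $ j ^ n / fact n) has_derivative (\<lambda>h. of_nat n * h $ j * x $ j ^ (n - 1) / fact n)) (at x)"
    by (auto intro!: derivative_eq_intros bounded_linear_imp_has_derivative bounded_linear_vec_nth)
  from pd_eqI[OF this] show "pd i (\<lambda>x. x $ j ^ n / fact n) x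
      = (if i = j \<and> n > 0 then x $ j ^ (n - 1) / fact (n - 1) else 0)"
    by (cases n) (auto simp: axis_def)
qed

lemma pd_monomial: "pd (dir i) (monomial js) = (if i \<in> set js then monomial (remove1 i js) else (\<lambda>x. 0))"
proof
  fix x
  let ?f = "\<lambda>k x. x $ dir k ^ count_list js k / fact (count_list js k)"
  have sm: "smooth (?f k)" for k
    unfolding divide_inverse by (intro smooth_mult smooth_power smooth_coord smooth_const)
  have pdf: "pd (dir i) (?f k) x = (if k = i \<and> i \<in> set js then x $ dir i ^ (count_list js i - 1) / fact (count_list js i - 1) else 0)" for k
    by (auto simp: pd_power_coord count_list_0_iff[of js] zero_less_iff_neq_zero)
  have "pd (dir i) (monomial js) x = (\<Sum>v\<in>{E1, E2, E3, E4}. \<Prod>k\<in>{E1, E2, E3, E4}. (if k = v then pd (dir i) (?f v) else ?f k) x)"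
    unfolding monomial_def[abs_def] by (rule pd_prod) (auto intro: sm)
  also have "\<dots> = (if i \<in> set js then monomial (remove1 i js) else (\<lambda>x. 0)) x"
    unfolding if_distribR pdf monomial_def by (cases i) (auto simp: count_list_remove1)
  finally show "pd (dir i) (monomial js) x = (if i \<in> set js then monomial (remove1 i js) else (\<lambda>x. 0)) x" .
qed

lemma pfun_simps: "pfun [] = (\<lambda>x. 0)" "pfun (js # p) = (\<lambda>x. monomial js x + pfun p x)"
  by (auto simp: pfun_def)

lemma smooth_pfun: "smooth (pfun p)"
  by (induction p) (auto simp: pfun_simps intro: smooth_add smooth_monomial)

lemma pd_pfun: "pd (dir i) (pfun p) = pfun (der i p)"
proof (induction p)
  case (Cons js p)
  have "pd (dir i) (pfun (js # p)) = (\<lambda>x. pd (dir i) (monomial js) x + pd (dir i) (pfun p) x)"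
    unfolding pfun_simps by (auto simp: pd_add smooth_differentiable smooth_monomial smooth_pfun)
  then show ?case using Cons by (auto simp: pd_monomial pfun_simps)
qed (simp add: pfun_simps)

lemma monomial_0: "monomial js 0 = (if js = [] then 1 else 0)"
proof (cases js)
  case (Cons j js')
  then have "count_list js j \<noteq> 0" by simp
  then show ?thesis
    unfolding monomial_def using Cons by (cases j) (auto simp: power_0_left)
qed (simp add: monomial_def)

lemma pfun_0: "pfun p 0 = of_int (const_term p)"
  by (induction p rule: const_term.induct) (auto simp: pfun_simps monomial_0)

lemma pfun_coord: "pfun [[i]] = (\<lambda>x. x $ dir i)"
  by (cases i) (auto simp: pfun_def monomial_def)

text \<open>The sign is that of moving the chosen index to the front. Repeating this with the
  remaining indices enumerates all permutations with their signs.\<close>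

fun choices :: "idx list \<Rightarrow> (int \<times> idx \<times> idx list) list" where
  "choices [] = []"
| "choices (x # xs) = (1, x, xs) # map (\<lambda>(s, y, ys). (- s, y, x # ys)) (choices xs)"

text \<open>A bracket is expanded as a determinant, edge by edge; branches on which a vertex is
  differentiated to zero are cut.\<close>

function eval_graph :: "idx list \<Rightarrow> nat list list \<Rightarrow> poly list \<Rightarrow> int" where
  "eval_graph is [] st = prod_list (map const_term st)"
| "eval_graph is ([] # g) st = eval_graph [E1, E2, E3, E4] g st"
| "eval_graph is ((v # vs) # g) st = sum_list (map (\<lambda>(s, i, js).
     let p = der i (st ! v) in if p = [] then 0 else s * eval_graph js (vs # g) (st[v := p])) (choices is))"
  by pat_completeness auto
termination by (relation "Wellfounded.measure (\<lambda>(is, g, st). length (concat g) + length g)") auto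

section \<open>Correctness of the determinant expansion\<close>

text \<open>The expansion that \<open>eval_graph\<close> performs on one bracket, interpreted in the
  reals; \<open>is\<close> holds the indices not yet given to an earlier edge.\<close>

primrec nest :: "nat list \<Rightarrow> (contents \<Rightarrow> real) \<Rightarrow> idx list \<Rightarrow> contents \<Rightarrow> real" where
  "nest [] \<Phi> is c = \<Phi> c"
| "nest (v # vs) \<Phi> is c = (\<Sum>(s, i, js)\<leftarrow>choices is. of_int s * nest vs \<Phi> js (dv v (dir i) c))"

lemma sum_quadruples: "(\<Sum>ix\<in>UNIV. F ix) = (\<Sum>i\<in>UNIV. \<Sum>j\<in>UNIV. \<Sum>k\<in>UNIV. \<Sum>l\<in>UNIV. F (i, j, k, l))"
  for F :: "'a::finite \<times> 'b::finite \<times> 'c::finite \<times> 'd::finite \<Rightarrow> real"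
  by (simp add: sum.cartesian_product split_def flip: UNIV_Times_UNIV)

lemma levi_civita_expand:
  fixes F :: "4 \<Rightarrow> 4 \<Rightarrow> 4 \<Rightarrow> 4 \<Rightarrow> real"
  shows "(\<Sum>i\<in>UNIV. \<Sum>j\<in>UNIV. \<Sum>k\<in>UNIV. \<Sum>l\<in>UNIV. levi_civita i j k l * F i j k l) =
      F 1 2 3 4 - F 1 2 4 3 - F 1 3 2 4 + F 1 3 4 2 + F 1 4 2 3 - F 1 4 3 2
    - F 2 1 3 4 + F 2 1 4 3 + F 2 3 1 4 - F 2 3 4 1 - F 2 4 1 3 + F 2 4 3 1
    + F 3 1 2 4 - F 3 1 4 2 - F 3 2 1 4 + F 3 2 4 1 + F 3 4 1 2 - F 3 4 2 1
    - F 4 1 2 3 + F 4 1 3 2 + F 4 2 1 3 - F 4 2 3 1 - F 4 3 1 2 + F 4 3 2 1"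
  by (simp add: sum_4 levi_civita_values)

text \<open>Four successive choices give the 24 terms of the Leibniz formula, which are the nonzero
  terms of the Levi-Civita sum.\<close>

lemma nest_brk:
  assumes "smooth_contents c"
  shows "nest [p, q, r, s] \<Phi> [E1, E2, E3, E4] c = brk [p, q, r, s] \<Phi> c"
proof -
  have "dv4 [p, q, r, s] (i, j, k, l) c = dv s l (dv r k (dv q j (dv p i c)))" for i j k l
    using assms by (simp add: dv_commute)
  then show ?thesis
    unfolding brk_def sum_quadruples lc4.simps levi_civita_expand
    by simp
qed

lemma gev_cong: "(\<And>v. v \<in> V \<Longrightarrow> c v = d v) \<Longrightarrow> gev V x g c = gev V x g d"
proof (induction g arbitrary: c d)
  case (Cons b g)
  have step: "dv w i c v = dv w i d v" if "v \<in> V" "\<And>v. v \<in> V \<Longrightarrow> c v = d v" for w i v and c d :: contents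
    using that by (cases "v = w") (auto simp: dv_def)
  have "dv4 b (i, j, k, l) c v = dv4 b (i, j, k, l) d v" if "v \<in> V" for i j k l v
    unfolding dv4.simps by (intro step that Cons.prems)
  then have "dv4 b ix c v = dv4 b ix d v" if "v \<in> V" for ix v
    using that by (metis surj_pair)
  then have "gev V x g (dv4 b ix c) = gev V x g (dv4 b ix d)" for ix
    by (intro Cons.IH)
  then show ?case by (simp add: gev_Cons)
qed simp

lemma gev_zero:
  assumes "finite V" "v \<in> V" "c v = (\<lambda>x. 0)"
  shows "gev V x g c = 0"
  using assms(3)
proof (induction g arbitrary: c)
  case Nil
  then show ?case using assms(1,2) by (auto intro!: bexI[of _ v])
next
  case (Cons b g)
  have "dv w i c v = (\<lambda>x. 0)" if "c v = (\<lambda>x. 0)" for w i and c :: contents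
    using that by (cases "v = w") (auto simp: dv_def)
  then have "dv4 b ix c v = (\<lambda>x. 0)" for ix
    using Cons.prems by (cases ix) simp
  then show ?case using Cons.IH by (simp add: gev_Cons)
qed

definition poly_contents :: "poly list \<Rightarrow> contents" where
  "poly_contents st v = (if v < length st then pfun (st ! v) else (\<lambda>x. 0))"

lemma smooth_poly_contents: "smooth_contents (poly_contents st)"
  by (auto simp: smooth_contents_def poly_contents_def smooth_pfun)

lemma dv_poly_contents: "dv v (dir i) (poly_contents st) = poly_contents (st[v := der i (st ! v)])"
  by (auto simp: dv_def poly_contents_def fun_eq_iff pd_pfun nth_list_update)

text \<open>Cutting a branch is sound because a zero content stays zero under all further
  derivatives and annihilates the final product.\<close>

lemma eval_graph_nest:
  assumes len: "length st = n" and vs: "\<forall>v\<in>set vs. v < n"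
    and rest: "\<And>st. length st = n \<Longrightarrow> gev {..<n} 0 g (poly_contents st) = of_int (eval_graph [E1, E2, E3, E4] g st)"
  shows "nest vs (gev {..<n} 0 g) is (poly_contents st) = of_int (eval_graph is (vs # g) st)"
  using len vs
proof (induction vs arbitrary: "is" st)
  case (Cons v vs)
  have "of_int s * nest vs (gev {..<n} 0 g) js (dv v (dir i) (poly_contents st))
     = of_int (let p = der i (st ! v) in if p = [] then 0 else s * eval_graph js (vs # g) (st[v := p]))" for s i js
  proof (cases "der i (st ! v) = []")
    case True
    have v: "v < n" using Cons.prems by simp
    have zero: "nest vs (gev {..<n} 0 g) js c = 0" if "c v = (\<lambda>x. 0)" for c js vs
      using that
    proof (induction vs arbitrary: c js)
      case Nil
      then show ?case using v by (simp add: gev_zero)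
    next
      case (Cons w ws)
      have "dv w i c v = (\<lambda>x. 0)" for i
        using Cons.prems by (cases "v = w") (auto simp: dv_def)
      then have "nest ws (gev {..<n} 0 g) ks (dv w i c) = 0" for i ks
        by (rule Cons.IH)
      then show ?case by (simp add: case_prod_unfold)
    qed
    have "dv v (dir i) (poly_contents st) v = (\<lambda>x. 0)"
      using True v Cons.prems(1) by (simp add: dv_poly_contents poly_contents_def pfun_simps)
    then show ?thesis using True by (simp add: zero)
  next
    case False
    have "nest vs (gev {..<n} 0 g) js (poly_contents (st[v := der i (st ! v)]))
        = of_int (eval_graph js (vs # g) (st[v := der i (st ! v)]))"
      by (rule Cons.IH) (use Cons.prems in auto)
    then show ?thesis using False by (simp add: dv_poly_contents Let_def)
  qed
  then have "(\<Sum>(s, i, js)\<leftarrow>L. of_int s * nest vs (gev {..<n} 0 g) js (dv v (dir i) (poly_contents st)))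
    = of_int (\<Sum>(s, i, js)\<leftarrow>L. let p = der i (st ! v) in if p = [] then 0 else s * eval_graph js (vs # g) (st[v := p]))" for L
    by (induction L) (auto simp: case_prod_unfold simp del: eval_graph.simps)
  then show ?case by simp
qed (simp add: rest)

lemma eval_graph_correct:
  assumes "length st = n" "\<forall>b\<in>set g. length b = 4 \<and> (\<forall>v\<in>set b. v < n)"
  shows "gev {..<n} 0 g (poly_contents st) = of_int (eval_graph [E1, E2, E3, E4] g st)"
  using assms
proof (induction g arbitrary: st)
  case Nil
  have "(\<Prod>v<n. poly_contents st v 0) = (\<Prod>v<n. of_int (const_term (st ! v)))"
    using Nil by (intro prod.cong) (auto simp: poly_contents_def pfun_0)
  also have "\<dots> = of_int (prod_list (map const_term st))"
    using Nil by (simp add: prod.list_conv_set_nth atLeast0LessThan)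
  finally show ?case by simp
next
  case (Cons b g)
  have IH: "gev {..<n} 0 g (poly_contents st) = of_int (eval_graph [E1, E2, E3, E4] g st)" if "length st = n" for st
    using Cons that by auto
  obtain p q r s where b: "b = [p, q, r, s]"
    using Cons.prems(2) by (auto simp: length_Suc_conv eval_nat_numeral)
  have "gev {..<n} 0 (b # g) (poly_contents st) = nest b (gev {..<n} 0 g) [E1, E2, E3, E4] (poly_contents st)"
    unfolding b nest_brk[OF smooth_poly_contents] by (simp add: gev_def[abs_def])
  also have "\<dots> = of_int (eval_graph [E1, E2, E3, E4] (b # g) st)"
    by (rule eval_graph_nest[OF _ _ IH]) (use Cons.prems in auto)
  finally show ?case .
qed

subsection \<open>Pruning by degree\<close>

definition homogeneous :: "nat \<Rightarrow> poly \<Rightarrow> poly" where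
  "homogeneous d p = filter (\<lambda>js. length js = d) p"

text \<open>At the origin, a vertex with \<open>d\<close> incoming edges is sensitive only to the
  monomials of degree \<open>d\<close> in its content.\<close>

definition prune :: "nat list list \<Rightarrow> poly list \<Rightarrow> poly list" where
  "prune g st = map (\<lambda>v. homogeneous (count_list (concat g) v) (st ! v)) [0..<length st]"

lemma der_homogeneous: "der i (homogeneous (Suc d) p) = homogeneous d (der i p)"
  by (induction p) (auto simp: homogeneous_def length_remove1 dest: length_pos_if_in_set)

lemma const_term_homogeneous: "const_term (homogeneous 0 p) = const_term p"
  by (induction p rule: const_term.induct) (auto simp: homogeneous_def)

lemma eval_graph_empty: "v < length st \<Longrightarrow> st ! v = [] \<Longrightarrow> eval_graph is g st = 0"
proof (induction "is" g st rule: eval_graph.induct)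
  case (1 "is" st)
  then show ?case by (auto simp: prod_list_zero_iff in_set_conv_nth intro!: image_eqI[of _ _ "[]"])
next
  case (3 "is" w ws g st)
  have "(let p = der i (st ! w) in if p = [] then 0 else s * eval_graph js (ws # g) (st[w := p])) = 0"
    if "(s, i, js) \<in> set (choices is)" for s i js
  proof (cases "w = v")
    case True
    then show ?thesis using 3(3) by simp
  next
    case False
    have "eval_graph js (ws # g) (st[w := der i (st ! w)]) = 0" if "der i (st ! w) \<noteq> []"
      by (rule 3(1)[OF \<open>(s, i, js) \<in> set (choices is)\<close> refl refl refl that]) (use 3 False in auto)
    then show ?thesis by (auto simp: Let_def)
  qed
  then have "map (\<lambda>(s, i, js). let p = der i (st ! w) in if p = [] then 0 else s * eval_graph js (ws # g) (st[w := p])) (choices is)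
      = map (\<lambda>_. 0) (choices is)"
    by (intro map_cong refl) (simp only: split_paired_all prod.case)
  then show ?case by (simp only: eval_graph.simps) simp
qed simp

text \<open>Processing an edge lowers by one both the number of edges still to enter its vertex and
  the degree of every surviving monomial there, so pruning commutes with each step. At the end
  degree zero remains, which is the constant term.\<close>

lemma eval_graph_prune:
  "set (concat g) \<subseteq> {..<length st} \<Longrightarrow> eval_graph is g (prune g st) = eval_graph is g st"
proof (induction "is" g st rule: eval_graph.induct)
  case (1 "is" st)
  have "map const_term (prune [] st) = map const_term st"
    by (rule nth_equalityI) (auto simp: prune_def const_term_homogeneous)
  then show ?case by simp
next
  case (2 "is" g st)
  have "prune ([] # g) st = prune g st" by (simp add: prune_def)
  with 2 show ?case by simp
next
  case (3 "is" v vs g st)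
  let ?q = "prune ((v # vs) # g) st"
  have len: "length ?q = length st" by (simp add: prune_def)
  have "(let p = der i (?q ! v) in if p = [] then 0 else s * eval_graph js (vs # g) (?q[v := p]))
      = (let p = der i (st ! v) in if p = [] then 0 else s * eval_graph js (vs # g) (st[v := p]))"
    if m: "(s, i, js) \<in> set (choices is)" for s i js
  proof -
    have v: "v < length st" using 3(2) by simp
    let ?d = "count_list (concat (vs # g)) v"
    let ?st = "st[v := der i (st ! v)]"
    have d: "der i (?q ! v) = homogeneous ?d (der i (st ! v))"
      using v by (simp add: prune_def der_homogeneous)
    have upd: "?q[v := der i (?q ! v)] = prune (vs # g) ?st"
      unfolding d using v by (intro nth_equalityI) (auto simp: prune_def nth_list_update)
    show ?thesis
    proof (cases "der i (st ! v) = []")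
      case True
      then show ?thesis by (simp add: d homogeneous_def)
    next
      case False
      have IH: "eval_graph js (vs # g) (prune (vs # g) ?st) = eval_graph js (vs # g) ?st"
        by (rule 3(1)[OF m refl refl refl False]) (use 3(2) in auto)
      show ?thesis
      proof (cases "der i (?q ! v) = []")
        case True
        have "prune (vs # g) ?st ! v = []"
          using True v unfolding d by (simp add: prune_def)
        then have "eval_graph js (vs # g) (prune (vs # g) ?st) = 0"
          using v by (intro eval_graph_empty[of v]) (auto simp: prune_def)
        with True False IH show ?thesis by simp
      next
        case F2: False
        show ?thesis unfolding Let_def upd IH using False F2 by simp
      qed
    qed
  qed
  then have "map (\<lambda>(s, i, js). let p = der i (?q ! v) in if p = [] then 0 else s * eval_graph js (vs # g) (?q[v := p])) (choices is)
      = map (\<lambda>(s, i, js). let p = der i (st ! v) in if p = [] then 0 else s * eval_graph js (vs # g) (st[v := p])) (choices is)"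
    by (intro map_cong refl) (simp only: split_paired_all prod.case)
  then show ?case by (simp only: eval_graph.simps)
qed

section \<open>In-degree test and derivatives at the origin\<close>

definition degrees :: "nat list list \<Rightarrow> nat list" where
  "degrees g = (let vs = concat g in map (count_list vs) [0, 1, 2, 3, 4, 5, 6, 7, 8, 9])"

text \<open>A vertex without a monomial of its in-degree forces the value zero, so
  \<open>graph_value\<close> need not expand any determinant.\<close>

fun unmatched :: "nat \<Rightarrow> nat list \<Rightarrow> poly list \<Rightarrow> nat list" where
  "unmatched n (d # ds) (p # ps) = (if list_ex (\<lambda>js. length js = d) p then unmatched (Suc n) ds ps
     else n # unmatched (Suc n) ds ps)"
| "unmatched n _ _ = []"

definition graph_value :: "nat list \<Rightarrow> nat list list \<Rightarrow> poly list \<Rightarrow> int" where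
  "graph_value ds g st = (if unmatched 0 ds st = []
     then eval_graph [E1, E2, E3, E4] g (map2 homogeneous ds st) else 0)"

definition valid_graph :: "nat list list \<Rightarrow> bool" where
  "valid_graph g \<longleftrightarrow> list_all (\<lambda>b. length b = 4 \<and> list_all (\<lambda>v. v < 10) b) g"

lemma ex_nat_Suc: "(\<exists>i. Q i) \<longleftrightarrow> Q 0 \<or> (\<exists>i. Q (Suc i))"
  by (metis not0_implies_Suc)

lemma set_unmatched:
  "v \<in> set (unmatched n ds ps) \<longleftrightarrow>
     (\<exists>i. v = n + i \<and> i < length ds \<and> i < length ps \<and> homogeneous (ds ! i) (ps ! i) = [])"
proof (induction n ds ps rule: unmatched.induct)
  case (1 n d ds p ps)
  have *: "homogeneous d p = [] \<longleftrightarrow> \<not> list_ex (\<lambda>js. length js = d) p"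
    by (auto simp: homogeneous_def filter_empty_conv list_ex_iff)
  have "(\<exists>i. v = n + i \<and> i < length (d # ds) \<and> i < length (p # ps) \<and> homogeneous ((d # ds) ! i) ((p # ps) ! i) = [])
     \<longleftrightarrow> (v = n \<and> homogeneous d p = []) \<or> (\<exists>i. v = Suc n + i \<and> i < length ds \<and> i < length ps \<and> homogeneous (ds ! i) (ps ! i) = [])"
    (is "(\<exists>i. ?Q i) \<longleftrightarrow> ?R \<or> (\<exists>i. ?S i)")
    by (subst ex_nat_Suc) simp
  then show ?case using 1 by (auto simp: *)
qed auto

lemma length_degrees [simp]: "length (degrees g) = 10"
  by (simp add: degrees_def Let_def)

lemma upt_10: "[0..<10] = [0, 1, 2, 3, 4, 5, 6, 7, 8, 9]"
  by code_simp

lemma nth_degrees: "v < 10 \<Longrightarrow> degrees g ! v = count_list (concat g) v"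
  unfolding degrees_def Let_def upt_10[symmetric] by (simp add: nth_map)

lemma prune_degrees: "length st = 10 \<Longrightarrow> map2 homogeneous (degrees g) st = prune g st"
  by (rule nth_equalityI) (auto simp: prune_def nth_degrees)

lemma graph_value_correct:
  assumes "length st = 10" "valid_graph g"
  shows "gev {..<10} 0 g (poly_contents st) = of_int (graph_value (degrees g) g st)"
proof -
  have g: "\<forall>b\<in>set g. length b = 4 \<and> (\<forall>v\<in>set b. v < 10)"
    using assms(2) by (auto simp: valid_graph_def list_all_iff)
  then have "set (concat g) \<subseteq> {..<length st}" using assms(1) by auto
  then have p: "eval_graph [E1, E2, E3, E4] g st = eval_graph [E1, E2, E3, E4] g (prune g st)"
    by (rule eval_graph_prune[symmetric])
  have "eval_graph [E1, E2, E3, E4] g st = graph_value (degrees g) g st"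
  proof (cases "unmatched 0 (degrees g) st = []")
    case True
    then show ?thesis unfolding p graph_value_def prune_degrees[OF assms(1)] by simp
  next
    case False
    then obtain v where "v \<in> set (unmatched 0 (degrees g) st)" by fastforce
    then have v: "v < 10" "homogeneous (degrees g ! v) (st ! v) = []"
      using assms(1) by (auto simp: set_unmatched)
    then have "prune g st ! v = []" using assms(1) by (simp add: prune_def nth_degrees)
    then have "eval_graph [E1, E2, E3, E4] g (prune g st) = 0"
      using v assms(1) by (intro eval_graph_empty[of v]) (auto simp: prune_def)
    then show ?thesis using False unfolding p graph_value_def by simp
  qed
  then show ?thesis using eval_graph_correct[OF assms(1) g] by simp
qed

text \<open>A derivative of the evaluation lands on one vertex and raises the degree demanded there
  by one. Two unmatched vertices cannot both be repaired; a single one must itself receive the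
  derivative; otherwise all ten vertices contribute.\<close>

fun candidates :: "nat list \<Rightarrow> nat list" where
  "candidates [] = [0, 1, 2, 3, 4, 5, 6, 7, 8, 9]"
| "candidates [v] = [v]"
| "candidates _ = []"

lemma unmatched_ge: "v \<in> set (unmatched n ds ps) \<Longrightarrow> n \<le> v"
  by (auto simp: set_unmatched)

lemma distinct_unmatched: "distinct (unmatched n ds ps)"
  by (induction n ds ps rule: unmatched.induct) (auto dest: unmatched_ge)

lemma derivative_value_correct:
  assumes len: "length st = 10" and g: "valid_graph g"
    and u: "us = unmatched 0 (degrees g) st"
  shows "pd (dir i) (\<lambda>x. gev {..<10} x g (poly_contents st)) 0
    = of_int (\<Sum>v\<leftarrow>candidates us. graph_value (degrees g) g (st[v := der i (st ! v)]))"
proof -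
  let ?f = "\<lambda>v. graph_value (degrees g) g (st[v := der i (st ! v)])"
  have zero: "?f v = 0" if "w \<in> set us" "w \<noteq> v" for v w
  proof -
    have "w \<in> set (unmatched 0 (degrees g) (st[v := der i (st ! v)]))"
      using that len unfolding u set_unmatched by auto
    then show ?thesis by (auto simp: graph_value_def)
  qed
  have "pd (dir i) (\<lambda>x. gev {..<10} x g (poly_contents st)) 0 = of_int (\<Sum>v<10. ?f v)"
    by (simp add: pd_gev smooth_poly_contents dv_poly_contents graph_value_correct len g)
  also have "(\<Sum>v<10. ?f v) = (\<Sum>v\<leftarrow>candidates us. ?f v)"
  proof (cases us rule: candidates.cases)
    case 1
    then show ?thesis
      by (simp add: lessThan_nat_numeral flip: upt_10)
  next
    case (2 v)
    have "v < 10" using 2 len u by (metis add_0 length_degrees list.set_intros(1) set_unmatched)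
    then have "(\<Sum>v<10. ?f v) = (\<Sum>w\<in>{v}. ?f w)"
      by (intro sum.mono_neutral_right) (use zero 2 in auto)
    then show ?thesis using 2 by simp
  next
    case (3 v w ws)
    have "distinct us" unfolding u by (rule distinct_unmatched)
    with 3 have "v \<noteq> w" by auto
    then have "?f k = 0" for k using zero[of v k] zero[of w k] 3 by auto
    then show ?thesis using 3 by simp
  qed
  finally show ?thesis .
qed

section \<open>Values and divergences of skew-symmetrized graphs\<close>

definition start :: "poly \<Rightarrow> poly \<Rightarrow> poly \<Rightarrow> poly \<Rightarrow> poly list" where
  "start s r a b = [s, r, r, r, a, a, a, b, b, b]"

lemma start_contents:
  "v < 10 \<Longrightarrow> poly_contents (start [[i]] r a b) v = cont (pfun r) (pfun a) (pfun b) (\<lambda>x. x $ dir i) v"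
proof -
  assume "v < 10"
  then have "v \<in> set [0..<10]" by simp
  then have "v = 0 \<or> v = 1 \<or> v = 2 \<or> v = 3 \<or> v = 4 \<or> v = 5 \<or> v = 6 \<or> v = 7 \<or> v = 8 \<or> v = 9"
    unfolding upt_10 by simp
  then show ?thesis
    by (elim disjE) (simp_all add: poly_contents_def start_def cont_def pfun_coord)
qed

text \<open>Twice the skew part under the exchange of \<open>a\<close> and \<open>b\<close>; the
  factor 1/2 of \<open>skew_evaluation\<close> is put back in
  \<open>skew_evaluation_gev\<close>.\<close>

definition skew_gev :: "real^4 \<Rightarrow> scalar_field \<Rightarrow> scalar_field \<Rightarrow> scalar_field \<Rightarrow> scalar_field \<Rightarrow> nat list list \<Rightarrow> real" where
  "skew_gev x \<rho> a b s g = gev {0..9} x g (cont \<rho> a b s) - gev {0..9} x g (cont \<rho> b a s)"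

lemma gev_start:
  "gev {0..9} x g (cont (pfun r) (pfun a) (pfun b) (\<lambda>x. x $ dir i)) = gev {..<10} x g (poly_contents (start [[i]] r a b))"
proof -
  have "{0..9} = {..<10::nat}" by auto
  then show ?thesis by (simp only:) (rule gev_cong, simp add: start_contents)
qed

definition skew_value :: "nat list \<Rightarrow> nat list list \<Rightarrow> idx \<Rightarrow> poly \<Rightarrow> poly \<Rightarrow> poly \<Rightarrow> int" where
  "skew_value ds g i r a b = graph_value ds g (start [[i]] r a b) - graph_value ds g (start [[i]] r b a)"

text \<open>Unmatched vertices are computed once, with direction \<open>E1\<close> at the sink: only
  degrees enter, and a coordinate has degree one in each direction.\<close>

definition divergence_value :: "nat list \<Rightarrow> nat list list \<Rightarrow> poly \<Rightarrow> poly \<Rightarrow> poly \<Rightarrow> int" where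
  "divergence_value ds g r a b = (case candidates (unmatched 0 ds (start [[E1]] r a b)) of [] \<Rightarrow> 0
     | v # vs \<Rightarrow> \<Sum>i\<leftarrow>[E1, E2, E3, E4]. let st = start [[i]] r a b in
         \<Sum>w\<leftarrow>v # vs. graph_value ds g (st[w := der i (st ! w)]))"

lemma skew_value_correct:
  assumes "valid_graph g"
  shows "skew_gev 0 (pfun r) (pfun a) (pfun b) (\<lambda>x. x $ dir i) g = of_int (skew_value (degrees g) g i r a b)"
  unfolding skew_gev_def gev_start skew_value_def using assms
  by (simp add: graph_value_correct start_def)

lemma sum_dir: "(\<Sum>k\<in>UNIV. F k) = (\<Sum>i\<leftarrow>[E1, E2, E3, E4]. F (dir i))" for F :: "4 \<Rightarrow> real"
  by (simp add: sum_4)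

lemma divergence_value_correct:
  assumes "valid_graph g"
  shows "(\<Sum>k\<in>UNIV. pd k (\<lambda>x. gev {0..9} x g (cont (pfun r) (pfun a) (pfun b) (\<lambda>x. x $ k))) 0)
    = of_int (divergence_value (degrees g) g r a b)"
proof -
  let ?us = "unmatched 0 (degrees g) (start [[E1]] r a b)"
  have us: "?us = unmatched 0 (degrees g) (start [[i]] r a b)" for i
    by (cases "degrees g") (auto simp: start_def)
  have "pd (dir i) (\<lambda>x. gev {0..9} x g (cont (pfun r) (pfun a) (pfun b) (\<lambda>x. x $ dir i))) 0
     = of_int (\<Sum>v\<leftarrow>candidates ?us. graph_value (degrees g) g ((start [[i]] r a b)[v := der i (start [[i]] r a b ! v)]))" for i
    unfolding gev_start by (rule derivative_value_correct[OF _ assms us]) (simp add: start_def)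
  then show ?thesis
    unfolding sum_dir divergence_value_def
    by (cases "candidates ?us") (simp_all add: Let_def)
qed

section \<open>Reduction of bracket graphs to a spanning set\<close>

type_synonym graph = "nat list list"

fun perm3 :: "nat \<Rightarrow> nat list" where
  "perm3 0 = [0, 1, 2]"
| "perm3 (Suc 0) = [0, 2, 1]"
| "perm3 (Suc (Suc 0)) = [1, 0, 2]"
| "perm3 (Suc (Suc (Suc 0))) = [1, 2, 0]"
| "perm3 (Suc (Suc (Suc (Suc 0)))) = [2, 0, 1]"
| "perm3 _ = [2, 1, 0]"

type_synonym symmetry = "nat \<times> nat \<times> nat \<times> bool"

text \<open>The symmetry \<open>(r, p, q, s)\<close> permutes each of the vertex sets \<open>{1, 2, 3}\<close>, \<open>{4, 5, 6}\<close>,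
  \<open>{7, 8, 9}\<close>, and exchanges the last two (that is, \<open>a\<^sup>1\<close> and \<open>a\<^sup>2\<close>) if \<open>s\<close> holds.\<close>

fun relabelling :: "symmetry \<Rightarrow> nat list" where
  "relabelling (r, p, q, s) = 0 # map Suc (perm3 r)
     @ (if s then map ((+) 7) (perm3 p) @ map ((+) 4) (perm3 q)
        else map ((+) 4) (perm3 p) @ map ((+) 7) (perm3 q))"

fun pick :: "nat list \<Rightarrow> nat \<Rightarrow> nat \<Rightarrow> nat" where
  "pick [] n d = d"
| "pick (x # xs) 0 d = x"
| "pick (x # xs) (Suc n) d = pick xs n d"

definition relabel :: "symmetry \<Rightarrow> nat \<Rightarrow> nat" where
  "relabel k v = pick (relabelling k) v v"

fun swaps :: "symmetry \<Rightarrow> bool" where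
  "swaps (r, p, q, s) = s"

definition signed :: "bool \<Rightarrow> real" where
  "signed b = (if b then -1 else 1)"

fun well_formed :: "graph \<Rightarrow> bool" where
  "well_formed [[_, _, _, _], [_, _, _, _], [_, _, _, _]] = True"
| "well_formed _ = False"

text \<open>Exactly the rules that the certificate may use. Reasoning about arbitrary functionals
  with these properties makes one reduction valid for all \<rho>, a1, a2, all points and all
  components of the field.\<close>

definition bracket_functional :: "(graph \<Rightarrow> real) \<Rightarrow> bool" where
  "bracket_functional S \<longleftrightarrow>
     (\<forall>xs a b ys B C. length xs + length ys = 2 \<longrightarrow> S [xs @ a # b # ys, B, C] = - S [xs @ b # a # ys, B, C])
   \<and> (\<forall>A B C. S [A, B, C] = S [B, A, C])
   \<and> (\<forall>A B C. S [A, B, C] = S [A, C, B])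
   \<and> (\<forall>p q r s e t u w C. S [[p, q, r, s], [e, t, u, w], C] =
        S [[e, q, r, s], [p, t, u, w], C] + S [[p, e, r, s], [q, t, u, w], C]
      + S [[p, q, e, s], [r, t, u, w], C] + S [[p, q, r, e], [s, t, u, w], C])
   \<and> (\<forall>k g. well_formed g \<longrightarrow> S (map (map (relabel k)) g) = signed (swaps k) * S g)"

subsection \<open>Normal forms\<close>

text \<open>The flag is the parity of the number of exchanges of neighbours.\<close>

fun sign_insert :: "nat \<Rightarrow> nat list \<Rightarrow> bool \<times> nat list" where
  "sign_insert x [] = (False, [x])"
| "sign_insert x (y # ys) = (if x \<le> y then (False, x # y # ys)
     else (case sign_insert x ys of (b, zs) \<Rightarrow> (\<not> b, y # zs)))"

fun sign_sort :: "nat list \<Rightarrow> bool \<times> nat list" where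
  "sign_sort [] = (False, [])"
| "sign_sort (x # xs) = (case sign_sort xs of (b, ys) \<Rightarrow> (case sign_insert x ys of (c, zs) \<Rightarrow> (b \<noteq> c, zs)))"

datatype comparison = LT | EQ | GT

fun cmp_list :: "('a \<Rightarrow> 'a \<Rightarrow> comparison) \<Rightarrow> 'a list \<Rightarrow> 'a list \<Rightarrow> comparison" where
  "cmp_list f [] [] = EQ"
| "cmp_list f [] (y # ys) = LT"
| "cmp_list f (x # xs) [] = GT"
| "cmp_list f (x # xs) (y # ys) = (case f x y of EQ \<Rightarrow> cmp_list f xs ys | c \<Rightarrow> c)"

fun cmp_nat :: "nat \<Rightarrow> nat \<Rightarrow> comparison" where
  "cmp_nat 0 0 = EQ"
| "cmp_nat 0 (Suc n) = LT"
| "cmp_nat (Suc m) 0 = GT"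
| "cmp_nat (Suc m) (Suc n) = cmp_nat m n"

fun bracket_insert :: "nat list \<Rightarrow> graph \<Rightarrow> graph" where
  "bracket_insert A [] = [A]"
| "bracket_insert A (B # g) = (case cmp_list cmp_nat A B of GT \<Rightarrow> B # bracket_insert A g | _ \<Rightarrow> A # B # g)"

fun normal_form :: "graph \<Rightarrow> bool \<times> graph" where
  "normal_form [A, B, C] = (case sign_sort A of (a, A) \<Rightarrow> case sign_sort B of (b, B) \<Rightarrow> case sign_sort C of (c, C) \<Rightarrow>
     ((a \<noteq> b) \<noteq> c, bracket_insert A (bracket_insert B [C])))"
| "normal_form g = (False, g)"

text \<open>The flag combines the sorting parity with the sign that skew-symmetry attaches to
  exchanging a1 and a2.\<close>

definition transform :: "symmetry \<Rightarrow> graph \<Rightarrow> bool \<times> graph" where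
  "transform k g = (let m = relabelling k in
     case normal_form (map (map (\<lambda>v. pick m v v)) g) of (b, h) \<Rightarrow> (b \<noteq> swaps k, h))"

text \<open>Comparing neighbours suffices, since the brackets of a normal form are sorted.\<close>

fun repeats :: "nat list \<Rightarrow> bool" where
  "repeats (x # y # xs) = (x = y \<or> repeats (y # xs))"
| "repeats _ = False"

text \<open>A search tree for graphs in normal form. A successful lookup ends at a stored graph
  equal to the given one, which is all that soundness rests on.\<close>

datatype gtree = Leaf | Node gtree graph gtree

abbreviation "cmp_graph \<equiv> cmp_list (cmp_list cmp_nat)"

fun member_tree :: "gtree \<Rightarrow> graph \<Rightarrow> bool" where
  "member_tree Leaf g = False"
| "member_tree (Node l h r) g = (case cmp_graph g h of LT \<Rightarrow> member_tree l g | EQ \<Rightarrow> True | GT \<Rightarrow> member_tree r g)"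

fun insert_tree :: "graph \<Rightarrow> gtree \<Rightarrow> gtree" where
  "insert_tree g Leaf = Node Leaf g Leaf"
| "insert_tree g (Node l h r) = (case cmp_graph g h of
     LT \<Rightarrow> Node (insert_tree g l) h r | EQ \<Rightarrow> Node l h r | GT \<Rightarrow> Node l h (insert_tree g r))"

subsection \<open>The certificate\<close>

text \<open>The data below were found by Gaussian elimination, one block of in-degrees at a time.  A
  step is either a Pluecker relation or the expansion of a Hamiltonian field, in which, after
  bringing its terms to normal form by the listed symmetries, a single graph is still unknown.\<close>

definition basis_graphs :: "graph list" where
  "basis_graphs = [
   [[0,1,4,7],[2,4,5,8],[3,4,6,9]], [[0,1,4,7],[1,4,5,8],[1,4,6,9]], [[0,1,4,7],[1,4,5,8],[4,5,6,9]],
   [[0,4,5,7],[4,5,7,8],[4,6,7,9]], [[0,4,5,7],[4,5,6,8],[4,6,7,9]], [[0,1,4,7],[1,4,5,8],[2,4,6,9]],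
   [[0,1,4,7],[1,2,5,8],[1,3,6,9]], [[0,1,4,7],[1,4,5,8],[4,6,7,9]], [[0,1,4,7],[1,2,5,8],[1,4,6,9]],
   [[0,1,4,7],[1,4,5,8],[1,6,8,9]], [[0,4,5,7],[4,6,7,8],[4,6,7,9]], [[0,1,4,7],[4,5,7,8],[4,6,7,9]],
   [[0,1,4,7],[1,4,5,8],[4,6,8,9]], [[0,1,4,7],[2,4,5,8],[4,5,6,9]], [[0,4,5,7],[4,5,7,8],[6,7,8,9]],
   [[0,1,4,7],[4,5,6,8],[4,5,6,9]], [[0,1,4,7],[2,4,5,8],[4,6,7,9]], [[0,4,5,7],[4,6,7,8],[4,6,8,9]],
   [[0,4,5,7],[1,6,7,8],[4,6,7,9]], [[0,4,5,7],[1,4,6,8],[4,7,8,9]], [[0,1,4,7],[2,4,5,8],[4,6,8,9]],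
   [[0,1,4,7],[1,5,6,8],[5,7,8,9]], [[0,4,5,7],[1,4,6,8],[1,6,7,9]], [[0,4,5,7],[1,2,6,8],[1,4,5,9]],
   [[0,4,5,7],[1,4,5,8],[1,6,8,9]], [[0,4,5,7],[1,4,6,8],[1,4,8,9]], [[0,1,4,7],[1,2,5,8],[1,5,6,9]],
   [[0,4,5,7],[1,2,4,8],[1,2,6,9]], [[0,1,4,7],[2,4,5,8],[3,5,6,9]], [[0,1,4,7],[1,5,6,8],[1,5,6,9]],
   [[0,1,4,7],[1,2,5,8],[3,5,6,9]], [[0,1,4,7],[1,2,5,8],[2,3,6,9]], [[0,4,5,7],[1,4,5,8],[4,6,8,9]],
   [[0,1,4,7],[2,5,6,8],[5,7,8,9]], [[0,4,5,7],[1,4,6,8],[5,6,7,9]], [[0,4,5,7],[1,4,5,8],[2,6,8,9]],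
   [[0,4,5,7],[1,4,6,8],[2,6,7,9]], [[0,1,4,7],[4,5,6,8],[4,5,7,9]], [[0,4,5,7],[1,4,6,8],[4,5,8,9]],
   [[0,4,5,7],[1,4,6,8],[4,5,7,9]], [[0,1,4,7],[4,5,6,8],[4,5,8,9]], [[0,1,4,7],[1,2,5,8],[3,4,6,9]],
   [[0,1,4,7],[2,3,5,8],[2,4,6,9]], [[0,4,5,7],[1,4,6,8],[1,6,8,9]], [[0,1,4,7],[1,5,6,8],[2,5,6,9]],
   [[0,4,5,7],[1,2,6,8],[1,4,6,9]], [[0,4,5,7],[1,4,8,9],[4,6,8,9]], [[0,1,4,7],[1,5,6,8],[5,6,8,9]],
   [[0,1,4,7],[2,4,5,8],[3,6,8,9]], [[0,1,4,7],[2,4,5,8],[3,6,7,9]], [[0,1,4,7],[1,2,5,8],[4,6,8,9]],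
   [[0,1,4,7],[1,4,5,8],[2,6,7,9]], [[0,1,4,7],[2,4,5,8],[2,6,8,9]], [[0,1,4,7],[1,5,6,8],[2,5,7,9]],
   [[0,4,5,7],[1,4,6,8],[2,4,8,9]], [[0,4,5,7],[1,2,4,8],[1,6,8,9]], [[0,4,5,7],[1,4,7,8],[5,6,8,9]],
   [[0,4,5,7],[1,6,7,8],[4,6,8,9]], [[0,4,5,7],[1,6,8,9],[4,5,8,9]], [[0,1,4,7],[2,5,6,8],[5,6,8,9]],
   [[0,4,5,7],[1,4,6,8],[2,6,8,9]]]"

text \<open>An entry \<open>[a, b, c, d]\<close> lists the free targets of Levi-Civita vertex 1,
  then those of vertex 2, in the numbering for two copies.\<close>

definition hamiltonians :: "nat list list" where
  "hamiltonians = [[1, 2, 1, 2], [1, 2, 1, 3], [1, 4, 1, 3], [1, 4, 1, 5], [1, 4, 2, 3], [1, 4, 2, 5], [1, 4, 3, 5], [4, 6, 3, 5]]"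

text \<open>Embeds the numbering for two copies into the one for three. The vertices 0, 3, 6, 9 are
  left free for the sink and the additional copy of P.\<close>

fun lift_label :: "nat \<Rightarrow> nat" where
  "lift_label v = (if v \<le> 2 then v else if v \<le> 4 then Suc v else Suc (Suc v))"

fun hamiltonian_graph :: "nat list \<Rightarrow> graph" where
  "hamiltonian_graph [a, b, c, d] = [[4, 6, c, d], [3, 5, a, b]]"
| "hamiltonian_graph _ = []"

text \<open>The bracket \<open>[0, v, 6, 9]\<close> is the additional copy of P, with its first
  index at the sink and its second acting on vertex \<open>v\<close> of the Hamiltonian; its factor
  \<rho> is vertex 3, which no edge enters. The Leibniz rule gives one graph for each of the six
  vertices.\<close>

definition hamiltonian_field :: "nat list \<Rightarrow> graph list" where
  "hamiltonian_field t = map (\<lambda>v. [0, v, 6, 9] # map (map lift_label) (hamiltonian_graph t)) [1, 2, 4, 5, 7, 8]"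

datatype step = Plu graph "symmetry list" | Der nat "symmetry list"

text \<open>The terms of a Pluecker relation sum to zero, those of a Hamiltonian field to a
  generator, so either sum lies in the span. Each term is paired with the symmetry that is to bring
  it to a known graph.\<close>

fun relation_terms :: "step \<Rightarrow> (int \<times> graph \<times> symmetry) list" where
  "relation_terms (Plu [[p, q, r, s], [e, t, u, w], C] ks) = zip [1, -1, -1, -1, -1] (zip
     [[[p, q, r, s], [e, t, u, w], C], [[e, q, r, s], [p, t, u, w], C], [[p, e, r, s], [q, t, u, w], C],
      [[p, q, e, s], [r, t, u, w], C], [[p, q, r, e], [s, t, u, w], C]] ks)"
| "relation_terms (Plu g ks) = []"
| "relation_terms (Der j ks) = zip [1, 1, 1, 1, 1, 1] (zip (hamiltonian_field (hamiltonians ! j)) ks)"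

fun well_posed :: "step \<Rightarrow> bool" where
  "well_posed (Plu [[p, q, r, s], [e, t, u, w], [_, _, _, _]] ks) = (length ks = 5)"
| "well_posed (Der j ks) = (j < 8 \<and> length ks = 6)"
| "well_posed _ = False"

definition unknowns :: "gtree \<Rightarrow> step \<Rightarrow> (int \<times> graph) list" where
  "unknowns K st = [(if b then - c else c, h). (c, g, k) \<leftarrow> relation_terms st, (b, h) \<leftarrow> [transform k g],
     \<not> list_ex repeats h \<and> \<not> member_tree K h]"

text \<open>When only multiples of one graph are unknown and their total coefficient is nonzero, the
  relation is solved for that graph. A step of any other form leaves the tree as it is, so soundness
  holds for every list of steps.\<close>

definition learn :: "gtree \<Rightarrow> step \<Rightarrow> gtree" where
  "learn K st = (case unknowns K st of [] \<Rightarrow> K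
     | (c, h) # us \<Rightarrow> if well_posed st \<and> list_all (\<lambda>u. snd u = h) us \<and> c + sum_list (map fst us) \<noteq> 0
         then insert_tree h K else K)"

text \<open>A symmetry that carries \<open>h\<close> to itself with the sign reversed gives
  \<open>S h = - S h\<close>.\<close>

definition learn_zero :: "gtree \<Rightarrow> graph \<times> symmetry \<Rightarrow> gtree" where
  "learn_zero K z = (case z of (h, k) \<Rightarrow> if well_formed h \<and> transform k h = (True, h) then insert_tree h K else K)"

text \<open>Graphs with a symmetry that reverses their sign.\<close>

definition vanishing :: "(graph \<times> symmetry) list" where
  "vanishing = [
   ([[0,1,2,4],[1,2,5,7],[3,6,8,9]], (0,0,1,False)), ([[0,1,2,4],[1,2,5,7],[4,6,8,9]], (0,0,1,False)),
   ([[0,1,2,4],[1,3,5,7],[4,6,8,9]], (0,0,1,False)), ([[0,1,2,4],[1,3,5,7],[5,6,8,9]], (0,0,1,False)),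
   ([[0,1,2,4],[1,3,5,7],[6,7,8,9]], (0,0,1,False)), ([[0,1,2,4],[1,4,5,7],[1,6,8,9]], (0,0,1,False)),
   ([[0,1,2,4],[1,4,5,7],[2,6,8,9]], (0,0,1,False)), ([[0,1,2,4],[1,4,5,7],[4,6,8,9]], (0,0,1,False)),
   ([[0,1,2,4],[1,5,6,7],[4,5,8,9]], (0,0,1,False)), ([[0,1,2,4],[1,5,7,8],[2,6,7,9]], (2,1,1,False)),
   ([[0,1,2,4],[1,5,7,8],[3,4,6,9]], (0,0,2,False)), ([[0,1,2,4],[1,5,7,8],[4,5,6,9]], (0,0,2,False)),
   ([[0,1,2,4],[5,6,7,8],[5,6,7,9]], (2,0,0,False)), ([[0,1,4,5],[1,2,4,7],[5,6,8,9]], (0,0,1,False)),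
   ([[0,1,4,5],[1,2,4,7],[6,7,8,9]], (0,0,1,False)), ([[0,1,4,5],[1,2,6,7],[4,7,8,9]], (0,0,1,False)),
   ([[0,1,4,5],[1,4,5,7],[1,6,8,9]], (0,0,1,False)), ([[0,1,4,5],[1,4,5,7],[2,6,8,9]], (0,0,1,False)),
   ([[0,1,4,5],[1,4,5,7],[4,6,8,9]], (0,0,1,False)), ([[0,1,4,5],[1,4,5,7],[6,7,8,9]], (0,0,1,False)),
   ([[0,1,4,5],[1,4,6,7],[1,7,8,9]], (0,0,1,False)), ([[0,1,4,5],[1,4,6,7],[4,7,8,9]], (0,0,1,False)),
   ([[0,1,4,5],[1,4,6,7],[5,7,8,9]], (0,0,1,False)), ([[0,1,4,5],[1,6,7,8],[2,4,5,9]], (0,0,2,False)),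
   ([[0,1,4,5],[1,6,7,8],[4,5,6,9]], (0,0,2,False)), ([[0,1,4,5],[1,6,7,8],[6,7,8,9]], (0,2,0,False)),
   ([[0,1,4,5],[2,4,5,7],[3,6,8,9]], (0,0,1,False)), ([[0,1,4,5],[2,4,5,7],[4,6,8,9]], (0,0,1,False)),
   ([[0,1,4,5],[2,4,5,7],[6,7,8,9]], (0,0,1,False)), ([[0,1,4,5],[2,4,6,7],[3,7,8,9]], (0,0,1,False)),
   ([[0,1,4,5],[2,4,6,7],[4,7,8,9]], (0,0,1,False)), ([[0,1,4,5],[2,4,6,7],[5,7,8,9]], (0,0,1,False)),
   ([[0,1,4,5],[2,6,7,8],[4,5,6,9]], (0,0,2,False)), ([[0,1,4,5],[2,6,7,8],[6,7,8,9]], (0,2,0,False)),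
   ([[0,1,4,5],[4,5,6,7],[4,6,8,9]], (0,0,1,False)), ([[0,1,4,5],[4,5,6,7],[4,7,8,9]], (0,0,1,False)),
   ([[0,1,4,5],[4,6,7,8],[5,6,7,9]], (0,2,1,False)), ([[0,1,4,7],[1,2,4,5],[5,6,8,9]], (0,0,1,False)),
   ([[0,1,4,7],[1,2,4,5],[6,7,8,9]], (0,0,1,False)), ([[0,1,4,7],[1,2,4,8],[5,6,8,9]], (0,1,0,False)),
   ([[0,1,4,7],[1,2,5,8],[4,6,7,9]], (0,0,0,True)), ([[0,1,4,7],[1,2,5,8],[5,6,8,9]], (0,0,0,True)),
   ([[0,1,4,7],[1,4,5,6],[5,7,8,9]], (0,0,1,False)), ([[0,1,4,7],[1,4,5,7],[2,6,8,9]], (0,0,1,False)),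
   ([[0,1,4,7],[1,4,5,8],[2,3,6,9]], (1,0,0,False)), ([[0,1,4,7],[1,5,6,8],[2,3,5,9]], (1,0,0,False)),
   ([[0,1,4,7],[1,5,6,8],[2,4,7,9]], (0,1,0,False)), ([[0,1,4,7],[1,5,6,8],[4,7,8,9]], (0,1,0,False)),
   ([[0,1,4,7],[2,3,5,8],[4,5,6,9]], (1,0,0,False)), ([[0,1,4,7],[2,3,5,8],[4,6,7,9]], (1,0,0,False)),
   ([[0,1,4,7],[2,3,5,8],[4,6,8,9]], (1,0,0,False)), ([[0,1,4,7],[2,3,5,8],[5,6,8,9]], (1,0,0,False)),
   ([[0,1,4,7],[2,4,5,6],[5,7,8,9]], (0,0,1,False)), ([[0,1,4,7],[2,5,6,8],[4,7,8,9]], (0,1,0,False)),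
   ([[0,1,4,7],[4,5,6,7],[5,7,8,9]], (0,0,1,False)), ([[0,4,5,6],[1,4,5,7],[4,7,8,9]], (0,0,1,False)),
   ([[0,4,5,6],[1,4,5,7],[6,7,8,9]], (0,0,1,False)), ([[0,4,5,6],[1,4,7,8],[1,5,7,9]], (0,2,1,False)),
   ([[0,4,5,6],[1,4,7,8],[2,5,7,9]], (2,2,1,False)), ([[0,4,5,6],[4,5,7,8],[4,6,7,9]], (0,1,1,False)),
   ([[0,4,5,6],[4,7,8,9],[5,7,8,9]], (0,2,0,False)), ([[0,4,5,7],[1,2,4,5],[1,6,8,9]], (0,0,1,False)),
   ([[0,4,5,7],[1,2,4,6],[1,7,8,9]], (0,0,1,False)), ([[0,4,5,7],[1,2,4,8],[3,4,6,9]], (2,0,0,False)),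
   ([[0,4,5,7],[1,2,4,8],[3,5,6,9]], (2,0,0,False)), ([[0,4,5,7],[1,2,4,8],[3,6,7,9]], (2,0,0,False)),
   ([[0,4,5,7],[1,2,4,8],[3,6,8,9]], (2,0,0,False)), ([[0,4,5,7],[1,2,4,8],[4,5,6,9]], (2,0,0,False)),
   ([[0,4,5,7],[1,2,4,8],[4,6,7,9]], (2,0,0,False)), ([[0,4,5,7],[1,2,4,8],[4,6,8,9]], (2,0,0,False)),
   ([[0,4,5,7],[1,2,4,8],[5,6,7,9]], (2,0,0,False)), ([[0,4,5,7],[1,2,4,8],[5,6,8,9]], (2,0,0,False)),
   ([[0,4,5,7],[1,2,4,8],[6,7,8,9]], (2,0,0,False)), ([[0,4,5,7],[1,2,6,8],[3,4,5,9]], (2,0,0,False)),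
   ([[0,4,5,7],[1,2,6,8],[3,4,6,9]], (2,0,0,False)), ([[0,4,5,7],[1,2,6,8],[3,4,7,9]], (2,0,0,False)),
   ([[0,4,5,7],[1,2,6,8],[3,4,8,9]], (2,0,0,False)), ([[0,4,5,7],[1,2,6,8],[4,5,6,9]], (2,0,0,False)),
   ([[0,4,5,7],[1,2,6,8],[4,5,7,9]], (2,0,0,False)), ([[0,4,5,7],[1,2,6,8],[4,5,8,9]], (2,0,0,False)),
   ([[0,4,5,7],[1,2,6,8],[4,6,7,9]], (2,0,0,False)), ([[0,4,5,7],[1,2,6,8],[4,6,8,9]], (2,0,0,False)),
   ([[0,4,5,7],[1,2,6,8],[4,7,8,9]], (2,0,0,False)), ([[0,4,5,7],[1,2,7,8],[4,5,6,9]], (2,0,0,False)),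
   ([[0,4,5,7],[1,2,8,9],[3,4,6,8]], (2,0,0,False)), ([[0,4,5,7],[1,2,8,9],[4,5,6,8]], (2,0,0,False)),
   ([[0,4,5,7],[1,4,5,6],[1,7,8,9]], (0,0,1,False)), ([[0,4,5,7],[1,4,5,6],[2,7,8,9]], (0,0,1,False)),
   ([[0,4,5,7],[1,4,5,6],[4,7,8,9]], (0,0,1,False)), ([[0,4,5,7],[1,4,5,6],[6,7,8,9]], (0,0,1,False)),
   ([[0,4,5,7],[1,4,5,7],[1,6,8,9]], (0,0,1,False)), ([[0,4,5,7],[1,4,5,7],[2,6,8,9]], (0,0,1,False)),
   ([[0,4,5,7],[1,4,5,7],[6,7,8,9]], (0,0,1,False)), ([[0,4,5,7],[1,4,5,8],[4,5,6,9]], (0,2,0,False)),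
   ([[0,4,5,7],[1,4,6,8],[1,5,6,9]], (0,2,1,False)), ([[0,4,5,7],[1,4,6,8],[2,5,6,9]], (2,2,1,False)),
   ([[0,4,5,7],[4,5,6,7],[6,7,8,9]], (0,0,1,False)), ([[0,4,5,7],[4,5,6,8],[4,5,6,9]], (0,2,0,False)),
   ([[0,4,5,7],[4,5,6,8],[4,5,7,9]], (0,2,0,False)), ([[0,4,5,7],[4,5,6,8],[4,5,8,9]], (0,2,0,False)),
   ([[0,4,5,7],[4,6,7,8],[5,6,7,9]], (0,2,1,False)), ([[0,4,5,7],[4,6,8,9],[5,6,8,9]], (0,2,0,False))]"

definition steps1 :: "step list" where
  "steps1 = [
   Plu [[0,1,4,7],[5,1,6,8],[4,5,6,9]] [(0,0,0,False),(0,3,2,False),(0,0,0,False),(0,2,0,False),(0,0,0,False)],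
   Plu [[0,1,4,7],[5,2,6,8],[4,5,6,9]] [(0,0,0,False),(2,3,2,False),(0,0,0,False),(0,2,0,False),(0,0,0,False)],
   Plu [[0,4,5,7],[6,7,8,9],[4,5,6,8]] [(0,0,0,False),(0,0,0,True),(0,4,0,False),(0,1,0,False),(0,0,0,False)],
   Plu [[0,4,5,7],[8,4,5,9],[6,7,8,9]] [(0,0,0,False),(0,0,3,False),(0,0,0,False),(0,0,0,False),(0,0,2,False)],
   Plu [[0,4,5,7],[8,4,6,9],[4,7,8,9]] [(0,0,0,False),(0,1,3,False),(0,0,0,False),(0,0,0,True),(0,0,2,False)],
   Plu [[4,6,8,9],[7,0,4,5],[5,7,8,9]] [(0,0,0,False),(0,0,0,False),(0,0,0,False),(0,0,2,False),(0,0,3,False)],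
   Plu [[4,6,8,9],[7,0,4,5],[6,7,8,9]] [(0,0,0,False),(0,0,0,False),(0,1,0,False),(0,0,2,False),(0,0,3,False)],
   Plu [[1,4,7,8],[5,6,7,9],[0,4,5,6]] [(0,0,0,False),(0,3,1,False),(0,2,0,False),(0,0,0,False),(0,0,0,False)],
   Plu [[0,4,5,7],[8,4,6,9],[1,7,8,9]] [(0,0,0,False),(0,1,3,False),(0,0,0,False),(0,0,0,True),(0,0,2,False)],
   Plu [[4,5,7,8],[6,7,8,9],[0,4,5,6]] [(0,0,0,False),(0,4,0,False),(0,1,0,False),(0,0,0,False),(0,0,0,False)],
   Plu [[4,5,6,8],[7,6,8,9],[0,4,5,7]] [(0,0,0,False),(0,2,0,False),(0,0,0,False),(0,0,0,False),(0,0,0,False)],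
   Plu [[0,4,5,7],[6,5,7,9],[1,4,6,8]] [(0,0,0,False),(0,2,1,True),(0,5,0,False),(0,0,0,False),(0,0,0,False)],
   Plu [[1,4,6,8],[5,6,7,9],[0,4,5,7]] [(0,0,0,False),(0,0,1,False),(0,2,0,False),(0,0,0,False),(0,0,0,False)],
   Plu [[0,4,5,7],[6,1,7,8],[4,5,6,9]] [(0,0,0,False),(0,0,0,True),(0,4,0,False),(0,1,0,False),(0,0,0,False)],
   Plu [[5,6,7,9],[4,0,1,7],[4,5,6,8]] [(0,0,0,False),(0,2,0,False),(0,3,0,False),(0,0,0,False),(0,0,1,True)],
   Plu [[4,5,6,8],[7,0,1,4],[5,6,7,9]] [(0,0,0,False),(0,0,0,False),(0,0,0,False),(0,1,0,False),(0,0,2,False)],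
   Plu [[1,4,8,9],[7,0,4,5],[6,7,8,9]] [(0,0,0,False),(0,0,0,False),(0,0,0,False),(0,0,2,False),(0,0,3,False)],
   Plu [[0,4,5,7],[6,5,8,9],[1,4,6,8]] [(0,0,0,False),(0,2,4,True),(0,5,0,False),(0,0,0,False),(0,1,2,False)],
   Plu [[1,4,6,8],[5,6,8,9],[0,4,5,7]] [(0,0,0,False),(0,0,0,False),(0,2,0,False),(0,0,0,False),(0,0,0,False)],
   Plu [[0,1,4,7],[2,4,6,9],[1,2,5,8]] [(0,0,0,False),(0,1,3,False),(2,0,0,False),(0,0,0,False),(0,0,2,False)],
   Plu [[0,1,4,7],[2,1,5,8],[2,4,6,9]] [(0,0,0,False),(0,2,2,False),(0,0,0,False),(0,0,0,True),(2,1,3,False)],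
   Der 0 [(0,3,3,False),(2,3,3,False),(0,1,3,False),(0,4,5,False),(0,3,1,True),(0,5,4,True)],
   Plu [[1,4,8,9],[5,6,8,9],[0,4,5,7]] [(0,0,0,False),(0,0,0,False),(0,2,0,False),(0,0,0,False),(0,0,0,False)],
   Plu [[0,4,5,7],[8,4,5,9],[1,6,7,8]] [(0,0,0,False),(0,0,3,False),(0,0,0,False),(0,0,0,False),(0,0,2,False)],
   Plu [[0,1,4,7],[8,4,5,9],[5,6,7,8]] [(0,0,0,False),(0,0,3,False),(0,0,0,True),(0,0,0,False),(0,0,2,False)],
   Plu [[4,5,8,9],[1,0,4,7],[5,6,8,9]] [(0,0,0,False),(0,0,0,False),(0,0,0,False),(0,0,2,True),(0,0,3,True)],
   Plu [[4,5,8,9],[7,0,1,4],[5,6,7,8]] [(0,0,0,False),(0,0,0,False),(0,2,0,False),(0,0,2,False),(0,0,3,False)],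
   Plu [[4,6,7,8],[5,7,8,9],[0,1,4,5]] [(0,0,0,False),(0,2,0,False),(0,0,0,False),(0,0,0,False),(0,0,0,False)],
   Plu [[0,4,5,7],[1,4,5,8],[6,7,8,9]] [(0,0,0,False),(0,0,2,False),(0,0,0,False),(0,0,0,False),(0,0,0,False)],
   Plu [[4,5,8,9],[0,1,4,7],[5,6,8,9]] [(0,0,0,False),(0,0,0,False),(0,0,4,True),(0,0,5,False),(0,0,4,False)],
   Plu [[0,1,4,7],[5,4,7,8],[5,6,8,9]] [(0,0,0,False),(0,0,0,True),(0,0,0,False),(0,0,0,False),(0,0,0,False)],
   Plu [[4,5,6,8],[7,5,8,9],[0,1,4,7]] [(0,0,0,False),(0,0,0,False),(0,0,0,False),(0,0,0,False),(0,0,0,False)],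
   Plu [[4,5,6,8],[7,0,1,4],[5,7,8,9]] [(0,0,0,False),(0,0,0,False),(0,0,0,False),(0,1,0,False),(0,0,2,False)],
   Plu [[5,6,8,9],[4,0,1,7],[4,5,8,9]] [(0,0,0,False),(0,2,0,False),(0,3,0,False),(0,0,2,True),(0,0,3,True)],
   Plu [[5,6,8,9],[0,1,4,7],[5,6,8,9]] [(0,0,0,False),(0,5,4,True),(0,4,4,True),(0,4,5,False),(0,4,4,False)],
   Plu [[5,6,8,9],[1,0,4,7],[5,6,8,9]] [(0,0,0,False),(0,2,0,False),(0,3,0,False),(0,0,2,True),(0,0,3,True)],
   Der 7 [(0,3,3,False),(2,3,3,False),(0,1,3,False),(0,4,3,False),(0,3,1,True),(0,3,4,True)],
   Plu [[5,6,8,9],[0,1,4,7],[4,5,7,8]] [(0,0,0,False),(0,3,4,True),(0,2,4,True),(0,4,3,False),(0,4,2,False)],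
   Plu [[0,4,5,7],[8,5,7,9],[1,4,6,8]] [(0,0,0,False),(0,2,1,True),(0,2,2,True),(0,0,0,False),(0,0,0,False)],
   Plu [[1,4,5,8],[6,7,8,9],[0,4,5,7]] [(0,0,0,False),(0,0,0,False),(0,2,0,False),(0,0,0,False),(0,0,0,False)]]"

definition steps2 :: "step list" where
  "steps2 = [
   Plu [[0,4,5,7],[6,4,5,8],[1,7,8,9]] [(0,0,0,False),(0,0,2,False),(0,0,0,False),(0,0,0,False),(0,0,0,False)],
   Plu [[1,4,7,8],[5,7,8,9],[0,4,5,6]] [(0,0,0,False),(0,0,0,False),(0,2,0,False),(0,0,0,False),(0,0,0,False)],
   Plu [[0,4,5,7],[6,7,8,9],[1,4,5,8]] [(0,0,0,False),(0,0,2,True),(0,4,0,False),(0,1,0,False),(0,0,0,False)],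
   Plu [[4,5,7,8],[6,7,8,9],[0,4,5,7]] [(0,0,0,False),(0,2,0,False),(0,0,0,False),(0,0,0,False),(0,0,0,False)],
   Plu [[0,4,5,7],[8,4,6,9],[4,5,7,8]] [(0,0,0,False),(0,1,3,False),(0,0,0,False),(0,0,0,True),(0,0,2,False)],
   Plu [[0,4,5,7],[9,6,7,8],[4,5,7,8]] [(0,0,0,False),(0,3,0,True),(0,2,1,True),(0,0,1,True),(0,0,0,False)],
   Plu [[0,4,5,7],[8,4,5,9],[4,6,7,8]] [(0,0,0,False),(0,0,3,False),(0,0,0,False),(0,0,0,False),(0,0,2,False)],
   Plu [[4,5,6,8],[7,4,8,9],[0,4,5,7]] [(0,0,0,False),(0,0,0,False),(0,0,0,False),(0,0,0,False),(0,0,0,False)],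
   Plu [[0,4,5,7],[6,4,5,8],[4,7,8,9]] [(0,0,0,False),(0,0,2,False),(0,0,0,False),(0,0,0,False),(0,0,0,False)],
   Plu [[0,4,5,7],[8,4,7,9],[4,5,6,8]] [(0,0,0,False),(0,0,1,True),(0,0,0,False),(0,0,0,True),(0,0,0,False)],
   Plu [[0,4,5,7],[6,4,5,8],[4,6,7,9]] [(0,0,0,False),(0,0,2,False),(0,0,0,False),(0,0,0,False),(0,0,0,False)],
   Plu [[0,4,5,7],[6,4,7,9],[4,5,6,8]] [(0,0,0,False),(0,0,1,True),(0,0,0,False),(0,1,0,False),(0,0,0,False)],
   Plu [[0,1,4,7],[5,1,6,8],[2,4,5,9]] [(0,0,0,False),(0,3,2,False),(0,0,0,False),(0,2,0,False),(0,0,0,False)],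
   Plu [[1,2,4,8],[5,1,6,9],[0,4,5,7]] [(0,0,0,False),(0,0,0,False),(0,0,1,False),(0,2,0,False),(0,0,0,False)],
   Plu [[0,1,4,7],[2,4,5,9],[1,5,6,8]] [(0,0,0,False),(0,0,3,False),(2,0,1,False),(0,0,0,False),(0,0,2,False)],
   Plu [[0,1,4,7],[5,4,6,9],[1,2,5,8]] [(0,0,0,False),(0,1,5,False),(0,2,0,False),(0,0,0,False),(0,2,2,False)],
   Plu [[0,1,4,7],[2,1,5,8],[4,5,6,9]] [(0,0,0,False),(0,2,2,False),(0,0,0,False),(0,0,0,True),(0,0,0,False)],
   Plu [[1,2,5,8],[4,5,6,9],[0,1,4,7]] [(0,0,0,False),(0,0,1,False),(0,0,0,False),(0,0,0,False),(0,0,0,False)],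
   Plu [[0,1,4,7],[5,2,6,9],[1,4,5,8]] [(0,0,0,False),(2,3,3,False),(0,0,1,False),(0,2,0,False),(0,0,2,False)],
   Plu [[1,4,5,8],[6,1,8,9],[0,4,5,7]] [(0,0,0,False),(0,0,0,False),(0,2,0,False),(0,0,0,False),(0,0,0,False)],
   Plu [[6,7,8,9],[0,1,4,7],[1,4,5,8]] [(0,0,0,False),(0,0,2,True),(0,0,0,False),(0,3,1,True),(0,3,0,True)],
   Plu [[0,1,4,7],[5,1,4,8],[6,7,8,9]] [(0,0,0,False),(0,0,2,False),(0,0,0,False),(0,0,0,False),(0,0,0,False)],
   Plu [[5,6,8,9],[4,0,1,7],[1,4,5,8]] [(0,0,0,False),(0,2,0,False),(0,3,0,False),(0,0,2,True),(0,0,1,True)],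
   Plu [[0,1,4,7],[5,6,8,9],[1,4,5,8]] [(0,0,0,False),(0,3,4,True),(0,0,0,False),(0,2,0,False),(0,0,2,False)],
   Plu [[5,6,8,9],[0,1,4,7],[1,5,6,8]] [(0,0,0,False),(0,5,4,True),(0,4,4,True),(0,4,5,False),(0,4,2,False)],
   Plu [[0,1,4,7],[5,1,6,8],[5,7,8,9]] [(0,0,0,False),(0,5,2,False),(0,0,0,False),(0,2,0,False),(0,2,0,False)],
   Plu [[1,4,5,8],[6,5,8,9],[0,1,4,7]] [(0,0,0,False),(0,0,0,True),(0,0,0,False),(0,0,0,False),(0,0,0,False)],
   Plu [[0,1,4,7],[6,7,8,9],[1,4,5,8]] [(0,0,0,False),(0,0,2,True),(0,1,0,False),(0,3,0,False),(0,0,0,False)],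
   Plu [[0,4,5,7],[1,4,6,8],[1,7,8,9]] [(0,0,0,False),(0,1,2,False),(0,0,0,False),(0,0,0,True),(0,0,0,False)],
   Plu [[0,1,4,7],[5,4,8,9],[1,5,6,8]] [(0,0,0,False),(0,0,4,True),(0,2,0,False),(0,0,0,False),(0,2,2,False)],
   Plu [[5,6,7,9],[1,0,4,7],[1,5,6,8]] [(0,0,0,False),(0,2,0,False),(0,3,0,False),(0,0,0,False),(0,0,1,True)],
   Plu [[5,6,7,9],[4,0,1,7],[1,4,5,8]] [(0,0,0,False),(0,2,0,False),(0,3,0,False),(0,0,0,False),(0,0,1,True)],
   Plu [[0,1,4,7],[5,1,4,8],[5,6,7,9]] [(0,0,0,False),(0,0,2,False),(0,0,0,False),(0,0,0,False),(0,0,0,False)],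
   Plu [[1,4,7,8],[5,6,7,9],[0,1,4,5]] [(0,0,0,False),(0,0,1,False),(0,2,0,False),(0,0,0,False),(0,0,0,False)],
   Plu [[0,1,4,7],[5,6,7,9],[1,4,5,8]] [(0,0,0,False),(0,3,1,True),(0,0,0,False),(0,2,0,False),(0,0,0,False)],
   Plu [[1,4,5,8],[6,1,7,9],[0,4,5,7]] [(0,0,0,False),(0,0,0,False),(0,2,0,False),(0,0,0,False),(0,0,0,False)],
   Plu [[1,4,5,8],[6,5,7,9],[0,1,4,7]] [(0,0,0,False),(0,0,1,True),(0,0,0,False),(0,0,0,False),(0,0,0,False)],
   Plu [[1,5,6,8],[7,0,1,4],[5,6,7,9]] [(0,0,0,False),(0,0,0,False),(0,2,0,False),(0,3,0,False),(0,0,2,False)],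
   Plu [[0,1,4,7],[5,1,6,9],[1,4,5,8]] [(0,0,0,False),(0,3,3,False),(0,0,0,False),(0,2,0,False),(0,0,2,False)],
   Der 2 [(0,3,3,False),(2,3,3,False),(0,1,3,False),(0,4,3,False),(0,3,1,True),(0,3,4,True)]]"

definition steps3 :: "step list" where
  "steps3 = [
   Plu [[1,4,5,8],[6,2,8,9],[0,4,5,7]] [(0,0,0,False),(0,0,0,False),(0,2,0,False),(0,0,0,False),(0,0,0,False)],
   Plu [[6,7,8,9],[0,1,4,7],[2,4,5,8]] [(0,0,0,False),(0,1,0,True),(0,0,0,False),(0,3,1,True),(0,3,0,True)],
   Plu [[0,1,4,7],[5,2,4,8],[6,7,8,9]] [(0,0,0,False),(2,0,2,False),(0,0,0,False),(0,0,0,False),(0,0,0,False)],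
   Plu [[5,6,8,9],[4,0,1,7],[2,4,5,8]] [(0,0,0,False),(0,2,0,False),(0,3,0,False),(0,0,2,True),(0,0,1,True)],
   Plu [[0,1,4,7],[5,6,8,9],[2,4,5,8]] [(0,0,0,False),(2,3,4,True),(2,0,0,False),(0,2,0,False),(0,0,2,False)],
   Plu [[5,6,8,9],[0,1,4,7],[2,5,6,8]] [(0,0,0,False),(2,5,4,True),(2,4,4,True),(2,4,5,False),(2,4,2,False)],
   Der 4 [(0,3,3,False),(2,3,5,False),(0,1,3,False),(0,4,3,False),(0,3,1,True),(2,3,4,True)],
   Plu [[0,1,4,7],[5,2,6,8],[5,7,8,9]] [(0,0,0,False),(2,5,2,False),(0,2,0,False),(0,2,0,False),(0,2,0,False)],
   Plu [[2,4,5,8],[6,5,8,9],[0,1,4,7]] [(0,0,0,False),(0,0,0,True),(0,0,0,False),(0,0,0,False),(0,0,0,False)],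
   Plu [[0,1,4,7],[6,7,8,9],[2,4,5,8]] [(0,0,0,False),(0,1,0,True),(2,1,0,False),(0,3,0,False),(0,0,0,False)],
   Plu [[0,4,5,7],[1,4,6,8],[2,7,8,9]] [(0,0,0,False),(0,1,2,False),(0,0,0,False),(0,0,0,True),(0,0,0,False)],
   Plu [[0,1,4,7],[5,4,8,9],[2,5,6,8]] [(0,0,0,False),(2,0,4,True),(2,2,0,False),(0,0,0,False),(0,2,2,False)],
   Plu [[5,6,7,9],[1,0,4,7],[2,5,6,8]] [(0,0,0,False),(2,2,0,False),(2,3,0,False),(0,0,0,False),(0,0,1,True)],
   Plu [[5,6,7,9],[4,0,1,7],[2,4,5,8]] [(0,0,0,False),(0,2,0,False),(0,3,0,False),(0,0,0,False),(0,0,1,True)],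
   Plu [[0,1,4,7],[5,2,4,8],[5,6,7,9]] [(0,0,0,False),(2,0,2,False),(0,0,0,False),(0,0,0,False),(0,0,0,False)],
   Plu [[2,4,7,8],[5,6,7,9],[0,1,4,5]] [(0,0,0,False),(0,0,1,False),(0,2,0,False),(0,0,0,False),(0,0,0,False)],
   Plu [[0,1,4,7],[5,6,7,9],[2,4,5,8]] [(0,0,0,False),(0,3,1,True),(2,0,0,False),(0,2,0,False),(0,0,0,False)],
   Plu [[1,4,5,8],[6,2,7,9],[0,4,5,7]] [(0,0,0,False),(0,0,1,False),(0,2,0,False),(0,0,0,False),(0,0,0,False)],
   Plu [[2,4,5,8],[6,5,7,9],[0,1,4,7]] [(0,0,0,False),(0,0,1,True),(0,0,0,False),(0,0,0,False),(0,0,0,False)],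
   Plu [[2,5,6,8],[7,0,1,4],[5,6,7,9]] [(0,0,0,False),(0,0,0,False),(0,2,0,False),(0,3,0,False),(0,0,2,False)],
   Plu [[0,4,5,7],[8,4,6,9],[1,4,7,8]] [(0,0,0,False),(0,1,3,False),(0,0,0,False),(0,0,0,True),(0,0,2,False)],
   Der 6 [(0,3,3,False),(2,3,3,False),(0,1,3,False),(0,4,3,False),(0,3,1,True),(0,3,4,True)],
   Plu [[0,4,5,7],[1,4,6,8],[4,7,8,9]] [(0,0,0,False),(0,1,2,False),(0,0,0,False),(0,0,0,True),(0,0,0,False)],
   Plu [[1,4,6,8],[7,4,8,9],[0,4,5,7]] [(0,0,0,False),(0,0,0,False),(0,0,0,False),(0,0,0,False),(0,0,0,False)],
   Plu [[4,5,8,9],[1,0,4,7],[4,6,8,9]] [(0,0,0,False),(0,0,0,False),(0,0,0,False),(0,0,2,True),(0,0,3,True)],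
   Plu [[4,6,8,9],[7,0,1,4],[4,5,7,8]] [(0,0,0,False),(0,0,0,False),(0,1,0,False),(0,0,2,False),(0,0,3,False)],
   Plu [[0,1,4,7],[5,4,7,8],[4,6,8,9]] [(0,0,0,False),(0,0,0,True),(0,0,0,False),(0,0,0,False),(0,0,0,False)],
   Plu [[1,4,7,8],[5,6,7,9],[0,4,5,7]] [(0,0,0,False),(0,0,1,False),(0,2,0,False),(0,0,0,False),(0,0,0,False)],
   Plu [[0,4,5,7],[6,4,8,9],[1,4,5,8]] [(0,0,0,False),(0,0,4,True),(0,0,0,False),(0,1,0,False),(0,0,2,False)],
   Plu [[0,1,4,7],[5,4,7,9],[4,5,6,8]] [(0,0,0,False),(0,0,1,True),(0,0,1,False),(0,0,0,False),(0,0,0,False)],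
   Plu [[1,4,5,8],[6,4,7,9],[0,4,5,7]] [(0,0,0,False),(0,0,1,False),(0,0,0,False),(0,0,0,False),(0,0,0,False)],
   Plu [[0,4,5,7],[1,4,5,8],[4,6,7,9]] [(0,0,0,False),(0,0,2,False),(0,0,0,False),(0,0,0,False),(0,0,0,False)],
   Plu [[1,4,5,8],[6,4,8,9],[0,4,5,7]] [(0,0,0,False),(0,0,0,False),(0,0,0,False),(0,0,0,False),(0,0,0,False)],
   Plu [[0,4,5,7],[6,4,5,9],[1,4,7,8]] [(0,0,0,False),(0,0,3,False),(0,0,0,False),(0,0,0,False),(0,0,0,False)],
   Plu [[0,1,4,7],[5,4,8,9],[4,5,6,8]] [(0,0,0,False),(0,0,4,True),(0,0,0,False),(0,0,0,False),(0,0,2,False)],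
   Plu [[0,4,5,7],[6,4,7,9],[1,4,5,8]] [(0,0,0,False),(0,0,1,True),(0,0,0,False),(0,1,0,False),(0,0,0,False)],
   Plu [[1,4,7,8],[6,7,8,9],[0,4,5,7]] [(0,0,0,False),(0,0,0,False),(0,0,0,False),(0,0,0,False),(0,0,0,False)],
   Plu [[0,1,4,7],[6,4,5,8],[4,5,7,9]] [(0,0,0,False),(0,0,2,False),(0,1,0,False),(0,0,0,False),(0,1,0,False)],
   Plu [[0,1,4,7],[2,3,6,9],[1,2,5,8]] [(0,0,0,False),(3,3,3,False),(2,0,0,False),(0,2,0,True),(0,0,2,False)],
   Plu [[0,1,4,7],[5,4,6,9],[1,4,5,8]] [(0,0,0,False),(0,1,3,False),(0,0,0,False),(0,0,0,False),(0,0,2,False)]]"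

definition steps4 :: "step list" where
  "steps4 = [
   Plu [[0,1,4,7],[5,3,6,9],[2,4,5,8]] [(0,0,0,False),(3,3,3,False),(1,0,1,False),(0,2,0,False),(0,0,2,False)],
   Plu [[0,1,4,7],[5,4,6,9],[2,4,5,8]] [(0,0,0,False),(0,1,3,False),(2,0,0,False),(0,0,0,False),(0,0,2,False)],
   Plu [[0,1,4,7],[5,4,6,8],[4,5,6,9]] [(0,0,0,False),(0,1,2,False),(0,0,0,False),(0,0,0,False),(0,0,3,False)],
   Plu [[0,1,4,7],[5,4,7,8],[4,6,7,9]] [(0,0,0,False),(0,0,0,True),(0,0,0,False),(0,0,0,False),(0,0,0,False)],
   Der 5 [(0,5,3,False),(2,5,3,True),(0,1,3,False),(0,4,3,False),(2,5,1,True),(2,5,4,True)],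
   Plu [[0,1,4,7],[5,1,6,8],[2,5,7,9]] [(0,0,0,False),(0,5,2,False),(0,0,0,False),(0,2,0,False),(0,2,0,False)],
   Plu [[1,2,5,8],[4,6,8,9],[0,1,4,7]] [(0,0,0,False),(0,1,0,True),(0,0,0,False),(0,0,0,False),(0,0,0,False)],
   Plu [[0,1,4,7],[5,1,4,8],[2,6,7,9]] [(0,0,0,False),(0,0,2,False),(0,0,0,False),(0,0,0,False),(0,0,0,False)],
   Plu [[1,2,7,8],[4,6,7,9],[0,1,4,5]] [(0,0,0,False),(0,0,1,False),(0,0,0,False),(0,0,0,False),(0,0,0,False)],
   Plu [[0,1,4,7],[5,1,2,8],[4,6,8,9]] [(0,0,0,False),(0,0,2,True),(0,0,0,False),(0,2,0,False),(0,0,2,False)],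
   Plu [[0,1,4,7],[2,1,5,8],[4,6,8,9]] [(0,0,0,False),(0,2,2,True),(0,0,0,False),(0,0,0,True),(0,0,2,False)],
   Plu [[0,1,4,7],[9,2,6,7],[1,4,5,8]] [(0,0,0,False),(2,3,1,True),(0,1,1,True),(0,0,1,True),(0,0,0,False)],
   Plu [[0,1,4,7],[6,4,8,9],[1,2,5,8]] [(0,0,0,False),(0,0,4,True),(0,1,0,False),(0,0,0,False),(0,1,2,False)],
   Plu [[1,2,4,8],[6,1,8,9],[0,4,5,7]] [(0,0,0,False),(0,0,0,False),(0,0,0,False),(0,0,0,False),(0,0,0,False)],
   Plu [[0,1,4,5],[7,4,6,9],[1,2,7,8]] [(0,0,0,False),(0,1,3,False),(0,0,0,False),(0,0,0,False),(0,0,0,True)],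
   Plu [[1,2,4,8],[6,1,7,9],[0,4,5,7]] [(0,0,0,False),(0,0,0,False),(0,0,1,False),(0,0,0,False),(0,0,0,False)],
   Plu [[0,1,4,7],[2,6,7,9],[1,4,5,8]] [(0,0,0,False),(0,3,1,True),(2,0,0,False),(0,0,0,True),(0,0,0,False)],
   Plu [[0,1,4,7],[6,2,7,9],[1,4,5,8]] [(0,0,0,False),(2,1,1,True),(0,1,1,False),(0,3,0,False),(0,0,0,False)],
   Plu [[0,1,4,7],[8,2,6,9],[1,4,5,8]] [(0,0,0,False),(2,3,5,False),(0,1,2,True),(0,0,2,True),(0,0,2,False)],
   Plu [[0,1,4,7],[6,4,8,9],[2,4,5,8]] [(0,0,0,False),(2,0,4,True),(2,1,0,False),(0,0,0,False),(0,1,2,False)],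
   Plu [[0,1,4,7],[5,2,4,8],[4,6,7,9]] [(0,0,0,False),(2,0,2,False),(0,0,0,False),(0,0,0,False),(0,0,0,False)],
   Plu [[0,1,4,7],[6,4,7,9],[2,4,5,8]] [(0,0,0,False),(0,1,1,True),(2,1,0,False),(0,0,0,False),(0,0,0,False)],
   Der 3 [(0,5,3,False),(2,5,3,False),(0,1,3,False),(0,4,3,False),(0,5,1,True),(0,5,4,True)],
   Plu [[0,1,4,7],[6,1,8,9],[1,4,5,8]] [(0,0,0,False),(0,0,4,True),(0,0,0,False),(0,3,0,False),(0,1,2,False)],
   Plu [[0,1,4,7],[5,1,4,8],[1,6,7,9]] [(0,0,0,False),(0,0,2,False),(0,0,0,False),(0,0,0,False),(0,0,0,False)],
   Plu [[0,1,4,7],[6,4,8,9],[1,4,5,8]] [(0,0,0,False),(0,0,4,True),(0,1,0,False),(0,0,0,False),(0,1,2,False)],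
   Plu [[0,1,4,7],[5,1,4,8],[4,6,7,9]] [(0,0,0,False),(0,0,2,False),(0,0,0,False),(0,0,0,False),(0,0,0,False)],
   Plu [[0,1,4,7],[6,4,7,9],[1,4,5,8]] [(0,0,0,False),(0,1,1,True),(0,1,0,False),(0,0,0,False),(0,0,0,False)],
   Der 1 [(0,3,3,False),(2,3,3,False),(0,1,3,False),(0,4,3,False),(0,3,1,True),(0,3,4,True)],
   Plu [[0,1,4,7],[2,1,5,8],[1,4,6,9]] [(0,0,0,False),(0,2,2,False),(0,0,0,False),(0,0,0,True),(0,1,3,False)],
   Plu [[0,1,4,7],[2,4,6,9],[1,4,5,8]] [(0,0,0,False),(0,1,3,False),(2,0,0,False),(0,0,0,False),(0,0,2,False)],
   Plu [[0,1,4,7],[2,1,5,8],[3,4,6,9]] [(0,0,0,False),(0,2,2,False),(0,0,0,False),(0,0,0,True),(0,0,0,False)],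
   Plu [[0,1,4,7],[3,4,6,9],[1,2,5,8]] [(0,0,0,False),(1,1,3,False),(3,0,0,False),(0,0,0,False),(1,0,2,False)],
   Plu [[0,1,4,7],[3,5,6,9],[1,2,5,8]] [(0,0,0,False),(0,4,5,False),(3,0,0,False),(1,2,0,True),(1,0,2,False)],
   Plu [[0,1,4,7],[5,2,4,8],[3,6,7,9]] [(0,0,0,False),(2,0,2,False),(0,0,0,False),(0,0,0,False),(0,0,0,False)],
   Plu [[0,1,4,7],[6,3,8,9],[2,4,5,8]] [(0,0,0,False),(5,0,4,True),(1,1,0,False),(0,3,0,False),(0,1,2,False)],
   Plu [[0,4,5,7],[6,4,7,9],[4,5,7,8]] [(0,0,0,False),(0,0,1,True),(0,0,0,False),(0,1,0,False),(0,0,0,False)]]"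

definition steps :: "step list" where
  "steps = concat [steps1, steps2, steps3, steps4]"

definition known :: gtree where
  "known = foldl learn (foldl learn_zero (foldl (\<lambda>K g. insert_tree g K) Leaf basis_graphs) vanishing) steps"

section \<open>Enumeration of graphs up to permutations of the \<rho>-vertices\<close>

definition pairs :: "nat list \<Rightarrow> nat list list" where
  "pairs ls = [[a, b]. a \<leftarrow> ls, b \<leftarrow> ls, a < b]"

text \<open>Here vertex 1 issues the edge to the sink. Each bracket contains the two Casimir
  vertices belonging to its issuer, and \<open>v\<close>, \<open>B\<close>, \<open>C\<close> are the
  free targets.\<close>

fun own_graph :: "nat \<Rightarrow> nat list \<Rightarrow> nat list \<Rightarrow> graph" where
  "own_graph v B C = [[0, 4, 7, v], B @ [5, 8], C @ [6, 9]]"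

text \<open>The \<rho>-vertices that occur form an initial segment of 1, 2, 3. Imposed on the
  targets of the first one, two and three brackets, this numbers them in the order of first
  occurrence, bracket by bracket.\<close>

definition initial :: "nat list \<Rightarrow> bool" where
  "initial ls = ((List.member ls 3 \<longrightarrow> List.member ls 2) \<and> (List.member ls 2 \<longrightarrow> List.member ls 1))"

definition first_targets :: "nat list" where
  "first_targets = [1, 2, 3, 5, 6, 8, 9]"

definition second_targets :: "nat list list" where
  "second_targets = pairs [1, 2, 3, 4, 6, 7, 9]"

definition third_targets :: "nat list list" where
  "third_targets = pairs [1, 2, 3, 4, 5, 7, 8]"

definition initial_graphs :: "graph list" where
  "initial_graphs = [own_graph v B C. v \<leftarrow> first_targets, initial [v],
     B \<leftarrow> second_targets, initial (v # B), C \<leftarrow> third_targets, initial (v # B @ C)]"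

definition relabels_initial :: "nat \<Rightarrow> nat list \<Rightarrow> nat list \<Rightarrow> bool" where
  "relabels_initial v B C = list_ex (\<lambda>r. let m = 0 # map Suc (perm3 r); f = (\<lambda>v. pick m v v) in
     initial [f v] \<and> initial (map f (v # B)) \<and> initial (map f (v # B @ C))) [0, 1, 2, 3, 4, 5]"

text \<open>The ten lists together give one symmetry for each entry of
  \<open>initial_graphs\<close>, in the same order; it leads to a normal form contained in
  \<open>known\<close>.\<close>

definition form_symmetries1 :: "symmetry list" where
  "form_symmetries1 = [
   (0,0,0,False), (0,0,0,False), (0,0,0,False), (0,0,0,False), (0,0,0,True), (0,0,0,True), (0,0,0,False), (0,0,0,False),
   (0,0,0,False), (0,0,0,True), (0,0,0,True), (0,0,0,False), (0,0,0,False), (0,0,0,True), (0,0,0,True), (0,0,0,False),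
   (0,0,0,False), (0,0,0,False), (0,0,0,True), (0,0,0,False), (0,0,0,True), (0,1,1,False), (0,0,0,False), (0,0,0,False),
   (0,0,0,False), (0,0,0,False), (0,0,0,False), (0,0,0,False), (0,0,0,False), (0,0,0,False), (0,0,0,False), (0,0,0,False),
   (0,0,0,False), (0,0,0,False), (0,0,0,False), (0,0,0,False), (0,0,0,False), (0,1,1,False), (0,1,1,False), (0,0,0,False),
   (0,1,1,True), (0,1,0,False), (0,1,0,False), (0,1,0,False), (0,0,0,False), (0,1,0,False), (0,1,0,False), (0,0,0,False),
   (0,1,0,False), (0,1,0,False), (0,0,0,False), (0,0,0,False), (0,1,0,False), (0,1,1,True), (0,1,1,False), (0,0,0,True),
   (0,0,0,True), (0,0,0,True), (0,0,0,True), (0,0,0,True), (0,0,0,True), (0,0,0,True), (0,0,0,True), (0,0,0,True),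
   (0,0,0,True), (0,0,0,True), (0,0,0,True), (0,0,0,True), (0,0,0,True), (0,1,1,True), (0,1,1,False), (0,0,1,False),
   (0,1,1,True), (0,0,0,True), (0,0,1,True), (0,0,1,True), (0,0,1,True), (0,0,1,True), (0,0,0,True), (0,0,1,True),
   (0,0,1,True), (0,0,0,True), (0,0,1,True), (0,0,0,True), (0,0,0,True), (0,1,1,False), (1,1,1,False), (0,1,1,False),
   (0,0,1,False), (0,1,1,True)]"

definition form_symmetries2 :: "symmetry list" where
  "form_symmetries2 = [
   (0,1,0,True), (0,0,0,False), (0,0,0,False), (0,0,0,False), (0,0,0,True), (0,0,0,True), (1,0,0,False), (1,0,0,False),
   (1,0,0,True), (1,0,0,True), (0,0,0,False), (0,0,0,False), (0,0,0,False), (0,0,0,True), (0,0,0,False), (0,0,0,True),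
   (0,1,1,False), (1,1,1,False), (0,1,1,False), (0,0,1,False), (0,1,1,True), (0,1,0,True), (0,1,1,False), (0,0,0,False),
   (0,0,0,False), (0,0,0,False), (0,0,0,False), (0,0,0,False), (0,0,0,False), (0,0,0,False), (0,0,0,False), (0,0,0,False),
   (0,0,0,False), (0,0,0,False), (0,0,0,False), (0,0,0,False), (0,0,0,False), (0,1,1,False), (1,1,1,False), (0,1,1,False),
   (0,0,1,False), (0,1,1,True), (0,1,0,True), (0,1,1,False), (0,1,1,False), (0,0,0,False), (0,1,1,True), (0,1,0,False),
   (1,1,1,False), (0,0,0,False), (1,1,1,True), (0,1,0,False), (0,0,0,False), (0,1,0,False), (0,1,0,False), (0,0,0,False),
   (0,0,0,False), (0,1,0,False), (0,1,1,True), (1,1,1,True), (0,1,1,False), (0,0,1,False), (0,1,1,True), (0,1,0,True),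
   (0,1,1,True), (0,1,1,False), (0,0,0,True), (0,0,0,True), (0,0,0,True), (1,1,1,False), (0,0,0,True), (0,0,0,True),
   (0,0,0,True), (0,0,0,True), (0,0,0,True), (0,0,0,True), (0,0,0,True), (0,0,0,True), (0,0,0,True), (0,1,1,True),
   (1,1,1,True), (0,1,1,False), (0,0,1,False), (0,1,1,True), (0,1,0,True), (0,1,1,True), (0,1,1,False), (0,0,1,False),
   (0,1,1,True), (0,0,0,True)]"

definition form_symmetries3 :: "symmetry list" where
  "form_symmetries3 = [
   (1,1,1,False), (1,0,1,False), (1,1,1,True), (0,0,0,True), (0,0,1,True), (0,0,1,True), (0,0,0,True), (0,0,1,True),
   (0,0,0,True), (0,0,0,True), (0,1,1,False), (0,1,1,False), (0,0,1,False), (0,1,1,True), (0,1,0,True), (0,1,1,False),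
   (0,1,1,False), (0,0,1,False), (0,1,1,True), (0,1,0,True), (0,0,0,False), (0,1,0,False), (0,1,0,False), (0,0,0,False),
   (0,0,0,False), (0,1,0,False), (0,1,1,False), (0,1,1,False), (0,0,1,False), (0,1,1,True), (0,1,0,True), (0,1,1,False),
   (0,1,1,False), (0,0,1,False), (0,1,1,True), (0,1,0,True), (0,0,1,False), (0,0,0,False), (0,0,0,False), (0,0,0,True),
   (0,0,0,False), (0,1,0,True), (0,1,1,False), (0,1,1,False), (0,0,1,False), (0,1,1,True), (0,1,0,True), (0,1,1,False),
   (0,1,1,False), (0,0,1,False), (0,1,1,True), (0,1,0,True), (0,0,1,False), (0,1,1,False), (0,0,0,False), (0,0,1,False),
   (0,0,0,False), (0,1,0,True), (0,1,1,True), (0,1,1,False), (0,0,1,False), (0,1,1,True), (0,1,0,True), (0,1,1,True),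
   (0,1,1,False), (0,0,1,False), (0,1,1,True), (0,1,0,True), (0,0,1,False), (0,1,1,True), (0,1,0,False), (0,0,0,True),
   (0,0,0,True), (0,1,0,True), (0,1,1,False), (0,1,1,False), (0,0,1,False), (0,1,1,True), (0,1,0,True), (0,1,1,False),
   (0,1,1,False), (0,0,1,False), (0,1,1,True), (0,1,0,True), (0,0,1,False), (0,1,1,False), (0,1,0,False), (0,0,1,True),
   (0,0,0,False), (0,1,0,True)]"

definition form_symmetries4 :: "symmetry list" where
  "form_symmetries4 = [
   (0,1,1,True), (0,1,1,False), (0,0,1,False), (0,1,1,True), (0,1,0,True), (0,1,1,True), (0,1,1,False), (0,0,1,False),
   (0,1,1,True), (0,1,0,True), (0,0,1,False), (0,0,1,True), (0,0,0,True), (0,0,1,True), (0,0,0,True), (0,0,0,True),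
   (0,2,0,False), (0,2,0,False), (0,2,0,False), (0,2,0,False), (0,2,0,False), (0,2,0,False), (2,2,0,False), (2,2,0,False),
   (2,2,0,False), (2,2,0,False), (2,2,0,False), (0,2,0,False), (0,2,0,False), (0,2,0,False), (0,2,0,False), (0,2,0,False),
   (0,2,0,False), (0,2,0,False), (0,2,0,False), (0,2,0,False), (0,2,0,False), (0,0,1,False), (0,0,0,False), (0,2,0,False),
   (0,0,0,False), (0,0,0,False), (4,0,1,False), (0,0,0,False), (0,2,0,False), (0,0,0,False), (0,0,0,False), (0,0,0,False),
   (0,0,0,False), (0,0,0,False), (0,2,0,False), (0,2,0,False), (0,0,0,False), (0,2,1,False), (0,0,1,False), (0,2,0,False),
   (0,2,0,False), (0,2,0,False), (4,2,1,False), (0,2,0,False), (0,2,0,False), (0,2,0,False), (0,2,0,False), (0,2,0,False),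
   (0,2,0,False), (0,2,0,False), (0,2,0,False), (0,2,0,False), (0,2,0,False), (0,2,1,False), (0,0,1,False), (0,2,1,False),
   (0,2,0,False), (0,2,0,False), (4,2,1,False), (2,0,1,False), (2,2,1,False), (0,2,0,False), (0,2,0,False), (0,2,0,False),
   (0,2,0,False), (0,2,0,False), (0,2,0,False), (0,2,0,False), (0,2,0,False), (0,2,1,False), (0,0,1,False), (0,2,1,False),
   (0,2,1,False), (0,2,0,False)]"

definition form_symmetries5 :: "symmetry list" where
  "form_symmetries5 = [
   (4,2,1,False), (2,0,1,False), (2,2,1,False), (0,2,1,False), (0,2,0,False), (0,2,1,False), (0,2,1,False), (0,2,0,False),
   (0,2,1,False), (0,2,0,False), (0,2,0,False), (0,0,1,False), (0,0,1,False), (0,2,1,False), (0,0,1,False), (0,0,0,False),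
   (0,0,0,False), (0,0,0,False), (0,0,0,False), (0,2,0,False), (0,2,0,False), (0,0,0,False), (0,0,1,False), (0,0,1,False),
   (0,2,1,False), (0,0,1,False), (0,0,0,False), (0,0,1,False), (0,0,0,False), (0,0,0,False), (0,2,0,False), (0,2,0,False),
   (0,0,0,False), (0,0,1,False), (0,0,1,False), (0,2,1,False), (0,0,1,False), (0,0,0,False), (0,0,1,False), (0,0,1,False),
   (0,0,0,False), (0,2,1,False), (0,2,0,False), (0,0,0,False), (0,2,1,False), (0,0,1,False), (0,2,1,False), (0,2,1,False),
   (0,2,0,False), (0,2,1,False), (0,0,1,False), (0,2,0,False), (0,2,0,False), (0,2,0,False), (0,2,0,False), (0,2,1,False),
   (0,0,1,False), (0,2,1,False), (0,2,1,False), (0,2,0,False), (0,2,1,False), (0,0,1,False), (0,0,0,False), (0,2,1,False),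
   (0,2,0,False), (0,2,0,False), (0,2,1,False), (0,0,1,False), (0,2,1,False), (0,2,1,False), (0,2,0,False), (0,2,1,False),
   (0,0,1,False), (0,0,0,False), (0,2,1,False), (0,2,0,False), (0,2,0,False), (0,3,1,False), (1,3,1,False), (0,1,0,False),
   (0,3,0,False), (0,3,0,False), (0,3,0,False), (4,3,1,False), (2,1,0,False), (2,3,0,False), (2,3,0,False), (2,3,0,False),
   (0,1,0,False), (0,3,0,False)]"

definition form_symmetries6 :: "symmetry list" where
  "form_symmetries6 = [
   (0,3,0,False), (0,3,0,False), (0,1,0,False), (0,1,0,False), (0,1,0,False), (0,3,0,False), (0,3,0,False), (0,3,0,False),
   (0,3,1,False), (0,1,1,False), (0,1,0,False), (0,1,0,False), (0,1,0,False), (4,3,1,False), (2,1,1,False), (0,1,0,False),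
   (0,1,0,False), (0,1,0,False), (0,1,0,False), (0,1,0,False), (0,1,0,False), (0,1,0,False), (0,1,0,False), (0,1,0,False),
   (0,3,1,False), (0,3,1,False), (0,3,0,False), (0,3,0,False), (0,3,0,False), (4,3,1,False), (2,3,1,False), (0,3,0,False),
   (0,3,0,False), (0,3,0,False), (0,3,0,False), (0,3,0,False), (0,3,0,False), (0,3,0,False), (0,3,0,False), (0,3,0,False),
   (0,3,1,False), (0,1,1,False), (0,3,1,False), (0,3,1,False), (0,3,0,False), (4,3,1,False), (2,1,1,False), (2,3,1,False),
   (2,3,1,False), (2,3,0,False), (0,1,0,False), (0,1,0,False), (0,1,0,False), (0,3,0,False), (0,3,0,False), (0,3,0,False),
   (0,3,1,False), (0,1,1,False), (0,3,1,False), (0,3,1,False), (0,3,0,False), (4,3,1,False), (2,1,1,False), (2,3,1,False),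
   (2,3,1,False), (2,3,0,False), (0,1,1,False), (0,1,1,False), (0,1,0,False), (0,3,1,False), (0,3,0,False), (0,3,0,False),
   (0,3,1,False), (0,1,1,False), (0,3,1,False), (0,3,1,False), (0,3,0,False), (0,1,0,False), (0,1,0,False), (0,1,0,False),
   (0,3,0,False), (0,3,0,False), (0,3,0,False), (0,3,1,False), (0,1,1,False), (0,3,1,False), (0,3,1,False), (0,3,0,False),
   (0,1,1,False), (0,1,1,False)]"

definition form_symmetries7 :: "symmetry list" where
  "form_symmetries7 = [
   (0,1,0,False), (0,1,0,False), (0,1,0,False), (0,1,0,False), (0,3,1,False), (0,1,1,False), (0,3,1,False), (0,3,1,False),
   (0,3,0,False), (0,1,1,False), (0,1,1,False), (0,1,0,False), (0,3,1,False), (0,1,0,False), (0,1,0,False), (0,3,1,False),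
   (0,3,1,False), (0,3,1,False), (0,3,1,False), (0,3,0,False), (0,3,1,False), (0,3,1,False), (0,3,0,False), (0,3,0,False),
   (0,3,0,False), (0,3,0,False), (0,3,1,False), (0,3,1,False), (0,3,1,False), (0,3,1,False), (0,3,0,False), (0,3,1,False),
   (0,3,1,False), (0,3,0,False), (0,3,1,False), (0,3,0,False), (0,3,0,False), (0,3,1,False), (0,1,1,False), (0,3,1,False),
   (0,3,1,False), (0,3,0,False), (0,1,1,False), (0,1,1,False), (0,1,0,False), (0,3,1,False), (0,3,0,False), (0,3,0,False),
   (0,0,2,True), (0,0,2,True), (0,0,2,True), (0,0,2,True), (0,0,2,True), (0,0,2,True), (2,0,2,True), (2,0,2,True),
   (2,0,2,True), (2,0,2,True), (2,0,2,True), (0,0,2,True), (0,0,2,True), (0,0,2,True), (0,0,2,True), (0,0,2,True),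
   (0,0,2,True), (0,0,2,True), (0,0,2,True), (0,0,2,True), (0,0,2,True), (0,1,2,True), (0,0,2,True), (0,0,2,True),
   (0,1,0,True), (0,1,2,True), (4,1,2,True), (0,0,2,True), (0,0,2,True), (2,1,0,True), (2,1,2,True), (0,0,2,True),
   (0,0,2,True), (0,0,2,True), (0,0,2,True), (0,0,2,True), (0,0,2,True), (0,1,2,True), (0,1,2,True), (0,0,2,True),
   (0,1,0,True), (0,1,2,True)]"

definition form_symmetries8 :: "symmetry list" where
  "form_symmetries8 = [
   (4,1,2,True), (0,1,2,True), (0,0,2,True), (2,1,0,True), (2,1,2,True), (0,0,2,True), (0,1,2,True), (0,1,2,True),
   (0,0,2,True), (0,0,2,True), (0,1,2,True), (0,1,0,True), (0,0,0,True), (0,0,0,True), (0,0,0,True), (0,0,2,True),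
   (4,1,0,True), (0,0,0,True), (0,0,0,True), (0,0,0,True), (0,0,2,True), (0,0,0,True), (0,0,0,True), (0,0,2,True),
   (0,0,0,True), (0,0,2,True), (0,0,0,True), (0,1,2,True), (0,0,2,True), (0,0,2,True), (0,0,2,True), (0,0,2,True),
   (4,1,2,True), (0,0,2,True), (0,0,2,True), (0,0,2,True), (0,0,2,True), (0,0,2,True), (0,0,2,True), (0,0,2,True),
   (0,0,2,True), (0,0,2,True), (0,0,2,True), (0,1,2,True), (0,1,2,True), (0,0,2,True), (0,1,0,True), (0,1,2,True),
   (0,0,2,True), (0,1,0,True), (0,1,2,True), (0,0,0,True), (0,0,2,True), (0,1,2,True), (0,1,0,True), (0,1,0,True),
   (0,0,0,True), (0,1,0,True), (0,1,2,True), (0,0,0,True), (0,0,0,True), (0,0,2,True), (0,0,0,True), (0,0,2,True),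
   (0,1,0,True), (0,1,2,True), (0,1,2,True), (0,0,2,True), (0,1,0,True), (0,1,2,True), (0,0,2,True), (0,0,2,True),
   (0,0,2,True), (0,0,2,True), (0,0,2,True), (0,1,2,True), (0,1,0,True), (0,1,0,True), (0,0,0,True), (0,1,0,True),
   (0,1,2,True), (0,0,0,True), (0,1,0,True), (0,1,2,True), (0,0,0,True), (0,0,2,True), (0,1,0,True), (0,1,2,True),
   (0,1,2,True), (0,0,2,True)]"

definition form_symmetries9 :: "symmetry list" where
  "form_symmetries9 = [
   (0,1,0,True), (0,1,2,True), (0,0,2,True), (0,1,0,True), (0,1,2,True), (0,0,0,True), (0,0,2,True), (0,1,2,True),
   (0,1,0,True), (0,1,0,True), (0,0,0,True), (0,1,0,True), (0,1,2,True), (0,0,0,True), (0,0,0,True), (0,0,2,True),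
   (0,0,0,True), (0,0,2,True), (0,0,0,True), (0,1,3,True), (1,1,3,True), (0,0,3,True), (0,0,3,True), (0,0,1,True),
   (0,0,3,True), (4,1,3,True), (2,0,3,True), (2,0,3,True), (2,0,1,True), (2,0,3,True), (0,0,3,True), (0,0,3,True),
   (0,0,1,True), (0,0,3,True), (0,0,3,True), (0,0,1,True), (0,0,3,True), (0,0,1,True), (0,0,3,True), (0,0,1,True),
   (0,1,3,True), (0,1,3,True), (0,0,3,True), (0,1,1,True), (0,1,3,True), (4,1,3,True), (2,1,3,True), (2,0,3,True),
   (2,1,1,True), (2,1,3,True), (0,0,3,True), (0,0,1,True), (0,0,3,True), (0,0,1,True), (0,0,3,True), (0,0,1,True),
   (0,1,3,True), (0,1,3,True), (0,0,3,True), (0,1,1,True), (0,1,3,True), (4,1,3,True), (2,1,3,True), (2,0,3,True),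
   (2,1,1,True), (2,1,3,True), (0,0,3,True), (0,1,1,True), (0,1,3,True), (0,0,1,True), (0,0,3,True), (0,1,1,True),
   (0,1,3,True), (0,0,1,True), (0,0,1,True), (0,1,1,True), (0,0,1,True), (4,1,3,True), (0,0,1,True), (0,0,1,True),
   (2,1,1,True), (0,0,1,True), (0,0,1,True), (0,0,1,True), (0,0,1,True), (0,0,1,True), (0,0,1,True), (0,0,1,True),
   (0,1,3,True), (0,0,3,True)]"

definition form_symmetries10 :: "symmetry list" where
  "form_symmetries10 = [
   (0,0,3,True), (0,1,3,True), (0,0,3,True), (4,1,3,True), (0,0,3,True), (0,0,3,True), (2,1,3,True), (0,0,3,True),
   (0,0,3,True), (0,0,3,True), (0,0,3,True), (0,0,3,True), (0,0,3,True), (0,0,3,True), (0,1,3,True), (0,1,3,True),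
   (0,0,3,True), (0,1,1,True), (0,1,3,True), (0,0,3,True), (0,1,1,True), (0,1,3,True), (0,0,1,True), (0,0,3,True),
   (0,1,1,True), (0,1,3,True), (0,1,3,True), (0,0,3,True), (0,1,1,True), (0,1,3,True), (0,0,1,True), (0,1,1,True),
   (0,0,1,True), (0,0,1,True), (0,0,1,True), (0,1,1,True), (0,1,3,True), (0,1,3,True), (0,0,3,True), (0,1,3,True),
   (0,1,3,True), (0,0,3,True), (0,1,3,True), (0,0,3,True), (0,0,3,True), (0,0,3,True), (0,1,3,True), (0,1,3,True),
   (0,1,3,True), (0,0,3,True), (0,1,1,True), (0,1,3,True), (0,0,1,True), (0,1,1,True), (0,1,3,True), (0,0,1,True),
   (0,0,1,True), (0,1,1,True), (0,1,3,True), (0,1,3,True), (0,0,3,True), (0,1,3,True), (0,1,3,True), (0,0,3,True),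
   (0,1,3,True), (0,1,3,True), (0,0,3,True), (0,0,3,True), (0,1,3,True), (0,1,3,True), (0,1,3,True), (0,0,3,True),
   (0,1,1,True), (0,1,3,True), (0,0,3,True), (0,0,1,True), (0,0,3,True), (0,0,1,True), (0,0,3,True), (0,0,1,True)]"

definition form_symmetries :: "symmetry list" where
  "form_symmetries = concat [form_symmetries1, form_symmetries2, form_symmetries3, form_symmetries4, form_symmetries5, form_symmetries6, form_symmetries7, form_symmetries8, form_symmetries9, form_symmetries10]"

definition certified :: "gtree \<Rightarrow> graph list \<Rightarrow> symmetry list \<Rightarrow> bool" where
  "certified K = list_all2 (\<lambda>g k. member_tree K (snd (transform k g)))"

subsection \<open>Soundness\<close>

lemma signed_simps [simp]: "signed False = 1" "signed True = -1"
  by (simp_all add: signed_def)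

lemma signed_neq: "signed (a \<noteq> b) = signed a * signed b"
  by (simp add: signed_def)

lemma signed_square: "signed a * signed a = 1"
  by (simp add: signed_def)

lemma well_formed_cases: "well_formed g \<Longrightarrow> \<exists>A B C. g = [A, B, C] \<and> length A = 4 \<and> length B = 4 \<and> length C = 4"
  by (cases g rule: well_formed.cases) auto

lemma well_formed_map: "well_formed (map (map f) g) = well_formed g"
  by (cases g rule: well_formed.cases) auto

lemma length_sign_insert [simp]: "length (snd (sign_insert x ys)) = Suc (length ys)"
  by (induction ys) (auto split: prod.splits)

lemma length_sign_sort [simp]: "length (snd (sign_sort xs)) = length xs"
  by (induction xs) (auto split: prod.splits simp: length_sign_insert[symmetric] simp del: length_sign_insert, metis length_sign_insert snd_conv)

locale bracket_functional_context =
  fixes S :: "graph \<Rightarrow> real"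
  assumes S: "bracket_functional S"
begin

lemma swap_edges: "length xs + length ys = 2 \<Longrightarrow> S [xs @ a # b # ys, B, C] = - S [xs @ b # a # ys, B, C]"
  by (rule S[unfolded bracket_functional_def, THEN conjunct1, rule_format])

lemma swap12: "S [A, B, C] = S [B, A, C]"
  by (rule S[unfolded bracket_functional_def, THEN conjunct2, THEN conjunct1, rule_format])

lemma swap23: "S [A, B, C] = S [A, C, B]"
  by (rule S[unfolded bracket_functional_def, THEN conjunct2, THEN conjunct2, THEN conjunct1, rule_format])

lemma rotate: "S [A, B, C] = S [B, C, A]"
  by (metis swap12 swap23)

lemma plucker: "S [[p, q, r, s], [e, t, u, w], C] =
        S [[e, q, r, s], [p, t, u, w], C] + S [[p, e, r, s], [q, t, u, w], C]
      + S [[p, q, e, s], [r, t, u, w], C] + S [[p, q, r, e], [s, t, u, w], C]"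
  by (rule S[unfolded bracket_functional_def, THEN conjunct2, THEN conjunct2, THEN conjunct2, THEN conjunct1, rule_format])

lemma relabel: "well_formed g \<Longrightarrow> S (map (map (relabel k)) g) = signed (swaps k) * S g"
  by (rule S[unfolded bracket_functional_def, THEN conjunct2, THEN conjunct2, THEN conjunct2, THEN conjunct2, rule_format])

text \<open>The prefix \<open>zs\<close> collects the entries already passed by \<open>x\<close>, so
  that the exchange rule can be used at each position of the bracket.\<close>

lemma sign_insert:
  "length zs + length ys = 3 \<Longrightarrow>
     S [zs @ x # ys, B, C] = signed (fst (sign_insert x ys)) * S [zs @ snd (sign_insert x ys), B, C]"
proof (induction ys arbitrary: zs)
  case (Cons y ys)
  show ?case
  proof (cases "x \<le> y")
    case False
    have "S [zs @ x # y # ys, B, C] = - S [(zs @ [y]) @ x # ys, B, C]"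
      using swap_edges[of zs ys x y B C] Cons.prems by simp
    also have "\<dots> = - signed (fst (sign_insert x ys)) * S [(zs @ [y]) @ snd (sign_insert x ys), B, C]"
      using Cons.IH[of "zs @ [y]"] Cons.prems by simp
    finally show ?thesis using False by (simp add: signed_def split: prod.splits)
  qed simp
qed simp

lemma sign_sort_prefix:
  "length zs + length xs = 4 \<Longrightarrow>
     S [zs @ xs, B, C] = signed (fst (sign_sort xs)) * S [zs @ snd (sign_sort xs), B, C]"
proof (induction xs arbitrary: zs)
  case (Cons x xs)
  obtain b ys where bys: "sign_sort xs = (b, ys)" by force
  obtain c us where cus: "sign_insert x ys = (c, us)" by force
  have len: "length ys = length xs" using length_sign_sort[of xs] bys by simp
  have "S [zs @ x # xs, B, C] = signed b * S [zs @ x # ys, B, C]"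
    using Cons.IH[of "zs @ [x]"] Cons.prems bys by simp
  also have "S [zs @ x # ys, B, C] = signed c * S [zs @ us, B, C]"
    using sign_insert[of zs ys x B C] Cons.prems len cus by simp
  finally show ?case by (simp add: bys cus signed_def)
qed simp

lemma sign_sort:
  "length xs = 4 \<Longrightarrow> S [xs, B, C] = signed (fst (sign_sort xs)) * S [snd (sign_sort xs), B, C]"
  using sign_sort_prefix[of "[]" xs B C] by simp

lemma bracket_order: "S (bracket_insert A (bracket_insert B [C])) = S [A, B, C]"
  by (auto split: comparison.splits) (metis swap12 swap23)+

text \<open>The alternating rule is stated for the first bracket only; three rotations bring each
  bracket to the front in turn.\<close>

lemma normal_form:
  assumes "well_formed g"
  shows "S g = signed (fst (normal_form g)) * S (snd (normal_form g))"
proof -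
  obtain A B C where g: "g = [A, B, C]" and l: "length A = 4" "length B = 4" "length C = 4"
    using well_formed_cases[OF assms] by blast
  obtain a A' b B' c C' where s: "sign_sort A = (a, A')" "sign_sort B = (b, B')" "sign_sort C = (c, C')"
    by (metis surj_pair)
  have "S [A, B, C] = signed a * S [A', B, C]" using sign_sort[OF l(1)] s by simp
  also have "S [A', B, C] = S [B, C, A']" by (rule rotate)
  also have "\<dots> = signed b * S [B', C, A']" using sign_sort[OF l(2)] s by simp
  also have "S [B', C, A'] = S [C, A', B']" by (rule rotate)
  also have "\<dots> = signed c * S [C', A', B']" using sign_sort[OF l(3)] s by simp
  also have "S [C', A', B'] = S [A', B', C']" by (rule rotate)
  finally show ?thesis
    by (simp add: g s bracket_order signed_def del: bracket_insert.simps)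
qed

lemma transform:
  assumes "well_formed g"
  shows "S g = signed (fst (transform k g)) * S (snd (transform k g))"
proof -
  let ?h = "map (map (relabel k)) g"
  have t: "transform k g = (fst (normal_form ?h) \<noteq> swaps k, snd (normal_form ?h))"
    by (simp add: transform_def relabel_def[abs_def] Let_def split: prod.splits)
  have "S g = signed (swaps k) * S ?h"
    using relabel[OF assms, of k] by (simp add: mult.assoc[symmetric] signed_square)
  also have "S ?h = signed (fst (normal_form ?h)) * S (snd (normal_form ?h))"
    using assms by (intro normal_form) (simp add: well_formed_map)
  finally show ?thesis unfolding t fst_conv snd_conv signed_neq by (simp add: mult_ac)
qed

lemma repeated_edge:
  assumes "length xs + length ys = 2"
  shows "S [xs @ a # a # ys, B, C] = 0"
  using swap_edges[OF assms, of a a B C] by simp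

lemma repeats_split: "repeats A \<Longrightarrow> \<exists>xs a ys. A = xs @ a # a # ys"
proof (induction A rule: repeats.induct)
  case (1 x y xs)
  then show ?case
    by (metis append_Cons append_Nil repeats.simps(1))
qed auto

lemma repeats_zero:
  assumes "list_ex repeats [A, B, C]" "length A = 4" "length B = 4" "length C = 4"
  shows "S [A, B, C] = 0"
proof -
  have z: "S [A, B, C] = 0" if "repeats A" "length A = 4" for A B C
    using repeats_split[OF that(1)] that(2) repeated_edge by auto
  consider "repeats A" | "repeats B" | "repeats C" using assms(1) by auto
  then show ?thesis
    using z[of A B C] z[of B C A] z[of C A B] assms rotate[of A B C] rotate[of B C A] by metis
qed

end

lemma well_formed_iff: "well_formed g \<longleftrightarrow> length g = 3 \<and> (\<forall>b\<in>set g. length b = 4)"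
proof
  assume "well_formed g"
  then show "length g = 3 \<and> (\<forall>b\<in>set g. length b = 4)"
    by (cases g rule: well_formed.cases) auto
next
  assume *: "length g = 3 \<and> (\<forall>b\<in>set g. length b = 4)"
  have four: "\<exists>p q r s. b = [p, q, r, s]" if "length b = 4" for b :: "nat list"
    using that by (auto simp: length_Suc_conv eval_nat_numeral)
  from * obtain A B C where g: "g = [A, B, C]"
    by (auto simp: length_Suc_conv eval_nat_numeral)
  from four[of A] four[of B] four[of C] * show "well_formed g"
    by (auto simp: g)
qed

lemma set_bracket_insert: "set (bracket_insert A g) = insert A (set g)"
  by (induction g) (auto split: comparison.splits)

lemma length_bracket_insert [simp]: "length (bracket_insert A g) = Suc (length g)"
  by (induction g) (auto split: comparison.splits)

lemma well_formed_normal_form: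
  assumes "well_formed g"
  shows "well_formed (snd (normal_form g))"
proof -
  obtain A B C where g: "g = [A, B, C]" and l: "length A = 4" "length B = 4" "length C = 4"
    using well_formed_cases[OF assms] by blast
  have "snd (normal_form g) = bracket_insert (snd (sign_sort A)) (bracket_insert (snd (sign_sort B)) [snd (sign_sort C)])"
    by (simp add: g case_prod_unfold del: bracket_insert.simps)
  then show ?thesis
    by (simp add: well_formed_iff set_bracket_insert l del: well_formed.simps bracket_insert.simps)
qed

lemma well_formed_transform: "well_formed g \<Longrightarrow> well_formed (snd (transform k g))"
  using well_formed_normal_form[of "map (map (\<lambda>v. pick (relabelling k) v v)) g"]
  by (simp add: transform_def Let_def well_formed_map case_prod_unfold)

primrec elements :: "gtree \<Rightarrow> graph set" where
  "elements Leaf = {}"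
| "elements (Node l h r) = insert h (elements l \<union> elements r)"

lemma cmp_nat_EQ: "cmp_nat m n = EQ \<Longrightarrow> m = n"
  by (induction m n rule: cmp_nat.induct) auto

lemma cmp_list_EQ: "(\<And>x y. f x y = EQ \<Longrightarrow> x = y) \<Longrightarrow> cmp_list f xs ys = EQ \<Longrightarrow> xs = ys"
  by (induction f xs ys rule: cmp_list.induct) (auto split: comparison.splits)

lemma cmp_graph_EQ: "cmp_graph g h = EQ \<Longrightarrow> g = h"
  using cmp_list_EQ[of "cmp_list cmp_nat" g h] cmp_list_EQ[of cmp_nat] cmp_nat_EQ by blast

lemma member_tree_elements: "member_tree K g \<Longrightarrow> g \<in> elements K"
  by (induction K) (auto split: comparison.splits dest: cmp_graph_EQ)

lemma elements_insert_tree: "elements (insert_tree g K) \<subseteq> insert g (elements K)"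
  by (induction K) (auto split: comparison.splits)

subsection \<open>The span\<close>

definition basis_value :: "(graph \<Rightarrow> real) \<Rightarrow> nat \<Rightarrow> real" where
  "basis_value S j = (if j < 61 then S (basis_graphs ! j)
     else \<Sum>h\<leftarrow>hamiltonian_field (hamiltonians ! (j - 61)). S h)"

text \<open>The coefficients are chosen before \<open>S\<close>. This uniformity is what later makes
  the coordinates of a field constants, independent of \<rho>, a1, a2, of the point and of the
  component.\<close>

definition in_span :: "((graph \<Rightarrow> real) \<Rightarrow> real) \<Rightarrow> bool" where
  "in_span F \<longleftrightarrow> (\<exists>n :: nat \<Rightarrow> real. \<forall>S. bracket_functional S \<longrightarrow> F S = (\<Sum>j<69. n j * basis_value S j))"

abbreviation "spanned g \<equiv> in_span (\<lambda>S. S g)"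

lemma in_span_cong: "in_span F \<Longrightarrow> (\<And>S. bracket_functional S \<Longrightarrow> F S = G S) \<Longrightarrow> in_span G"
  unfolding in_span_def by metis

lemma in_span_0 [simp]: "in_span (\<lambda>S. 0)"
  unfolding in_span_def by (rule exI[of _ "\<lambda>j. 0"]) simp

lemma in_span_add:
  assumes "in_span F" "in_span G"
  shows "in_span (\<lambda>S. F S + G S)"
proof -
  obtain n m where "\<forall>S. bracket_functional S \<longrightarrow> F S = (\<Sum>j<69. n j * basis_value S j)"
    "\<forall>S. bracket_functional S \<longrightarrow> G S = (\<Sum>j<69. m j * basis_value S j)"
    using assms unfolding in_span_def by blast
  then show ?thesis unfolding in_span_def
    by (intro exI[of _ "\<lambda>j. n j + m j"]) (simp add: sum.distrib ring_distribs)
qed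

lemma in_span_scale:
  assumes "in_span F"
  shows "in_span (\<lambda>S. c * F S)"
proof -
  obtain n where "\<forall>S. bracket_functional S \<longrightarrow> F S = (\<Sum>j<69. n j * basis_value S j)"
    using assms unfolding in_span_def by blast
  then show ?thesis unfolding in_span_def
    by (intro exI[of _ "\<lambda>j. c * n j"]) (simp add: sum_distrib_left mult.assoc)
qed

lemma in_span_basis:
  assumes "j < 69"
  shows "in_span (\<lambda>S. basis_value S j)"
  unfolding in_span_def
  by (rule exI[of _ "\<lambda>i. if i = j then 1 else 0"])
     (use assms in \<open>simp add: if_distrib[where f = "\<lambda>c. c * _"] cong: if_cong\<close>)

lemma spanned_transform:
  assumes "well_formed g" "spanned (snd (transform k g))"
  shows "spanned g"
  using in_span_scale[OF assms(2), of "signed (fst (transform k g))"]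
  by (rule in_span_cong)
     (metis assms(1) bracket_functional_context.intro bracket_functional_context.transform)

lemma length_basis_graphs: "length basis_graphs = 61"
  by (simp add: basis_graphs_def)

lemma spanned_basis_graph:
  assumes "g \<in> set basis_graphs"
  shows "spanned g"
proof -
  obtain j where j: "j < 61" "basis_graphs ! j = g"
    using assms by (auto simp: in_set_conv_nth length_basis_graphs)
  show ?thesis
    by (rule in_span_cong[OF in_span_basis[of j]]) (use j in \<open>auto simp: basis_value_def\<close>)
qed

definition sound :: "gtree \<Rightarrow> bool" where
  "sound K \<longleftrightarrow> (\<forall>g\<in>elements K. spanned g)"

lemma sound_insert: "sound K \<Longrightarrow> spanned g \<Longrightarrow> sound (insert_tree g K)"
  using elements_insert_tree[of g K] unfolding sound_def by blast

lemma sound_basis: "(\<And>g. g \<in> set gs \<Longrightarrow> spanned g) \<Longrightarrow> sound K \<Longrightarrow> sound (foldl (\<lambda>K g. insert_tree g K) K gs)"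
  by (induction gs arbitrary: K) (auto intro: sound_insert)

lemma sound_learn_zero:
  assumes "sound K"
  shows "sound (learn_zero K z)"
proof -
  obtain h k where z: "z = (h, k)" by (rule prod.exhaust)
  show ?thesis
  proof (cases "well_formed h \<and> transform k h = (True, h)")
    case True
    have "spanned h"
    proof (rule in_span_cong[OF in_span_0])
      fix S assume "bracket_functional S"
      then interpret bracket_functional_context S by unfold_locales
      show "0 = S h" using transform[of h k] True by simp
    qed
    then show ?thesis using assms by (simp add: z learn_zero_def sound_insert)
  qed (use assms in \<open>auto simp: z learn_zero_def\<close>)
qed

definition unknown_terms :: "gtree \<Rightarrow> (int \<times> graph \<times> symmetry) list \<Rightarrow> (int \<times> graph) list" where
  "unknown_terms K L = [(if b then - c else c, h). (c, g, k) \<leftarrow> L, (b, h) \<leftarrow> [transform k g],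
     \<not> list_ex repeats h \<and> \<not> member_tree K h]"

text \<open>Up to sign every term equals its normal form. A normal form that is stored lies in the
  span, one with a repeated entry in a bracket is zero, and all others are subtracted.\<close>

lemma in_span_known_terms:
  assumes "sound K" "\<And>c g k. (c, g, k) \<in> set L \<Longrightarrow> well_formed g"
  shows "in_span (\<lambda>S. (\<Sum>(c, g, k)\<leftarrow>L. of_int c * S g) - (\<Sum>(c, h)\<leftarrow>unknown_terms K L. of_int c * S h))"
  using assms(2)
proof (induction L)
  case Nil
  then show ?case by (simp add: unknown_terms_def)
next
  case (Cons x L)
  obtain c g k where x: "x = (c, g, k)" by (metis prod_cases3)
  obtain b h where t: "transform k g = (b, h)" by force
  have wf: "well_formed g" using Cons.prems[of c g k] by (simp add: x)
  have wfh: "well_formed h" using well_formed_transform[OF wf, of k] t by simp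
  have IH: "in_span (\<lambda>S. (\<Sum>(c, g, k)\<leftarrow>L. of_int c * S g) - (\<Sum>(c, h)\<leftarrow>unknown_terms K L. of_int c * S h))"
    by (rule Cons.IH) (rule Cons.prems, rule list.set_intros(2))
  have head: "S g = signed b * S h" if "bracket_functional S" for S
    using bracket_functional_context.transform[OF bracket_functional_context.intro[OF that] wf, of k] t by simp
  show ?case
  proof (cases "\<not> list_ex repeats h \<and> \<not> member_tree K h")
    case True
    then have u: "unknown_terms K (x # L) = (if b then - c else c, h) # unknown_terms K L"
      by (simp add: unknown_terms_def x t)
    show ?thesis
      by (rule in_span_cong[OF IH]) (auto simp: u[unfolded x] x head signed_def)
  next
    case False
    then have u: "unknown_terms K (x # L) = unknown_terms K L"
      by (auto simp: unknown_terms_def x t)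
    have "spanned h"
    proof (cases "member_tree K h")
      case True
      then show ?thesis using assms(1) member_tree_elements unfolding sound_def by blast
    next
      case nm: False
      show ?thesis
      proof (rule in_span_cong[OF in_span_0])
        fix S assume "bracket_functional S"
        then interpret bracket_functional_context S by unfold_locales
        obtain A B C where "h = [A, B, C]" "length A = 4" "length B = 4" "length C = 4"
          using well_formed_cases[OF wfh] by blast
        then show "0 = S h" using repeats_zero[of A B C] False nm by auto
      qed
    qed
    from in_span_add[OF in_span_scale[OF this, of "of_int c * signed b"] IH]
    show ?thesis
      by (rule in_span_cong) (auto simp: u[unfolded x] x head)
  qed
qed

lemma hamiltonians_well_formed: "list_all (\<lambda>t. list_all well_formed (hamiltonian_field t)) hamiltonians"
  by code_simp

lemma length_hamiltonians: "length hamiltonians = 8"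
  by (simp add: hamiltonians_def)

lemma hamiltonian_field_well_formed:
  "j < 8 \<Longrightarrow> g \<in> set (hamiltonian_field (hamiltonians ! j)) \<Longrightarrow> well_formed g"
  using hamiltonians_well_formed length_hamiltonians by (auto simp: list_all_iff)

lemma in_span_relation:
  assumes "well_posed st"
  shows "in_span (\<lambda>S. \<Sum>(c, g, k)\<leftarrow>relation_terms st. of_int c * S g)"
    and "(c, g, k) \<in> set (relation_terms st) \<Longrightarrow> well_formed g"
proof -
  consider p q r s e t u w C ks where "st = Plu [[p, q, r, s], [e, t, u, w], C] ks" "length C = 4" "length ks = 5"
    | j ks where "st = Der j ks" "j < 8" "length ks = 6"
    using assms by (cases st rule: well_posed.cases) auto
  then have "in_span (\<lambda>S. \<Sum>(c, g, k)\<leftarrow>relation_terms st. of_int c * S g) \<and> (\<forall>(c, g, k)\<in>set (relation_terms st). well_formed g)"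
  proof cases
    case 1
    obtain k1 k2 k3 k4 k5 where ks: "ks = [k1, k2, k3, k4, k5]"
      using 1(3) by (auto simp: length_Suc_conv eval_nat_numeral)
    have "in_span (\<lambda>S. \<Sum>(c, g, k)\<leftarrow>relation_terms st. of_int c * S g)"
    proof (rule in_span_cong[OF in_span_0])
      fix S assume "bracket_functional S"
      then interpret bracket_functional_context S by unfold_locales
      show "0 = (\<Sum>(c, g, k)\<leftarrow>relation_terms st. of_int c * S g)"
        using plucker[of p q r s e t u w C] by (simp add: 1(1) ks)
    qed
    moreover have "\<forall>(c, g, k)\<in>set (relation_terms st). well_formed g"
      by (auto simp: 1(1) ks well_formed_iff 1(2) simp del: well_formed.simps)
    ultimately show ?thesis by blast
  next
    case 2
    let ?F = "hamiltonian_field (hamiltonians ! j)"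
    obtain k1 k2 k3 k4 k5 k6 where ks: "ks = [k1, k2, k3, k4, k5, k6]"
      using 2(3) by (auto simp: length_Suc_conv eval_nat_numeral)
    have "length ?F = 6" by (simp add: hamiltonian_field_def)
    then obtain g1 g2 g3 g4 g5 g6 where F: "?F = [g1, g2, g3, g4, g5, g6]"
      by (auto simp: length_Suc_conv eval_nat_numeral)
    have "in_span (\<lambda>S. \<Sum>(c, g, k)\<leftarrow>relation_terms st. of_int c * S g)"
      by (rule in_span_cong[OF in_span_basis[of "61 + j"]])
         (use 2(2) in \<open>auto simp: 2(1) ks F basis_value_def\<close>)
    moreover have "\<forall>(c, g, k)\<in>set (relation_terms st). well_formed g"
      using hamiltonian_field_well_formed[OF 2(2)] by (auto simp: 2(1) ks F)
    ultimately show ?thesis by blast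
  qed
  then show "in_span (\<lambda>S. \<Sum>(c, g, k)\<leftarrow>relation_terms st. of_int c * S g)"
    and "(c, g, k) \<in> set (relation_terms st) \<Longrightarrow> well_formed g"
    by auto
qed

text \<open>The relation and its known part lie in the span, hence so does a nonzero multiple of the
  single unknown graph.\<close>

lemma sound_learn:
  assumes "sound K"
  shows "sound (learn K st)"
proof (cases "unknowns K st")
  case (Cons a us)
  obtain c h where a: "a = (c, h)" by force
  show ?thesis
  proof (cases "well_posed st \<and> list_all (\<lambda>u. snd u = h) us \<and> c + sum_list (map fst us) \<noteq> 0")
    case True
    let ?d = "c + sum_list (map fst us)"
    have u: "unknown_terms K (relation_terms st) = (c, h) # us"
      using Cons by (simp add: unknowns_def unknown_terms_def a)
    have "list_all (\<lambda>u. snd u = h) us" using True by blast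
    then have tail: "(\<Sum>(c, h)\<leftarrow>us. of_int c * S h) = of_int (sum_list (map fst us)) * S h" for S :: "graph \<Rightarrow> real"
      by (induction us) (auto simp: ring_distribs)
    have "in_span (\<lambda>S. (\<Sum>(c, g, k)\<leftarrow>relation_terms st. of_int c * S g) - of_int ?d * S h)"
      using True
      by (intro in_span_cong[OF in_span_known_terms[OF assms, of "relation_terms st"]])
         (auto simp: u tail ring_distribs in_span_relation)
    from in_span_add[OF in_span_scale[OF this, of "-1"] in_span_relation(1)[of st]] True
    have "in_span (\<lambda>S. of_int ?d * S h)" by simp
    from in_span_scale[OF this, of "1 / of_int ?d"] True
    have "spanned h" by (simp flip: of_int_add)
    then show ?thesis
      using assms True Cons by (simp add: learn_def a sound_insert)
  qed (use assms Cons in \<open>auto simp: learn_def a\<close>)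
qed (use assms in \<open>simp add: learn_def\<close>)

lemma sound_known: "sound known"
proof -
  have "sound Leaf" by (simp add: sound_def)
  then have "sound (foldl (\<lambda>K g. insert_tree g K) Leaf basis_graphs)"
    by (intro sound_basis spanned_basis_graph)
  moreover have "sound K \<Longrightarrow> sound (foldl learn_zero K zs)" for K zs
    by (induction zs arbitrary: K) (auto intro: sound_learn_zero)
  moreover have "sound K \<Longrightarrow> sound (foldl learn K st)" for K st
    by (induction st arbitrary: K) (auto intro: sound_learn)
  ultimately show ?thesis by (simp add: known_def)
qed

section \<open>Finite checks and stability of the span under the bracket rules\<close>

text \<open>A computation over all 3087 choices of the free targets and the six permutations of the
  \<rho>-vertices.\<close>

lemma relabels_initial_own_graphs:
  "list_all (\<lambda>v. list_all (\<lambda>B. list_all (relabels_initial v B) third_targets) second_targets) first_targets"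
  by code_simp

text \<open>The certificate is executed here: \<open>known\<close> is computed and the 890 normal
  forms are looked up in it.\<close>

lemma certified_initial_graphs: "certified known initial_graphs form_symmetries"
  by code_simp

lemma spanned_initial_graph:
  assumes "g \<in> set initial_graphs" "well_formed g"
  shows "spanned g"
proof -
  obtain i where i: "i < length initial_graphs" "initial_graphs ! i = g"
    using assms(1) by (auto simp: in_set_conv_nth)
  then have "member_tree known (snd (transform (form_symmetries ! i) g))"
    using certified_initial_graphs unfolding certified_def list_all2_conv_all_nth by auto
  then have "spanned (snd (transform (form_symmetries ! i) g))"
    using sound_known member_tree_elements unfolding sound_def by blast
  with assms(2) show ?thesis by (rule spanned_transform)
qed

lemma spanned_swap:
  "spanned [A, B, C] \<Longrightarrow> spanned [B, A, C]" "spanned [A, B, C] \<Longrightarrow> spanned [A, C, B]"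
  by (erule in_span_cong, metis bracket_functional_context.intro bracket_functional_context.swap12 bracket_functional_context.swap23)+

lemma spanned_rotate: "spanned [A, B, C] \<Longrightarrow> spanned [B, C, A]"
  by (blast intro: spanned_swap)

lemma sign_sort_sort: "snd (sign_sort xs) = sort xs"
proof -
  have ins: "snd (sign_insert x ys) = insort x ys" for x and ys :: "nat list"
    by (induction ys) (auto split: prod.splits)
  show ?thesis
    by (induction xs) (auto simp: ins[symmetric] split: prod.splits)
qed

text \<open>Brackets with the same sorted form differ by a sign, which the span absorbs.\<close>

lemma spanned_sort:
  assumes "length A = 4" "sort A = sort A'" "spanned [A, B, C]"
  shows "spanned [A', B, C]"
proof -
  have l: "length A' = 4" using assms(1,2) by (metis length_sort)
  show ?thesis
  proof (rule in_span_cong)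
    show "in_span (\<lambda>S. signed (fst (sign_sort A')) * signed (fst (sign_sort A)) * S [A, B, C])"
      by (rule in_span_scale[OF assms(3)])
    fix S assume "bracket_functional S"
    then interpret bracket_functional_context S by unfold_locales
    show "signed (fst (sign_sort A')) * signed (fst (sign_sort A)) * S [A, B, C] = S [A', B, C]"
      unfolding sign_sort[OF assms(1), of B C] sign_sort[OF l, of B C]
      by (simp add: sign_sort_sort assms(2) signed_def)
  qed
qed

lemma spanned_sort_all:
  assumes "length A = 4" "length B = 4" "length C = 4"
    "sort A = sort A'" "sort B = sort B'" "sort C = sort C'" "spanned [A, B, C]"
  shows "spanned [A', B', C']"
proof -
  have "spanned [B, C, A']"
    by (rule spanned_rotate, rule spanned_sort[OF assms(1,4,7)])
  then have "spanned [C, A', B']"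
    by (intro spanned_rotate[of B'] spanned_sort[OF assms(2,5)])
  then have "spanned [C', A', B']"
    by (rule spanned_sort[OF assms(3,6)])
  then show ?thesis by (rule spanned_rotate)
qed

lemma sort_eqI: "distinct xs \<Longrightarrow> distinct ys \<Longrightarrow> set xs = set ys \<Longrightarrow> sort xs = sort ys"
  by (metis distinct_sort set_sort sorted_distinct_set_unique sorted_sort)

lemma spanned_relabel:
  assumes "well_formed g" "spanned (map (map (relabel k)) g)"
  shows "spanned g"
proof (rule in_span_cong)
  show "in_span (\<lambda>S. signed (swaps k) * S (map (map (relabel k)) g))"
    by (rule in_span_scale[OF assms(2)])
  fix S assume "bracket_functional S"
  then interpret bracket_functional_context S by unfold_locales
  show "signed (swaps k) * S (map (map (relabel k)) g) = S g"
    by (simp add: relabel[OF assms(1)] mult.assoc[symmetric] signed_square)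
qed

section \<open>Skew-symmetrized evaluations as bracket functionals\<close>

lemma perm3_props: "distinct (perm3 r) \<and> set (perm3 r) = {0, 1, 2} \<and> length (perm3 r) = 3"
  by (cases r rule: perm3.cases) auto

lemma set_perm3: "set (perm3 r) = {0, 1, 2}" and length_perm3: "length (perm3 r) = 3"
  and distinct_perm3: "distinct (perm3 r)"
  using perm3_props by blast+

lemma relabelling_props:
  "distinct (relabelling k)" "set (relabelling k) = {0..9}" "length (relabelling k) = 10"
proof -
  obtain r p q s where k: "k = (r, p, q, s)" by (metis surj_pair)
  have dig: "{0..9::nat} = {0, 1, 2, 3, 4, 5, 6, 7, 8, 9}" by auto
  show "set (relabelling k) = {0..9}"
    unfolding dig by (cases s) (auto simp: k set_perm3)
  show "distinct (relabelling k)"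
    by (cases s) (simp_all add: k distinct_map set_perm3 distinct_perm3)
  show "length (relabelling k) = 10" by (simp add: k length_perm3)
qed

lemma pick_nth: "pick xs n d = (if n < length xs then xs ! n else d)"
  by (induction xs n d rule: pick.induct) auto

lemma relabel_image: "relabel k ` {0..9} = {0..9}" and inj_relabel: "inj (relabel k)"
proof -
  have small: "relabel k v = relabelling k ! v" if "v < 10" for v
    using that by (simp add: relabel_def pick_nth relabelling_props)
  have large: "relabel k v = v" if "\<not> v < 10" for v
    using that by (simp add: relabel_def pick_nth relabelling_props)
  have S: "{0..9} = {..<10::nat}" by auto
  have "relabel k ` {..<10} = set (relabelling k)"
    using small by (auto simp: set_conv_nth relabelling_props(3) image_iff)
  then show im: "relabel k ` {0..9} = {0..9}" using relabelling_props(2) S by metis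
  show "inj (relabel k)"
  proof (rule injI)
    fix v w assume eq: "relabel k v = relabel k w"
    have mem: "relabel k u < 10" if "u < 10" for u
    proof -
      have "relabel k u \<in> relabel k ` {0..9}" using that by auto
      then show ?thesis unfolding im by auto
    qed
    show "v = w"
    proof (cases "v < 10"; cases "w < 10")
      assume "v < 10" "w < 10"
      then show ?thesis using eq small relabelling_props(1,3)[of k] nth_eq_iff_index_eq by metis
    qed (use eq mem large in \<open>metis+\<close>)
  qed
qed

lemma relabel_values:
  "relabel (r, p, q, s) 0 = 0"
  "i < 3 \<Longrightarrow> relabel (r, p, q, s) (1 + i) = 1 + perm3 r ! i"
  "i < 3 \<Longrightarrow> relabel (r, p, q, s) (4 + i) = (if s then 7 else 4) + perm3 p ! i"
  "i < 3 \<Longrightarrow> relabel (r, p, q, s) (7 + i) = (if s then 4 else 7) + perm3 q ! i"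
  by (simp_all add: relabel_def pick_nth length_perm3 nth_append)

lemma perm3_less: "i < 3 \<Longrightarrow> perm3 r ! i < 3"
  using nth_mem[of i "perm3 r"] by (auto simp: set_perm3 length_perm3)

lemma vertex_cases:
  fixes v :: nat
  assumes "v \<in> {0..9}"
  obtains "v = 0" | i where "v = 1 + i" "i < 3" | i where "v = 4 + i" "i < 3" | i where "v = 7 + i" "i < 3"
proof -
  have "v = 0 \<or> v = 1 + (v - 1) \<and> v - 1 < 3 \<or> v = 4 + (v - 4) \<and> v - 4 < 3 \<or> v = 7 + (v - 7) \<and> v - 7 < 3"
    using assms unfolding atLeastAtMost_iff by arith
  then show ?thesis using that by blast
qed

text \<open>A symmetry permutes vertices of equal content, apart from possibly exchanging the two
  classes of Casimir vertices.\<close>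

lemma cont_relabel:
  assumes "v \<in> {0..9}"
  shows "cont \<rho> a b s (relabel k v) = (if swaps k then cont \<rho> b a s v else cont \<rho> a b s v)"
proof -
  obtain r p q sw where k: "k = (r, p, q, sw)" by (metis surj_pair)
  from assms show ?thesis
  proof (cases rule: vertex_cases)
    case 1
    then show ?thesis by (simp add: k relabel_values cont_def)
  next
    case (2 i)
    then show ?thesis using perm3_less[of i r] unfolding k 2(1) relabel_values(2)[OF 2(2)] by (simp add: cont_def)
  next
    case (3 i)
    then show ?thesis using perm3_less[of i p] unfolding k 3(1) relabel_values(3)[OF 3(2)] by (simp add: cont_def)
  next
    case (4 i)
    then show ?thesis using perm3_less[of i q] unfolding k 4(1) relabel_values(4)[OF 4(2)] by (simp add: cont_def)
  qed
qed

lemma gev_relabel_sources: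
  assumes "well_formed g"
  shows "gev {0..9} x (map (map (relabel k)) g) (cont \<rho> a b s)
    = gev {0..9} x g (if swaps k then cont \<rho> b a s else cont \<rho> a b s)"
proof -
  have "\<forall>b\<in>set g. length b = 4" using assms by (simp add: well_formed_iff)
  then have "gev (relabel k ` {0..9}) x (map (map (relabel k)) g) (cont \<rho> a b s) = gev {0..9} x g (cont \<rho> a b s \<circ> relabel k)"
    by (rule gev_relabel[OF inj_relabel])
  also have "\<dots> = gev {0..9} x g (if swaps k then cont \<rho> b a s else cont \<rho> a b s)"
    by (rule gev_cong) (simp add: cont_relabel)
  finally show ?thesis by (simp only: relabel_image)
qed

text \<open>The sign under an exchange of the Casimir classes arises because the two terms of the
  difference trade places; the other rules hold for each term separately.\<close>

lemma bracket_functional_skew_gev: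
  assumes "smooth \<rho>" "smooth a" "smooth b" "smooth s"
  shows "bracket_functional (skew_gev x \<rho> a b s)"
proof -
  have c: "smooth_contents (cont \<rho> a b s)" "smooth_contents (cont \<rho> b a s)" using assms by auto
  have sw: "gev {0..9} x [A, B, C] d = gev {0..9} x [A, C, B] d" if "smooth_contents d" for A B C d
    using that by (rule gev_cong_smooth[rotated]) (rule gev_swap)
  have "skew_gev x \<rho> a b s (map (map (relabel k)) g) = signed (swaps k) * skew_gev x \<rho> a b s g"
    if "well_formed g" for k g
    using that by (simp add: skew_gev_def gev_relabel_sources signed_def)
  moreover have "skew_gev x \<rho> a b s [xs @ p # q # ys, B, C] = - skew_gev x \<rho> a b s [xs @ q # p # ys, B, C]"
    if "length xs + length ys = 2" for xs p q ys B C
    unfolding skew_gev_def gev_alternating[OF c(1) that, where a = p and b = q] gev_alternating[OF c(2) that, where a = p and b = q] by simp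
  moreover have "skew_gev x \<rho> a b s [A, B, C] = skew_gev x \<rho> a b s [B, A, C]" for A B C
    unfolding skew_gev_def gev_swap[OF c(1), where a = A and b = B] gev_swap[OF c(2), where a = A and b = B] by simp
  moreover have "skew_gev x \<rho> a b s [A, B, C] = skew_gev x \<rho> a b s [A, C, B]" for A B C
    unfolding skew_gev_def sw[OF c(1), of A B C] sw[OF c(2), of A B C] by simp
  moreover have "skew_gev x \<rho> a b s [[p, q, r, u], [e, t, v, w], C] =
        skew_gev x \<rho> a b s [[e, q, r, u], [p, t, v, w], C] + skew_gev x \<rho> a b s [[p, e, r, u], [q, t, v, w], C]
      + skew_gev x \<rho> a b s [[p, q, e, u], [r, t, v, w], C] + skew_gev x \<rho> a b s [[p, q, r, e], [u, t, v, w], C]"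
    for p q r u e t v w C
    unfolding skew_gev_def gev_plucker[OF c(1), where p = p and q = q and r = r and s = u] gev_plucker[OF c(2), where p = p and q = q and r = r and s = u] by simp
  ultimately show ?thesis
    unfolding bracket_functional_def by blast
qed

section \<open>All micro-graphs lie in the span\<close>

text \<open>The two Casimir vertices belonging to Levi-Civita vertex \<open>k\<close> are the only
  trace of the issuer that a bracket retains.\<close>

definition own_bracket :: "nat \<Rightarrow> nat list \<Rightarrow> bool" where
  "own_bracket k A \<longleftrightarrow> length A = 4 \<and> distinct A \<and> set A \<subseteq> {0..9} \<and> 3 + k \<in> set A \<and> 6 + k \<in> set A"

lemma perm3_0: "i < 3 \<Longrightarrow> perm3 0 ! i = i"
  by (cases i rule: perm3.cases) auto

lemma relabel_rho:
  assumes "v \<in> {0..9}"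
  shows "v = 0 \<or> 4 \<le> v \<Longrightarrow> relabel (r, 0, 0, False) v = v"
    and "v \<in> {1, 2, 3} \<Longrightarrow> relabel (r, 0, 0, False) v \<in> {1, 2, 3}"
proof -
  show "v = 0 \<or> 4 \<le> v \<Longrightarrow> relabel (r, 0, 0, False) v = v"
    using assms
  proof (cases rule: vertex_cases)
    case (3 i)
    then show ?thesis using relabel_values(3)[OF 3(2), of r 0 0 False] perm3_0[OF 3(2)] by simp
  next
    case (4 i)
    then show ?thesis using relabel_values(4)[OF 4(2), of r 0 0 False] perm3_0[OF 4(2)] by simp
  qed (auto simp: relabel_values)
  show "v \<in> {1, 2, 3} \<Longrightarrow> relabel (r, 0, 0, False) v \<in> {1, 2, 3}"
    using assms
  proof (cases rule: vertex_cases)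
    case (2 i)
    have "1 + perm3 r ! i \<in> {1, 2, 3}" using perm3_less[OF 2(2), of r] by auto
    then show ?thesis unfolding 2(1) relabel_values(2)[OF 2(2)] .
  qed auto
qed

lemma pairs_iff: "ls' \<in> set (pairs ls) \<longleftrightarrow> (\<exists>a b. ls' = [a, b] \<and> a \<in> set ls \<and> b \<in> set ls \<and> a < b)"
  by (auto simp: pairs_def)

lemma pairs_subset: "us \<in> set (pairs ls) \<Longrightarrow> set us \<subseteq> set ls"
  by (auto simp: pairs_iff)

lemma targets_small:
  "v \<in> set first_targets \<Longrightarrow> v \<in> {0..9}"
  "B \<in> set second_targets \<Longrightarrow> set B \<subseteq> {0..9}"
  "C \<in> set third_targets \<Longrightarrow> set C \<subseteq> {0..9}"
  using pairs_subset[of B "[1, 2, 3, 4, 6, 7, 9]"] pairs_subset[of C "[1, 2, 3, 4, 5, 7, 8]"]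
  unfolding first_targets_def second_targets_def third_targets_def
  by (auto dest!: subsetD)

lemma relabels_initial_graph:
  assumes "v \<in> set first_targets" "B \<in> set second_targets" "C \<in> set third_targets"
  shows "\<exists>r. initial [relabel (r, 0, 0, False) v]
    \<and> initial (map (relabel (r, 0, 0, False)) (v # B)) \<and> initial (map (relabel (r, 0, 0, False)) (v # B @ C))"
proof -
  have eq: "pick (0 # map Suc (perm3 r)) u u = relabel (r, 0, 0, False) u" if "u \<in> {0..9}" for r u
    using that
  proof (cases rule: vertex_cases)
    case (2 i)
    then show ?thesis using relabel_values(2)[OF 2(2), of r 0 0 False] by (simp add: pick_nth length_perm3)
  next
    case (3 i)
    then show ?thesis using relabel_rho(1)[OF that, of r] by (simp add: pick_nth length_perm3)
  next
    case (4 i)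
    then show ?thesis using relabel_rho(1)[OF that, of r] by (simp add: pick_nth length_perm3)
  qed (simp add: pick_nth relabel_values)
  have "relabels_initial v B C"
    using relabels_initial_own_graphs assms by (simp add: list_all_iff)
  then obtain r where r: "let f = (\<lambda>v. pick (0 # map Suc (perm3 r)) v v) in
      initial [f v] \<and> initial (map f (v # B)) \<and> initial (map f (v # B @ C))"
    unfolding relabels_initial_def list_ex_iff Let_def by blast
  have small: "v \<in> {0..9}" "set B \<subseteq> {0..9}" "set C \<subseteq> {0..9}"
    using assms by (simp_all only: targets_small)
  have m: "map (\<lambda>v. pick (0 # map Suc (perm3 r)) v v) us = map (relabel (r, 0, 0, False)) us" if "set us \<subseteq> {0..9}" for us
    using that by (intro map_cong refl eq) auto
  have sub: "set (v # B) \<subseteq> {0..9}" "set (v # B @ C) \<subseteq> {0..9}" using small by auto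
  show ?thesis
    using r unfolding Let_def m[OF sub(1)] m[OF sub(2)] eq[OF small(1)] by blast
qed

lemma initial_cong: "set us = set vs \<Longrightarrow> initial us = initial vs"
  by (simp add: initial_def)

lemma sort_in_pairs:
  assumes "length us = 2" "distinct us" "set us \<subseteq> set ls"
  shows "sort us \<in> set (pairs ls)"
proof -
  obtain a b where us: "us = [a, b]" using assms(1) by (auto simp: length_Suc_conv eval_nat_numeral)
  show ?thesis
  proof (cases "a < b")
    case True
    then show ?thesis using assms by (auto simp: us pairs_iff)
  next
    case False
    then show ?thesis using assms by (auto simp: us pairs_iff)
  qed
qed

lemma sort_mset: "mset xs = mset ys \<Longrightarrow> sort xs = sort ys"
  by (metis mset_sort properties_for_sort sorted_sort)

text \<open>A permutation of the \<rho>-vertices makes the targets initial. It may disturb the order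
  within the pairs, so these are sorted again to match the enumeration.\<close>

lemma spanned_own_graph:
  assumes v: "v \<in> set first_targets" and B: "B \<in> set second_targets" and C: "C \<in> set third_targets"
  shows "spanned (own_graph v B C)"
proof -
  obtain r where r: "initial [relabel (r, 0, 0, False) v]"
    "initial (map (relabel (r, 0, 0, False)) (v # B))" "initial (map (relabel (r, 0, 0, False)) (v # B @ C))"
    using relabels_initial_graph[OF assms] by blast
  let ?m = "relabel (r, 0, 0, False)"
  have small: "v \<in> {0..9}" "set B \<subseteq> {0..9}" "set C \<subseteq> {0..9}"
    using assms by (simp_all only: targets_small)
  have m: "?m u \<in> (if u \<in> {1, 2, 3} then {1, 2, 3} else {u})" if "u \<in> {0..9}" for u
  proof (cases "u \<in> {1, 2, 3}")
    case False
    then have "u \<noteq> 1" "u \<noteq> 2" "u \<noteq> 3" by auto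
    then have "u = 0 \<or> 4 \<le> u" by arith
    then show ?thesis using relabel_rho(1)[OF that, of r] False by auto
  qed (use relabel_rho(2)[OF that, of r] in auto)
  have B': "length B = 2" "distinct B" "set B \<subseteq> {1, 2, 3, 4, 6, 7, 9}"
    using B by (auto simp: second_targets_def pairs_iff)
  have C': "length C = 2" "distinct C" "set C \<subseteq> {1, 2, 3, 4, 5, 7, 8}"
    using C by (auto simp: third_targets_def pairs_iff)
  have closed: "?m u \<in> M" if "u \<in> {0..9}" "u \<in> M" "{1, 2, 3} \<subseteq> M" for u M
    using m[OF that(1)] that(2,3) by (cases "u \<in> {1, 2, 3}") auto
  have mv: "?m v \<in> set first_targets"
    by (rule closed[OF small(1) v]) (simp add: first_targets_def)
  have "set (map ?m B) \<subseteq> {1, 2, 3, 4, 6, 7, 9}"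
    unfolding set_map by (intro image_subsetI closed) (use small(2) B'(3) in blast, use B'(3) in blast, simp)
  then have mB: "sort (map ?m B) \<in> set second_targets"
    unfolding second_targets_def using B' inj_relabel[of "(r, 0, 0, False)"]
    by (intro sort_in_pairs) (auto simp: distinct_map inj_on_subset)
  have "set (map ?m C) \<subseteq> {1, 2, 3, 4, 5, 7, 8}"
    unfolding set_map by (intro image_subsetI closed) (use small(3) C'(3) in blast, use C'(3) in blast, simp)
  then have mC: "sort (map ?m C) \<in> set third_targets"
    unfolding third_targets_def using C' inj_relabel[of "(r, 0, 0, False)"]
    by (intro sort_in_pairs) (auto simp: distinct_map inj_on_subset)
  have "initial (?m v # sort (map ?m B))" "initial (?m v # sort (map ?m B) @ sort (map ?m C))"
    using r(2,3) initial_cong[of "?m v # sort (map ?m B)" "map ?m (v # B)"]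
      initial_cong[of "?m v # sort (map ?m B) @ sort (map ?m C)" "map ?m (v # B @ C)"] by auto
  then have "own_graph (?m v) (sort (map ?m B)) (sort (map ?m C)) \<in> set initial_graphs"
    unfolding initial_graphs_def using r(1) mv mB mC by auto
  moreover have "well_formed (own_graph (?m v) (sort (map ?m B)) (sort (map ?m C)))"
    using B'(1) C'(1) by (simp add: well_formed_iff)
  ultimately have "spanned (own_graph (?m v) (sort (map ?m B)) (sort (map ?m C)))"
    by (rule spanned_initial_graph)
  then have "spanned [[0, 4, 7, ?m v], sort (map ?m B) @ [5, 8], sort (map ?m C) @ [6, 9]]" by simp
  then have "spanned [[0, 4, 7, ?m v], map ?m B @ [5, 8], map ?m C @ [6, 9]]"
    by (rule spanned_sort_all[rotated 6]) (simp_all only: B'(1) C'(1) length_append length_sort length_map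
        list.size, simp_all add: sort_mset)
  moreover have "map (map ?m) (own_graph v B C) = [[0, 4, 7, ?m v], map ?m B @ [5, 8], map ?m C @ [6, 9]]"
  proof -
    have "?m 0 = 0" "?m 4 = 4" "?m 5 = 5" "?m 6 = 6" "?m 7 = 7" "?m 8 = 8" "?m 9 = 9"
      by (simp_all add: relabel_rho(1))
    then show ?thesis by simp
  qed
  ultimately have sp: "spanned (map (map ?m) (own_graph v B C))" by (simp only:)
  have "well_formed (own_graph v B C)" using B'(1) C'(1) by (simp add: well_formed_iff)
  then show ?thesis by (rule spanned_relabel[OF _ sp])
qed

lemma remove_two:
  assumes "length A = 4" "distinct A" "x \<in> set A" "y \<in> set A" "x \<noteq> y"
  shows "\<exists>us. length us = 2 \<and> distinct us \<and> set us = set A - {x, y}"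
  using assms by (intro exI[of _ "remove1 x (remove1 y A)"]) (auto simp: length_remove1)

lemma own_bracketD:
  assumes "own_bracket k A"
  shows "length A = 4" "distinct A" "set A \<subseteq> {0..9}" "3 + k \<in> set A" "6 + k \<in> set A"
  using assms by (simp_all add: own_bracket_def)

lemma own_bracket_others:
  assumes "own_bracket k A"
  obtains us where "length us = 2" "distinct us" "set us = set A - {3 + k, 6 + k}"
  using remove_two[of A "3 + k" "6 + k"] own_bracketD[OF assms] by auto

text \<open>Besides the Casimir vertices of its issuer, the bracket with the sink has one free
  target and each of the others has two, none of them the sink.\<close>

lemma spanned_own_brackets:
  assumes A: "own_bracket 1 A" "0 \<in> set A" and B: "own_bracket 2 B" "0 \<notin> set B" and C: "own_bracket 3 C" "0 \<notin> set C"
  shows "spanned [A, B, C]"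
proof -
  obtain us where us: "length us = 2" "distinct us" "set us = set A - {4, 7}"
    by (rule own_bracket_others[OF A(1)]) simp
  then obtain v where v: "set A = {0, 4, 7, v}" "v \<notin> {0, 4, 7}" 
  proof -
    obtain p q where pq: "us = [p, q]" using us(1) by (auto simp: length_Suc_conv eval_nat_numeral)
    have s: "set A - {4, 7} = {p, q}" using us(3) by (simp add: pq)
    have A47: "4 \<in> set A" "7 \<in> set A" using own_bracketD(4,5)[OF A(1)] by simp_all
    then have "set A = {4, 7} \<union> {p, q}" unfolding s[symmetric] by blast
    moreover have "0 \<in> set A - {4, 7}" using A(2) by simp
    then have "0 \<in> {p, q}" by (simp only: s)
    moreover have "p \<noteq> q" using us(2) by (simp add: pq)
    moreover have "p \<notin> {4, 7}" "q \<notin> {4, 7}" using s by blast+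
    ultimately show ?thesis using that[of p] that[of q] by auto
  qed
  obtain bs where bs: "length bs = 2" "distinct bs" "set bs = set B - {5, 8}"
    by (rule own_bracket_others[OF B(1)]) simp
  obtain cs where cs: "length cs = 2" "distinct cs" "set cs = set C - {6, 9}"
    by (rule own_bracket_others[OF C(1)]) simp
  have dig: "{0..9::nat} = {0, 1, 2, 3, 4, 5, 6, 7, 8, 9}" by auto
  have "v \<in> {0..9}" using v(1) own_bracketD(3)[OF A(1)] by blast
  then have "v \<in> set first_targets" using v(2) unfolding dig first_targets_def by auto
  moreover have "set bs \<subseteq> {0..9} - {0, 5, 8}" using bs(3) B(2) own_bracketD(3)[OF B(1)] by blast
  then have "set bs \<subseteq> set [1, 2, 3, 4, 6, 7, 9]" unfolding dig by (rule order_trans) auto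
  then have "sort bs \<in> set second_targets"
    unfolding second_targets_def by (intro sort_in_pairs bs)
  moreover have "set cs \<subseteq> {0..9} - {0, 6, 9}" using cs(3) C(2) own_bracketD(3)[OF C(1)] by blast
  then have "set cs \<subseteq> set [1, 2, 3, 4, 5, 7, 8]" unfolding dig by (rule order_trans) auto
  then have "sort cs \<in> set third_targets"
    unfolding third_targets_def by (intro sort_in_pairs cs)
  ultimately have "spanned (own_graph v (sort bs) (sort cs))"
    by (rule spanned_own_graph)
  then have sp: "spanned [[0, 4, 7, v], sort bs @ [5, 8], sort cs @ [6, 9]]" by simp
  have "distinct (sort bs @ [5, 8])" "set (sort bs @ [5, 8]) = set B"
    using bs own_bracketD(4,5)[OF B(1)] by auto
  moreover have "distinct (sort cs @ [6, 9])" "set (sort cs @ [6, 9]) = set C"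
    using cs own_bracketD(4,5)[OF C(1)] by auto
  moreover have "distinct [0, 4, 7, v]" "set [0, 4, 7, v] = set A" using v by auto
  ultimately show ?thesis
    using bs(1) cs(1) own_bracketD(2)[OF A(1)] own_bracketD(2)[OF B(1)] own_bracketD(2)[OF C(1)]
    by (intro spanned_sort_all[OF _ _ _ _ _ _ sp] sort_eqI) simp_all
qed

lemma own_bracket_relabel:
  assumes "own_bracket k A" "relabel s (3 + k) = 3 + l" "relabel s (6 + k) = 6 + l"
  shows "own_bracket l (map (relabel s) A)"
proof -
  have "set (map (relabel s) A) \<subseteq> relabel s ` {0..9}" using assms(1) by (auto simp: own_bracket_def)
  moreover have "3 + l \<in> relabel s ` set A" "6 + l \<in> relabel s ` set A"
    using assms by (auto simp: own_bracket_def intro: image_eqI[OF sym])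
  ultimately show ?thesis
    using assms(1) inj_relabel[of s] unfolding relabel_image own_bracket_def
    by (auto simp: distinct_map inj_on_subset)
qed

lemma zero_relabel: "0 \<in> set (map (relabel s) A) \<longleftrightarrow> 0 \<in> set A"
proof -
  have z: "relabel s 0 = 0" by (cases s) (simp add: relabel_def)
  show ?thesis using inj_relabel[of s] z by (auto simp: inj_eq[of "relabel s" _ 0, unfolded z] image_iff)
qed

text \<open>The bracket pointing to the sink becomes the first one by reordering brackets and
  renaming the Casimir vertices accordingly. The \<rho>-vertices keep their labels, as brackets are
  not tied to them.\<close>

lemma spanned_graph_of:
  assumes t: "t \<in> micrographs 3 True"
  shows "spanned (graph_of 3 t)"
proof -
  define L where "L k = map (t k) [1, 2, 3, 4]" for k
  have g: "graph_of 3 t = [L 3, L 2, L 1]"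
    by (simp add: graph_of_def L_def upt_rec eval_nat_numeral)
  have L: "own_bracket k (L k)" "0 \<in> set (L k) \<longleftrightarrow> (\<exists>e. t k e = 0)" if "k \<in> {1..3}" for k
  proof -
    have k: "inj (t k)" "range (t k) \<subseteq> {0..9}" "3 + k \<in> range (t k)" "6 + k \<in> range (t k)"
      using t that unfolding micrographs_def vertices_def by auto
    have s: "set (L k) = range (t k)" by (auto simp: L_def UNIV_4)
    have "distinct (L k)"
      using k(1) by (auto simp: L_def inj_eq)
    then show "own_bracket k (L k)" using k s by (simp add: own_bracket_def) (simp add: L_def)
    show "0 \<in> set (L k) \<longleftrightarrow> (\<exists>e. t k e = 0)" unfolding s by (metis rangeE rangeI)
  qed
  have "card {(k, e). k \<in> {1..3} \<and> t k e = 0} = 1" using t by (simp add: micrographs_def)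
  then obtain k0 e0 where z: "{(k, e). k \<in> {1..3} \<and> t k e = 0} = {(k0, e0)}"
    by (auto simp: card_1_singleton_iff)
  have k0: "k0 \<in> {1..3}" "0 \<in> set (L k0)" and other: "0 \<notin> set (L k)" if "k \<in> {1..3}" "k \<noteq> k0" for k
    using z L that by blast+
  have k0: "k0 \<in> {1..3}" "0 \<in> set (L k0)" using z L(2)[of k0] by blast+
  have wf: "well_formed [L i, L j, L k]" for i j k
    by (simp add: well_formed_iff L_def)
  consider "k0 = 1" | "k0 = 2" | "k0 = 3" using k0(1) by fastforce
  then have "spanned [L 1, L 2, L 3]"
  proof cases
    case 1
    show ?thesis
      by (rule spanned_own_brackets) (use 1 L(1) k0(2) other in auto)
  next
    case 2
    \<comment> \<open>\<open>perm3 2\<close> exchanges the first two vertices in both Casimir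
      classes: 4 with 5 and 7 with 8. In the third case \<open>perm3 5\<close> exchanges the outer
      two.\<close>
    let ?s = "(0, 2, 2, False) :: symmetry"
    have s: "relabel ?s 4 = 5" "relabel ?s 5 = 4" "relabel ?s 6 = 6" "relabel ?s 7 = 8" "relabel ?s 8 = 7" "relabel ?s 9 = 9"
      by (simp_all add: relabel_def eval_nat_numeral)
    have "spanned [map (relabel ?s) (L 2), map (relabel ?s) (L 1), map (relabel ?s) (L 3)]"
    proof (rule spanned_own_brackets)
      show "own_bracket 1 (map (relabel ?s) (L 2))" by (rule own_bracket_relabel[OF L(1)[of 2]]) (simp_all add: s)
      show "own_bracket 2 (map (relabel ?s) (L 1))" by (rule own_bracket_relabel[OF L(1)[of 1]]) (simp_all add: s)
      show "own_bracket 3 (map (relabel ?s) (L 3))" by (rule own_bracket_relabel[OF L(1)[of 3]]) (simp_all add: s)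
    qed (use 2 k0(2) other in \<open>simp_all only: zero_relabel, simp_all\<close>)
    then have "spanned [L 2, L 1, L 3]"
      by (intro spanned_relabel[OF wf, where k = ?s]) simp
    then show ?thesis by (rule spanned_swap(1))
  next
    case 3
    let ?s = "(0, 5, 5, False) :: symmetry"
    have s: "relabel ?s 4 = 6" "relabel ?s 5 = 5" "relabel ?s 6 = 4" "relabel ?s 7 = 9" "relabel ?s 8 = 8" "relabel ?s 9 = 7"
      by (simp_all add: relabel_def eval_nat_numeral)
    have "spanned [map (relabel ?s) (L 3), map (relabel ?s) (L 2), map (relabel ?s) (L 1)]"
    proof (rule spanned_own_brackets)
      show "own_bracket 1 (map (relabel ?s) (L 3))" by (rule own_bracket_relabel[OF L(1)[of 3]]) (simp_all add: s)
      show "own_bracket 2 (map (relabel ?s) (L 2))" by (rule own_bracket_relabel[OF L(1)[of 2]]) (simp_all add: s)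
      show "own_bracket 3 (map (relabel ?s) (L 1))" by (rule own_bracket_relabel[OF L(1)[of 1]]) (simp_all add: s)
    qed (use 3 k0(2) other in \<open>simp_all only: zero_relabel, simp_all\<close>)
    then have "spanned [L 3, L 2, L 1]"
      by (intro spanned_relabel[OF wf, where k = ?s]) simp
    then show ?thesis by (blast intro: spanned_swap)
  qed
  then show ?thesis unfolding g by (blast intro: spanned_swap)
qed

section \<open>Hamiltonian vector fields\<close>

definition hamiltonian_micrograph :: "nat list \<Rightarrow> micrograph" where
  "hamiltonian_micrograph h k e = (if k = 1 then [3, 5, h ! 0, h ! 1] else [4, 6, h ! 2, h ! 3])
     ! (if e = 1 then 0 else if e = 2 then 1 else if e = 3 then 2 else 3)"

text \<open>The last condition asks for an edge between {1, 3, 5} and {2, 4, 6}, the two stars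
  formed by a Levi-Civita vertex and its own Casimir vertices.\<close>

fun connected_choice :: "nat list \<Rightarrow> bool" where
  "connected_choice [a, b, c, d] \<longleftrightarrow> distinct [3, 5, a, b] \<and> distinct [4, 6, c, d]
     \<and> set [a, b, c, d] \<subseteq> {1..6} \<and> (a \<in> {2, 4, 6} \<or> b \<in> {2, 4, 6} \<or> c \<in> {1, 3, 5} \<or> d \<in> {1, 3, 5})"
| "connected_choice _ \<longleftrightarrow> False"

lemma hamiltonians_connected: "h \<in> set hamiltonians \<Longrightarrow> connected_choice h"
  by (auto simp: hamiltonians_def)

lemma connected_choice_cases:
  assumes "connected_choice h"
  obtains a b c d where "h = [a, b, c, d]" "distinct [3, 5, a, b]" "distinct [4, 6, c, d]"
    "set [a, b, c, d] \<subseteq> {1..6}" "a \<in> {2, 4, 6} \<or> b \<in> {2, 4, 6} \<or> c \<in> {1, 3, 5} \<or> d \<in> {1, 3, 5}"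
  using assms by (cases h rule: connected_choice.cases) auto

lemma graph_of_hamiltonian:
  assumes "connected_choice h"
  shows "graph_of 2 (hamiltonian_micrograph h) = hamiltonian_graph h"
proof -
  obtain a b c d where h: "h = [a, b, c, d]" by (rule connected_choice_cases[OF assms])
  show ?thesis by (simp add: h graph_of_def hamiltonian_micrograph_def upt_rec eval_nat_numeral)
qed

lemma range_hamiltonian:
  "range (hamiltonian_micrograph [a, b, c, d] 1) = {3, 5, a, b}"
  "range (hamiltonian_micrograph [a, b, c, d] 2) = {4, 6, c, d}"
  unfolding UNIV_4 by (simp_all add: hamiltonian_micrograph_def)

lemma inj_4I:
  fixes f :: "4 \<Rightarrow> 'a"
  assumes "distinct [f 1, f 2, f 3, f 4]"
  shows "inj f"
proof (rule injI)
  fix x y assume "f x = f y"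
  then show "x = y" using exhaust_4[of x] exhaust_4[of y] assms by (elim disjE) simp_all
qed

text \<open>Weak connectedness: each star is connected through its centre, and the linking edge
  joins the two, so every vertex is connected to vertex 1.\<close>

lemma hamiltonian_in_micrographs:
  assumes "connected_choice h"
  shows "hamiltonian_micrograph h \<in> micrographs 2 False"
proof -
  let ?t = "hamiltonian_micrograph h"
  obtain a b c d where h: "h = [a, b, c, d]" and d1: "distinct [3, 5, a, b]" and d2: "distinct [4, 6, c, d]"
    and sub: "set [a, b, c, d] \<subseteq> {1..6}" and link: "a \<in> {2, 4, 6} \<or> b \<in> {2, 4, 6} \<or> c \<in> {1, 3, 5} \<or> d \<in> {1, 3, 5}"
    by (rule connected_choice_cases[OF assms])
  have inj: "inj (?t 1)" "inj (?t 2)"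
    using d1 d2 by (auto intro!: inj_4I simp: h hamiltonian_micrograph_def)
  have two: "{1..2::nat} = {1, 2}" by auto
  let ?R = "edge_rel 2 ?t \<union> (edge_rel 2 ?t)\<inverse>"
  have e1: "(1, v) \<in> ?R\<^sup>*" if "v \<in> {3, 5, a, b}" for v
  proof -
    have "v \<in> range (?t 1)" using that by (simp only: h range_hamiltonian)
    then have "(1, v) \<in> edge_rel 2 ?t" by (auto simp: edge_rel_def)
    then show ?thesis by blast
  qed
  have e2: "(2, v) \<in> ?R\<^sup>*" if "v \<in> {4, 6, c, d}" for v
  proof -
    have "v \<in> range (?t 2)" using that by (simp only: h range_hamiltonian)
    then have "(2, v) \<in> edge_rel 2 ?t" by (auto simp: edge_rel_def)
    then show ?thesis by blast
  qed
  have "sym ?R" by (auto simp: sym_def)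
  then have sym: "(v, u) \<in> ?R\<^sup>*" if "(u, v) \<in> ?R\<^sup>*" for u v
    using that sym_rtrancl symD by metis
  have a1: "(1, v) \<in> ?R\<^sup>*" if "v \<in> {1, 3, 5}" for v using that e1 by auto
  have a2: "(2, v) \<in> ?R\<^sup>*" if "v \<in> {2, 4, 6}" for v using that e2 by auto
  have "(1, 2) \<in> ?R\<^sup>*"
  proof -
    consider v where "v \<in> {a, b}" "v \<in> {2, 4, 6}" | v where "v \<in> {c, d}" "v \<in> {1, 3, 5}"
      using link by blast
    then show ?thesis
    proof cases
      case 1
      then have "(1, v) \<in> ?R\<^sup>*" "(v, 2) \<in> ?R\<^sup>*" using e1[of v] sym[OF a2[of v]] by auto
      then show ?thesis by (rule rtrancl_trans)
    next
      case 2
      then have "(1, v) \<in> ?R\<^sup>*" "(v, 2) \<in> ?R\<^sup>*" using a1[of v] sym[OF e2[of v]] by auto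
      then show ?thesis by (rule rtrancl_trans)
    qed
  qed
  then have from1: "(1, v) \<in> ?R\<^sup>*" if "v \<in> {1..6}" for v
  proof -
    have "v \<in> {1, 3, 5} \<or> v \<in> {2, 4, 6}" using that by auto
    then show ?thesis using a1 a2 \<open>(1, 2) \<in> ?R\<^sup>*\<close> by (meson rtrancl_trans)
  qed
  have "weakly_connected 2 False ?t"
    unfolding weakly_connected_def
  proof (intro ballI)
    fix u v assume "u \<in> vertices 2 False" "v \<in> vertices 2 False"
    then have "(u, 1) \<in> ?R\<^sup>*" "(1, v) \<in> ?R\<^sup>*" using sym[OF from1[of u]] from1[of v] by (auto simp: vertices_def)
    then show "(u, v) \<in> ?R\<^sup>*" by (rule rtrancl_trans)
  qed
  moreover have "inj (?t k) \<and> range (?t k) \<subseteq> vertices 2 False \<and> 2 + k \<in> range (?t k) \<and> 2 * 2 + k \<in> range (?t k)"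
    if "k \<in> {1..2}" for k
  proof -
    consider "k = 1" | "k = 2" using \<open>k \<in> {1..2}\<close> unfolding two by blast
    then show ?thesis
      using inj sub by cases (simp_all add: vertices_def h range_hamiltonian del: One_nat_def)
  qed
  ultimately show ?thesis unfolding micrographs_def by blast
qed

lemma inj_lift_label: "inj lift_label"
  by (rule injI) (auto split: if_splits)

lemma evaluation_hamiltonian:
  assumes "connected_choice h"
  shows "evaluation 2 (hamiltonian_micrograph h) \<rho> a b {} x
      = gev {1, 2, 4, 5, 7, 8} x (map (map lift_label) (hamiltonian_graph h)) (cont \<rho> a b s)"
    and "I \<noteq> {} \<Longrightarrow> evaluation 2 (hamiltonian_micrograph h) \<rho> a b I x = 0"
proof -
  have pos: "hamiltonian_micrograph h k e \<noteq> 0" if "k \<in> {1..2}" for k e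
  proof -
    have "hamiltonian_micrograph h k e \<in> vertices 2 False"
      using hamiltonian_in_micrographs[OF assms] that unfolding micrographs_def by blast
    then show ?thesis by (auto simp: vertices_def)
  qed
  have img: "lift_label ` {1..3 * 2} = {1, 2, 4, 5, 7, 8}"
  proof -
    have "{1..3 * 2::nat} = {1, 2, 3, 4, 5, 6}" by auto
    then show ?thesis by auto
  qed
  have "evaluation 2 (hamiltonian_micrograph h) \<rho> a b {} x
      = gev {1..3 * 2} x (hamiltonian_graph h) (content 2 \<rho> a b)"
    using evaluation_no_sink(1)[of 2, OF pos] graph_of_hamiltonian[OF assms] by simp
  also have "\<dots> = gev {1..3 * 2} x (hamiltonian_graph h) (cont \<rho> a b s \<circ> lift_label)"
    by (rule gev_cong) (auto simp: content_def cont_def)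
  also have "\<dots> = gev (lift_label ` {1..3 * 2}) x (map (map lift_label) (hamiltonian_graph h)) (cont \<rho> a b s)"
  proof (rule gev_relabel[OF inj_lift_label, symmetric])
    obtain a b c d where h: "h = [a, b, c, d]" by (rule connected_choice_cases[OF assms])
    show "\<forall>b\<in>set (hamiltonian_graph h). length b = 4" by (simp add: h)
  qed
  finally show "evaluation 2 (hamiltonian_micrograph h) \<rho> a b {} x
      = gev {1, 2, 4, 5, 7, 8} x (map (map lift_label) (hamiltonian_graph h)) (cont \<rho> a b s)"
    by (simp only: img)
  show "I \<noteq> {} \<Longrightarrow> evaluation 2 (hamiltonian_micrograph h) \<rho> a b I x = 0"
    using evaluation_no_sink(2)[of 2, OF pos] by simp
qed

text \<open>The derivative that P applies to the Hamiltonian is spread over its six vertices by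
  \<open>pd_gev\<close>. For each of them the vertices in \<open>?W\<close> factor out: the sink
  yields the Kronecker symbol selecting \<open>i\<close>, the others yield \<rho> and the gradients
  of \<open>a\<close> and \<open>b\<close>.\<close>

lemma hamiltonian_bracket:
  assumes h: "connected_choice h" and sm: "smooth \<rho>" "smooth a" "smooth b"
  shows "(\<Sum>g\<leftarrow>hamiltonian_field h. gev {0..9} x g (cont \<rho> a b (\<lambda>x. x $ i)))
    = (\<Sum>m\<in>UNIV. nambu_coeff \<rho> a b i m x * pd m (evaluation 2 (hamiltonian_micrograph h) \<rho> a b {}) x)"
proof -
  let ?V = "{1, 2, 4, 5, 7, 8} :: nat set" and ?W = "{0, 3, 6, 9} :: nat set"
  let ?G = "map (map lift_label) (hamiltonian_graph h)"
  let ?c = "cont \<rho> a b (\<lambda>x. x $ i)"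
  have smc: "smooth_contents ?c" using sm by simp
  have Vs: "{0..9} = ?V \<union> ?W" by auto
  have G: "\<forall>b\<in>set ?G. length b = 4 \<and> set b \<subseteq> ?V"
  proof -
    obtain a b c d where h': "h = [a, b, c, d]" "set [a, b, c, d] \<subseteq> {1..6}"
      by (rule connected_choice_cases[OF h])
    have lift: "lift_label v \<in> ?V" if "v \<in> {1..6}" for v
      using that by auto
    show ?thesis using h'(2) lift[of a] lift[of b] lift[of c] lift[of d] by (simp add: h'(1))
  qed
  have bracket: "gev {0..9} x ([0, v, 6, 9] # ?G) ?c = (\<Sum>m\<in>UNIV. nambu_coeff \<rho> a b i m x * gev ?V x ?G (dv v m ?c))"
    if v: "v \<in> ?V" for v
  proof -
    have "gev {0..9} x ?G (dv4 [0, v, 6, 9] (j, m, k, l) ?c)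
        = (if j = i then \<rho> x * pd k a x * pd l b x * gev ?V x ?G (dv v m ?c) else 0)" for j m k l
    proof -
      let ?d = "dv4 [0, v, 6, 9] (j, m, k, l) ?c"
      have d: "?d 0 = (\<lambda>x. if j = i then 1 else 0)" "?d 3 = \<rho>" "?d 6 = pd k a" "?d 9 = pd l b"
        using v by (auto simp: dv_def cont_def pd_coord)
      have "gev ?V x ?G ?d = gev ?V x ?G (dv v m ?c)"
        by (rule gev_cong) (auto simp: dv_def)
      moreover have "gev {0..9} x ?G ?d = (\<Prod>w\<in>?W. ?d w x) * gev ?V x ?G ?d"
        unfolding Vs by (rule gev_split[OF G]) auto
      moreover have "(\<Prod>w\<in>?W. ?d w x) = (if j = i then \<rho> x * pd k a x * pd l b x else 0)"
        by (simp add: d del: dv4.simps)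
      ultimately show ?thesis by simp
    qed
    then have "gev {0..9} x ([0, v, 6, 9] # ?G) ?c = (\<Sum>j\<in>UNIV. \<Sum>m\<in>UNIV. \<Sum>k\<in>UNIV. \<Sum>l\<in>UNIV.
        levi_civita j m k l * (if j = i then \<rho> x * pd k a x * pd l b x * gev ?V x ?G (dv v m ?c) else 0))"
      unfolding gev_Cons sum_quadruples lc4.simps by (simp only:)
    also have "\<dots> = (\<Sum>j\<in>UNIV. if j = i then (\<Sum>m\<in>UNIV. \<Sum>k\<in>UNIV. \<Sum>l\<in>UNIV.
        levi_civita j m k l * (\<rho> x * pd k a x * pd l b x * gev ?V x ?G (dv v m ?c))) else 0)"
      by (intro sum.cong) auto
    also have "\<dots> = (\<Sum>m\<in>UNIV. nambu_coeff \<rho> a b i m x * gev ?V x ?G (dv v m ?c))"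
      by (simp add: nambu_coeff_def sum_distrib_right sum_distrib_left mult_ac)
    finally show ?thesis .
  qed
  have "(\<Sum>g\<leftarrow>hamiltonian_field h. gev {0..9} x g ?c) = (\<Sum>v\<in>?V. gev {0..9} x ([0, v, 6, 9] # ?G) ?c)"
    by (simp add: hamiltonian_field_def)
  also have "\<dots> = (\<Sum>v\<in>?V. \<Sum>m\<in>UNIV. nambu_coeff \<rho> a b i m x * gev ?V x ?G (dv v m ?c))"
    by (rule sum.cong[OF refl bracket])
  also have "\<dots> = (\<Sum>m\<in>UNIV. nambu_coeff \<rho> a b i m x * (\<Sum>v\<in>?V. gev ?V x ?G (dv v m ?c)))"
    by (subst sum.swap) (simp only: sum_distrib_left)
  also have "\<dots> = (\<Sum>m\<in>UNIV. nambu_coeff \<rho> a b i m x * pd m (\<lambda>x. gev ?V x ?G ?c) x)"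
    by (simp only: pd_gev[OF smc] finite.intros)
  also have "(\<lambda>x. gev ?V x ?G ?c) = evaluation 2 (hamiltonian_micrograph h) \<rho> a b {}"
    using evaluation_hamiltonian(1)[OF h] by (intro ext) simp
  finally show ?thesis .
qed

lemma smooth_evaluation_hamiltonian:
  assumes "connected_choice h" "smooth \<rho>" "smooth a" "smooth b"
  shows "smooth (evaluation 2 (hamiltonian_micrograph h) \<rho> a b {})"
proof -
  have "evaluation 2 (hamiltonian_micrograph h) \<rho> a b {}
      = (\<lambda>x. gev {1, 2, 4, 5, 7, 8} x (map (map lift_label) (hamiltonian_graph h)) (cont \<rho> a b (\<lambda>x. 0)))"
    using evaluation_hamiltonian(1)[OF assms(1)] by (intro ext) simp
  then show ?thesis using assms by (simp add: smooth_gev)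
qed

lemma nambu_coeff_swap: "nambu_coeff \<rho> b a i j x = - nambu_coeff \<rho> a b i j x"
proof -
  have "(\<Sum>k\<in>UNIV. \<Sum>l\<in>UNIV. \<rho> x * levi_civita i j k l * pd k b x * pd l a x)
      = (\<Sum>l\<in>UNIV. \<Sum>k\<in>UNIV. \<rho> x * levi_civita i j k l * pd k b x * pd l a x)"
    by (rule sum.swap)
  also have "\<dots> = (\<Sum>l\<in>UNIV. \<Sum>k\<in>UNIV. - (\<rho> x * levi_civita i j l k * pd l a x * pd k b x))"
    by (intro sum.cong refl) (subst levi_civita_swap(6), simp)
  finally show ?thesis by (simp add: nambu_coeff_def sum_negf)
qed

text \<open>Exchanging \<open>a\<close> and \<open>b\<close> reverses the sign of P.
  Skew-symmetrizing the Hamiltonian field thus symmetrizes the Hamiltonian, which explains the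
  pairing of symmetric functions with skew vector fields. The 2 cancels the factor 1/2 in
  \<open>sym_evaluation\<close>.\<close>

lemma hamiltonian_skew_bracket:
  assumes h: "connected_choice h" and sm: "smooth \<rho>" "smooth a" "smooth b"
  shows "(\<Sum>g\<leftarrow>hamiltonian_field h. skew_gev x \<rho> a b (\<lambda>x. x $ i) g)
    = 2 * (\<Sum>m\<in>UNIV. nambu_coeff \<rho> a b i m x * pd m (sym_evaluation 2 (hamiltonian_micrograph h) \<rho> a b {}) x)"
proof -
  let ?E = "evaluation 2 (hamiltonian_micrograph h)"
  have smE: "smooth (?E \<rho> a b {})" "smooth (?E \<rho> b a {})"
    by (intro smooth_evaluation_hamiltonian assms)+
  have "sym_evaluation 2 (hamiltonian_micrograph h) \<rho> a b {} = (\<lambda>x. 1/2 * (?E \<rho> a b {} x + ?E \<rho> b a {} x))"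
    by (simp add: sym_evaluation_def)
  then have pdE: "pd m (sym_evaluation 2 (hamiltonian_micrograph h) \<rho> a b {}) x
      = 1/2 * (pd m (?E \<rho> a b {}) x + pd m (?E \<rho> b a {}) x)" for m
    using pd_cmult[OF smooth_differentiable[OF smooth_add[OF smE]], of m "1/2" x]
    by (simp add: pd_add smooth_differentiable smE)
  have "(\<Sum>g\<leftarrow>hamiltonian_field h. skew_gev x \<rho> a b (\<lambda>x. x $ i) g)
      = (\<Sum>g\<leftarrow>hamiltonian_field h. gev {0..9} x g (cont \<rho> a b (\<lambda>x. x $ i)))
      - (\<Sum>g\<leftarrow>hamiltonian_field h. gev {0..9} x g (cont \<rho> b a (\<lambda>x. x $ i)))"
    by (simp add: skew_gev_def sum_list_subtractf)
  also have "\<dots> = (\<Sum>m\<in>UNIV. nambu_coeff \<rho> a b i m x * (pd m (?E \<rho> a b {}) x + pd m (?E \<rho> b a {}) x))"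
    unfolding hamiltonian_bracket[OF h sm] hamiltonian_bracket[OF h sm(1,3,2)]
    by (simp add: nambu_coeff_swap[of \<rho> b a] sum_negf sum.distrib ring_distribs)
  finally show ?thesis unfolding pdE sum_distrib_left by (simp add: mult.left_commute)
qed

section \<open>Test jets\<close>

text \<open>At a point with \<open>\<rho> = 1\<close>, \<open>da\<^sup>1 = dx\<^sup>3\<close>, \<open>da\<^sup>2 = dx\<^sup>4\<close>, a closed field satisfies
  \<open>Y\<^sup>3 = 0\<close> (flag \<open>True\<close>) and \<open>Y(\<rho>) = \<rho> div Y\<close> (flag \<open>False\<close>).\<close>

type_synonym test = "bool \<times> poly \<times> poly \<times> poly"

fun test_value :: "test \<Rightarrow> nat list \<times> graph \<Rightarrow> int" where
  "test_value (True, r, a, b) (ds, g) = skew_value ds g E3 r a b"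
| "test_value (False, r, a, b) (ds, g) =
     (\<Sum>i\<leftarrow>[E1, E2, E3, E4]. let c = const_term (der i r) in if c = 0 then 0 else c * skew_value ds g i r a b)
     - (divergence_value ds g r a b - divergence_value ds g r b a)"

fun normal_test :: "test \<Rightarrow> bool" where
  "normal_test (_, r, a, b) = (const_term r = 1
     \<and> list_all (\<lambda>i. const_term (der i a) = (if i = E3 then 1 else 0)
                  \<and> const_term (der i b) = (if i = E4 then 1 else 0)) [E1, E2, E3, E4])"

definition sum_value :: "test \<Rightarrow> (nat list \<times> graph) list \<Rightarrow> int" where
  "sum_value t G = (\<Sum>x\<leftarrow>G. test_value t x)"

text \<open>Each test detects its own generator and vanishes on all later ones, including those left
  over when the tests are exhausted; here these are the eight Hamiltonian fields.\<close>

fun triangular :: "test list \<Rightarrow> (nat list \<times> graph) list list \<Rightarrow> bool" where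
  "triangular [] Gs = True"
| "triangular (t # ts) [] = False"
| "triangular (t # ts) (G # Gs) = (sum_value t G \<noteq> 0 \<and> list_all (\<lambda>H. sum_value t H = 0) Gs \<and> triangular ts Gs)"

definition basis :: "graph list list" where
  "basis = map (\<lambda>g. [g]) basis_graphs @ map hamiltonian_field hamiltonians"

text \<open>One jet for each entry of \<open>basis_graphs\<close>, in the same order, with matrix of
  values triangular on the generators. In every jet \<open>[]\<close> makes \<rho> equal to 1 at the
  origin, and \<open>[E3]\<close>, \<open>[E4]\<close> normalize the gradients of a1, a2; the
  remaining monomials single out the graph.\<close>

definition tests :: "test list" where
  "tests = [
   (True, [[],[E2]], [[E1,E1,E1],[E3]], [[E4]]), (True, [[],[E1,E1,E1]], [[E2,E2,E2],[E3]], [[E4]]),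
   (True, [[],[E2,E3]], [[E1,E1,E1],[E2,E2],[E3]], [[E4]]), (True, [[]], [[E1,E1],[E2,E2,E2],[E3]], [[E1,E3,E4],[E4]]),
   (True, [[]], [[E1,E3],[E1,E4],[E2,E2,E2],[E3]], [[E1,E3],[E4]]), (True, [[],[E1],[E2,E2]], [[E1,E1,E2],[E3]], [[E4]]),
   (False, [[],[E1,E1,E1],[E2]], [[E3]], [[E4]]), (True, [[],[E2,E2]], [[E1,E4],[E3]], [[E1,E1,E2],[E4]]),
   (True, [[],[E1,E1,E1],[E2]], [[E2,E2],[E3]], [[E4]]), (True, [[],[E1,E1,E2]], [[E1,E4],[E3]], [[E2,E2],[E4]]),
   (True, [[]], [[E1,E2,E2],[E3]], [[E1,E1],[E2,E4,E4],[E4]]), (True, [[],[E4]], [[E2,E2,E2],[E3]], [[E1,E1,E1],[E4]]),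
   (True, [[],[E2,E2]], [[E1,E1,E2],[E3]], [[E1,E4],[E4]]), (True, [[],[E1]], [[E1,E2,E3],[E2,E2],[E3]], [[E4]]),
   (True, [[]], [[E1,E1,E2],[E1,E3],[E3]], [[E2,E4],[E3,E3],[E4]]), (True, [[],[E1]], [[E1,E1],[E1,E1,E2],[E2,E3],[E3]], [[E4]]),
   (True, [[],[E1]], [[E1,E4],[E3]], [[E2,E2,E2],[E4]]), (True, [[]], [[E2,E4],[E3]], [[E1,E1,E1],[E1,E3],[E2,E3],[E4]]),
   (True, [[],[E1]], [[E1,E1,E2],[E3]], [[E2,E4],[E4]]), (True, [[],[E1]], [[E1,E2],[E1,E4],[E3]], [[E2,E2,E3],[E4]]),
   (True, [[],[E2]], [[E1,E1,E2],[E3]], [[E1,E4],[E4]]), (True, [[],[E1,E2]], [[E1,E1],[E3],[E3,E4]], [[E2,E2],[E4]]),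
   (True, [[],[E2,E2]], [[E1,E1],[E3]], [[E1,E4],[E2,E4],[E4]]), (True, [[],[E1,E3],[E2]], [[E1,E2],[E3]], [[E4]]),
   (True, [[],[E1,E4]], [[E1,E1],[E2,E3],[E3]], [[E2,E2],[E4]]), (False, [[],[E1,E1,E1]], [[E2,E2,E2],[E3]], [[E3,E4],[E4]]),
   (False, [[],[E1,E1,E1],[E2]], [[E2,E2,E3],[E3]], [[E4]]), (False, [[],[E1,E1],[E1,E2,E4]], [[E3]], [[E2,E2],[E4]]),
   (False, [[],[E1],[E2]], [[E1,E1,E1],[E3],[E3,E3]], [[E4]]), (False, [[],[E2,E2,E3]], [[E1,E1],[E1,E2,E3],[E3]], [[E4]]),
   (False, [[],[E2],[E2,E2],[E4]], [[E3]], [[E1,E1,E1],[E4]]), (False, [[],[E1,E1],[E1,E2,E2],[E2]], [[E3]], [[E4]]),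
   (True, [[],[E3]], [[E1,E1,E4],[E1,E2],[E3]], [[E2,E2],[E4]]), (True, [[],[E2]], [[E1,E1],[E3],[E3,E4]], [[E1,E2],[E4]]),
   (True, [[],[E2]], [[E1,E2],[E2,E4],[E3],[E3,E3]], [[E1,E1],[E4]]), (True, [[],[E1]], [[E1,E4],[E2,E3],[E3]], [[E2,E2],[E4]]),
   (True, [[],[E1]], [[E1,E2],[E3]], [[E2,E2],[E4],[E4,E4]]), (True, [[],[E4]], [[E1,E1],[E3]], [[E1,E2,E4],[E2,E2],[E4]]),
   (True, [[],[E4]], [[E1,E1,E1],[E2,E2],[E3]], [[E2,E3],[E4]]), (True, [[],[E2]], [[E3],[E4,E4]], [[E1,E1,E2],[E1,E2],[E4]]),
   (True, [[],[E2]], [[E1,E2,E2],[E3],[E3,E4]], [[E1,E1],[E4]]), (False, [[],[E1,E3],[E2]], [[E1,E1],[E3]], [[E4]]),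
   (True, [[],[E1],[E2],[E2,E2]], [[E1,E1],[E3]], [[E4]]), (False, [[],[E2,E2,E2]], [[E1,E4],[E3]], [[E1,E1],[E3,E4],[E4]]),
   (False, [[],[E1,E1],[E2]], [[E1,E2,E2],[E3],[E3,E3]], [[E4]]), (False, [[],[E1,E1,E1],[E2]], [[E3]], [[E2,E4],[E4]]),
   (False, [[],[E4]], [[E2,E2,E2],[E3],[E3,E3]], [[E1,E1,E1],[E4]]), (False, [[],[E2,E2]], [[E2,E3],[E3],[E3,E4]], [[E1,E1,E1],[E4]]),
   (False, [[],[E1],[E2]], [[E3],[E3,E4]], [[E1,E1,E1],[E4]]), (True, [[],[E1]], [[E2,E2],[E3]], [[E2,E4],[E4]]),
   (False, [[],[E2],[E3,E4]], [[E1,E1],[E3]], [[E1,E2,E2],[E4]]), (True, [[],[E1,E4],[E2]], [[E2,E2],[E3]], [[E1,E1],[E4]]),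
   (True, [[],[E1],[E2,E2]], [[E2,E4],[E3]], [[E1,E1],[E4]]), (True, [[],[E2,E2],[E4]], [[E1,E1],[E3]], [[E1,E2],[E4]]),
   (False, [[],[E1,E1],[E2]], [[E3],[E3,E4]], [[E1,E2,E2],[E4]]), (False, [[],[E2,E2],[E3]], [[E1,E4],[E3]], [[E1,E1,E2],[E4]]),
   (False, [[],[E1]], [[E1,E4],[E3]], [[E2,E2,E2],[E3,E3],[E4]]), (True, [[],[E1]], [[E2,E3],[E3],[E4,E4]], [[E1,E2],[E4]]),
   (True, [[],[E2]], [[E1,E2],[E3]], [[E1,E3],[E4],[E4,E4]]), (False, [[],[E2]], [[E2,E4],[E3]], [[E1,E1,E1],[E3,E4],[E4]]),
   (False, [[],[E2]], [[E1,E1,E1],[E3]], [[E2,E3],[E4],[E4,E4]])]"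

text \<open>Forward substitution: the first test yields \<open>y 0 = 0\<close>, after which this
  unknown disappears from the remaining equations.\<close>

lemma triangular_zero:
  assumes "triangular ts Gs"
    and "\<And>t. t \<in> set ts \<Longrightarrow> (\<Sum>j<length Gs. y j * of_int (sum_value t (Gs ! j))) = (0::real)"
    and "j < length ts"
  shows "y j = 0"
  using assms
proof (induction ts Gs arbitrary: y j rule: triangular.induct)
  case (3 t ts G Gs)
  have zero: "sum_value t (Gs ! i) = 0" if "i < length Gs" for i
    using "3.prems"(1) that by (simp add: list_all_iff)
  have "(\<Sum>i<length (G # Gs). y i * of_int (sum_value t ((G # Gs) ! i)))
      = y 0 * of_int (sum_value t G) + (\<Sum>i<length Gs. y (Suc i) * of_int (sum_value t (Gs ! i)))"
    by (simp add: sum.lessThan_Suc_shift del: sum.lessThan_Suc)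
  also have "(\<Sum>i<length Gs. y (Suc i) * of_int (sum_value t (Gs ! i))) = 0"
    using zero by simp
  finally have "y 0 * of_int (sum_value t G) = 0"
    using "3.prems"(2)[of t] by simp
  then have y0: "y 0 = 0" using "3.prems"(1) by simp
  have "(\<Sum>i<length Gs. y (Suc i) * of_int (sum_value u (Gs ! i))) = 0" if "u \<in> set ts" for u
    using "3.prems"(2)[of u] that y0 by (simp add: sum.lessThan_Suc_shift del: sum.lessThan_Suc)
  then have "y (Suc i) = 0" if "i < length ts" for i
    using "3.IH"[of "\<lambda>i. y (Suc i)" i] "3.prems"(1) that by simp
  then show ?case using y0 "3.prems"(3) by (cases j) auto
qed auto

lemma triangular_tests: "triangular tests (map (map (\<lambda>g. (degrees g, g))) basis)"
  by code_simp

lemma normal_tests: "list_all normal_test tests"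
  by code_simp

lemma valid_basis: "list_all (list_all valid_graph) basis"
  by code_simp

lemma length_basis: "length basis = 69"
  by (simp add: basis_def length_basis_graphs length_hamiltonians)

lemma length_tests: "length tests = 61"
  by (simp add: tests_def)

lemma basis_value_sum: "j < 69 \<Longrightarrow> basis_value S j = (\<Sum>g\<leftarrow>basis ! j. S g)"
  by (auto simp: basis_value_def basis_def nth_append length_basis_graphs length_hamiltonians)

lemma basis_value_of_int:
  assumes "j < 69" "\<And>g. valid_graph g \<Longrightarrow> S g = of_int (V g)"
  shows "basis_value S j = of_int (\<Sum>g\<leftarrow>basis ! j. V g)"
proof -
  have "\<forall>g\<in>set (basis ! j). valid_graph g"
    using valid_basis assms(1) length_basis by (auto simp: list_all_iff)
  moreover have "(\<Sum>g\<leftarrow>G. S g) = of_int (\<Sum>g\<leftarrow>G. V g)" if "\<forall>g\<in>set G. valid_graph g" for G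
    using that by (induction G) (auto simp: assms(2))
  ultimately show ?thesis using basis_value_sum[OF assms(1)] by simp
qed

section \<open>Skew-symmetric vector fields\<close>

lemma skew_evaluation_gev:
  assumes "t \<in> micrographs 3 True"
  shows "skew_evaluation 3 t \<rho> a b {i} x = 1/2 * skew_gev x \<rho> a b (\<lambda>x. x $ i) (graph_of 3 t)"
    and "\<nexists>i. I = {i} \<Longrightarrow> skew_evaluation 3 t \<rho> a b I x = 0"
proof -
  have "card {(k, e). k \<in> {1..3} \<and> t k e = 0} = 1" using assms by (simp add: micrographs_def)
  note ev = evaluation_sink[OF this]
  show "skew_evaluation 3 t \<rho> a b {i} x = 1/2 * skew_gev x \<rho> a b (\<lambda>x. x $ i) (graph_of 3 t)"
    by (simp add: skew_evaluation_def skew_gev_def ev)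
  show "\<nexists>i. I = {i} \<Longrightarrow> skew_evaluation 3 t \<rho> a b I x = 0"
    by (simp add: skew_evaluation_def ev)
qed

text \<open>Coefficients of the graphs in the combination are multiplied by their coordinates in the
  span; both are constants. The weight 3 is obtained from the graphs themselves, before the passage
  to coordinates.\<close>

lemma V_minus_coordinates:
  assumes "Y \<in> V_minus"
  obtains y where
    "\<And>\<rho> a b i x. smooth \<rho> \<Longrightarrow> smooth a \<Longrightarrow> smooth b \<Longrightarrow>
       Y \<rho> a b {i} x = (\<Sum>j<69. y j * basis_value (skew_gev x \<rho> a b (\<lambda>x. x $ i)) j)"
    "\<And>\<rho> a b I. \<nexists>i. I = {i} \<Longrightarrow> Y \<rho> a b I = (\<lambda>x. 0)"
    "\<And>\<rho> a b i. smooth \<rho> \<Longrightarrow> smooth a \<Longrightarrow> smooth b \<Longrightarrow> smooth (Y \<rho> a b {i})"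
    "\<And>\<rho> a b i. smooth \<rho> \<Longrightarrow> smooth a \<Longrightarrow> smooth b \<Longrightarrow>
       exp_poly 3 (\<lambda>t. Y (\<lambda>x. exp (t * x $ 1) * \<rho> x) a b {i})"
proof -
  obtain S c where S: "finite S" "S \<subseteq> skew_evaluation 3 ` micrographs 3 True"
    and Y: "Y = (\<lambda>\<rho> a b I x. \<Sum>F\<in>S. c F * F \<rho> a b I x)"
    using assms unfolding V_minus_def expr_span_def by blast
  obtain \<tau> where \<tau>: "\<And>F. F \<in> S \<Longrightarrow> \<tau> F \<in> micrographs 3 True \<and> F = skew_evaluation 3 (\<tau> F)"
  proof -
    have "\<forall>F\<in>S. \<exists>t. t \<in> micrographs 3 True \<and> F = skew_evaluation 3 t" using S(2) by blast
    from bchoice[OF this] show ?thesis using that by blast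
  qed
  have F: "F \<rho> a b {i} x = 1/2 * skew_gev x \<rho> a b (\<lambda>x. x $ i) (graph_of 3 (\<tau> F))"
    "\<nexists>i. I = {i} \<Longrightarrow> F \<rho> a b I x = 0" if "F \<in> S" for F \<rho> a b i x I
  proof -
    have t: "\<tau> F \<in> micrographs 3 True" and eq: "F = skew_evaluation 3 (\<tau> F)" using \<tau>[OF that] by blast+
    show "F \<rho> a b {i} x = 1/2 * skew_gev x \<rho> a b (\<lambda>x. x $ i) (graph_of 3 (\<tau> F))"
      by (subst eq) (rule skew_evaluation_gev(1)[OF t])
    show "\<nexists>i. I = {i} \<Longrightarrow> F \<rho> a b I x = 0"
      by (subst eq) (rule skew_evaluation_gev(2)[OF t])
  qed
  have Yi: "Y \<rho> a b {i} x = (\<Sum>F\<in>S. c F * (1/2 * skew_gev x \<rho> a b (\<lambda>x. x $ i) (graph_of 3 (\<tau> F))))" for \<rho> a b i x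
    unfolding Y by (intro sum.cong refl) (simp only: F(1))
  have "\<exists>n. \<forall>S. bracket_functional S \<longrightarrow> S (graph_of 3 (\<tau> F)) = (\<Sum>j<69. n j * basis_value S j)" if "F \<in> S" for F
    using spanned_graph_of[of "\<tau> F"] \<tau>[OF that] unfolding in_span_def by blast
  then obtain n where n: "\<And>F T. F \<in> S \<Longrightarrow> bracket_functional T \<Longrightarrow>
      T (graph_of 3 (\<tau> F)) = (\<Sum>j<69. n F j * basis_value T j)" by metis
  let ?y = "\<lambda>j. \<Sum>F\<in>S. c F * (1/2 * n F j)"
  show ?thesis
  proof
    fix \<rho> a b i x
    assume sm: "smooth \<rho>" "smooth a" "smooth b"
    have bf: "bracket_functional (skew_gev x \<rho> a b (\<lambda>x. x $ i))"
      using sm by (intro bracket_functional_skew_gev smooth_coord)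
    have "Y \<rho> a b {i} x = (\<Sum>F\<in>S. c F * (1/2 * (\<Sum>j<69. n F j * basis_value (skew_gev x \<rho> a b (\<lambda>x. x $ i)) j)))"
      unfolding Yi by (intro sum.cong refl) (simp only: n[OF _ bf])
    also have "\<dots> = (\<Sum>F\<in>S. \<Sum>j<69. c F * (1/2 * n F j) * basis_value (skew_gev x \<rho> a b (\<lambda>x. x $ i)) j)"
      by (simp add: sum_distrib_left mult.assoc)
    also have "\<dots> = (\<Sum>j<69. ?y j * basis_value (skew_gev x \<rho> a b (\<lambda>x. x $ i)) j)"
      unfolding sum_distrib_right by (rule sum.swap)
    finally show "Y \<rho> a b {i} x = (\<Sum>j<69. ?y j * basis_value (skew_gev x \<rho> a b (\<lambda>x. x $ i)) j)" .
  next
    fix \<rho> a b and I :: "4 set"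
    assume "\<nexists>i. I = {i}"
    then show "Y \<rho> a b I = (\<lambda>x. 0)"
      unfolding Y by (intro ext sum.neutral) (simp add: F(2))
  next
    fix \<rho> a b i
    assume sm: "smooth \<rho>" "smooth a" "smooth b"
    have "smooth (\<lambda>x. \<Sum>F\<in>S. c F * (1/2 * skew_gev x \<rho> a b (\<lambda>x. x $ i) (graph_of 3 (\<tau> F))))"
      unfolding skew_gev_def using sm
      by (intro smooth_sum smooth_cmult smooth_diff smooth_gev smooth_cont smooth_coord)
    then show "smooth (Y \<rho> a b {i})" unfolding Yi[abs_def] .
  next
    fix \<rho> a b i
    assume sm: "smooth \<rho>" "smooth a" "smooth b"
    let ?r = "\<lambda>t x. exp (t * x $ 1) * \<rho> x"
    \<comment> \<open>Weight 1 at each of the three vertices carrying \<rho>, and weight 0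
      elsewhere.\<close>
    let ?k = "\<lambda>v::nat. if 1 \<le> v \<and> v \<le> 3 then 1 else (0::real)"
    have three: "(\<Sum>v\<in>{0..9}. ?k v) = 3"
    proof -
      have "{0..9::nat} = {0, 1, 2, 3, 4, 5, 6, 7, 8, 9}" by auto
      then show ?thesis by simp
    qed
    have ep: "exp_poly 3 (\<lambda>t x. gev {0..9} x g (cont (?r t) a b (\<lambda>x. x $ i)))"
      if "smooth a" "smooth b" for a b g
    proof -
      have "exp_poly (?k v) (\<lambda>t. cont (?r t) a b (\<lambda>x. x $ i) v)" for v
        using that sm(1) by (auto simp: cont_def intro: exp_poly_const exp_poly_scaled exp_poly_const[OF smooth_coord])
      then have "exp_poly (\<Sum>v\<in>{0..9}. ?k v) (\<lambda>t x. gev {0..9} x g (cont (?r t) a b (\<lambda>x. x $ i)))"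
        by (intro exp_poly_gev) auto
      then show ?thesis by (simp only: three)
    qed
    have "exp_poly 3 (\<lambda>t x. \<Sum>F\<in>S. c F * (1/2 * (gev {0..9} x (graph_of 3 (\<tau> F)) (cont (?r t) a b (\<lambda>x. x $ i))
        + (-1) * gev {0..9} x (graph_of 3 (\<tau> F)) (cont (?r t) b a (\<lambda>x. x $ i)))))"
      by (intro exp_poly_sum exp_poly_cmult exp_poly_add ep sm)
    then show "exp_poly 3 (\<lambda>t. Y (?r t) a b {i})"
      unfolding Yi[abs_def] skew_gev_def by simp
  qed
qed

text \<open>\<open>expr_span\<close> sums over a set of expressions, so indices with the same
  expression have to be merged by adding their coefficients.\<close>

lemma expr_span_sum:
  fixes f :: "nat \<Rightarrow> field_expr"
  assumes "\<And>j. j < n \<Longrightarrow> f j \<in> B"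
  shows "(\<lambda>\<rho> a b I x. \<Sum>j<n. h j * f j \<rho> a b I x) \<in> expr_span B"
proof -
  let ?c = "\<lambda>F. \<Sum>j\<in>{j \<in> {..<n}. f j = F}. h j"
  have "(\<Sum>j<n. h j * f j \<rho> a b I x) = (\<Sum>F\<in>f ` {..<n}. ?c F * F \<rho> a b I x)" for \<rho> a b I x
    unfolding sum_distrib_right by (subst sum.image_gen[OF finite_lessThan, where g = f]) (auto intro!: sum.cong)
  then show ?thesis
    unfolding expr_span_def using assms
    by (intro CollectI exI[of _ "f ` {..<n}"] exI[of _ ?c]) auto
qed

text \<open>At the jet of each test, one of the two consequences of closedness becomes a linear
  equation for \<open>y\<close> whose coefficients are the integers
  \<open>sum_value\<close>.\<close>

lemma closed_coordinates_vanish: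
  assumes comp: "\<And>\<rho> a b i x. smooth \<rho> \<Longrightarrow> smooth a \<Longrightarrow> smooth b \<Longrightarrow>
       Y \<rho> a b {i} x = (\<Sum>j<69. y j * basis_value (skew_gev x \<rho> a b (\<lambda>x. x $ i)) j)"
    and vf: "\<And>\<rho> a b. smooth \<rho> \<Longrightarrow> smooth a \<Longrightarrow> smooth b \<Longrightarrow> vector_field (Y \<rho> a b)"
    and poly: "\<And>\<rho> a b i. smooth \<rho> \<Longrightarrow> smooth a \<Longrightarrow> smooth b \<Longrightarrow>
       exp_poly 3 (\<lambda>t. Y (\<lambda>x. exp (t * x $ 1) * \<rho> x) a b {i})"
    and closed: "\<And>\<rho> a b. smooth \<rho> \<Longrightarrow> smooth a \<Longrightarrow> smooth b \<Longrightarrow> schouten (nambu \<rho> a b) (Y \<rho> a b) = (\<lambda>I x. 0)"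
    and j: "j < 61"
  shows "y j = 0"
proof (rule triangular_zero[OF triangular_tests])
  show "j < length tests" using j by (simp add: length_tests)
  fix t assume t: "t \<in> set tests"
  obtain kind r a b where t': "t = (kind, r, a, b)" by (metis surj_pair)
  let ?\<rho> = "pfun r" and ?a = "pfun a" and ?b = "pfun b"
  have sm: "smooth ?\<rho>" "smooth ?a" "smooth ?b" by (simp_all add: smooth_pfun)
  have nt: "normal_test (kind, r, a, b)" using normal_tests t t' by (auto simp: list_all_iff)
  have pda: "pd k ?a 0 = (if k = 3 then 1 else 0)" and pdb: "pd k ?b 0 = (if k = 4 then 1 else 0)" for k
  proof -
    obtain i where k: "k = dir i" using dir_surj by metis
    have "const_term (der i a) = (if i = E3 then 1 else 0)" "const_term (der i b) = (if i = E4 then 1 else 0)"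
      using nt by (cases i; simp)+
    then show "pd k ?a 0 = (if k = 3 then 1 else 0)" "pd k ?b 0 = (if k = 4 then 1 else 0)"
      unfolding k pd_pfun pfun_0 by (cases i; simp)+
  qed
  have \<rho>0: "?\<rho> 0 = 1" using nt by (simp add: pfun_0)
  note normal = closed_at_normal_point[OF sm vf[OF _ sm(2,3)] closed[OF _ sm(2,3)] poly[OF sm] \<rho>0 pda pdb]
  let ?Gs = "map (map (\<lambda>g. (degrees g, g))) basis"
  have sv: "sum_value t (?Gs ! j) = (\<Sum>g\<leftarrow>basis ! j. test_value t (degrees g, g))" if "j < 69" for j
    using that by (simp add: sum_value_def length_basis comp_def)
  have Yx: "Y ?\<rho> ?a ?b {dir i} 0 = (\<Sum>j<69. y j * of_int (\<Sum>g\<leftarrow>basis ! j. skew_value (degrees g) g i r a b))" for i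
    unfolding comp[OF sm]
    by (intro sum.cong refl) (simp add: basis_value_of_int[OF _ skew_value_correct])
  have dY: "(\<Sum>k\<in>UNIV. pd k (Y ?\<rho> ?a ?b {k}) 0)
      = (\<Sum>j<69. y j * of_int (\<Sum>g\<leftarrow>basis ! j. divergence_value (degrees g) g r a b - divergence_value (degrees g) g r b a))"
  proof -
    let ?D = "\<lambda>g. \<Sum>k\<in>UNIV. pd k (\<lambda>x. skew_gev x ?\<rho> ?a ?b (\<lambda>x. x $ k) g) 0"
    have smg: "smooth (\<lambda>x. skew_gev x ?\<rho> ?a ?b (\<lambda>x. x $ k) g)" for k g
      unfolding skew_gev_def using sm by (intro smooth_diff smooth_gev smooth_cont smooth_coord)
    have smb: "smooth (\<lambda>x. basis_value (skew_gev x ?\<rho> ?a ?b (\<lambda>x. x $ k)) j)"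
      and pdb': "pd k (\<lambda>x. basis_value (skew_gev x ?\<rho> ?a ?b (\<lambda>x. x $ k)) j) 0
        = basis_value (\<lambda>g. pd k (\<lambda>x. skew_gev x ?\<rho> ?a ?b (\<lambda>x. x $ k) g) 0) j" for k j
    proof -
      have "smooth (\<lambda>x. \<Sum>g\<leftarrow>G. skew_gev x ?\<rho> ?a ?b (\<lambda>x. x $ k) g)
        \<and> pd k (\<lambda>x. \<Sum>g\<leftarrow>G. skew_gev x ?\<rho> ?a ?b (\<lambda>x. x $ k) g) 0
          = (\<Sum>g\<leftarrow>G. pd k (\<lambda>x. skew_gev x ?\<rho> ?a ?b (\<lambda>x. x $ k) g) 0)" for G
        by (induction G) (auto simp: smooth_add smg pd_add smooth_differentiable)
      then show "smooth (\<lambda>x. basis_value (skew_gev x ?\<rho> ?a ?b (\<lambda>x. x $ k)) j)"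
        "pd k (\<lambda>x. basis_value (skew_gev x ?\<rho> ?a ?b (\<lambda>x. x $ k)) j) 0
          = basis_value (\<lambda>g. pd k (\<lambda>x. skew_gev x ?\<rho> ?a ?b (\<lambda>x. x $ k) g) 0) j"
        by (cases "j < 61"; simp add: basis_value_def smg)+
    qed
    have "pd k (Y ?\<rho> ?a ?b {k}) 0 = (\<Sum>j<69. y j * basis_value (\<lambda>g. pd k (\<lambda>x. skew_gev x ?\<rho> ?a ?b (\<lambda>x. x $ k) g) 0) j)" for k
    proof -
      have "Y ?\<rho> ?a ?b {k} = (\<lambda>x. \<Sum>j<69. y j * basis_value (skew_gev x ?\<rho> ?a ?b (\<lambda>x. x $ k)) j)"
        using comp[OF sm] by auto
      then show ?thesis
        by (simp only: pdb'[symmetric])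
           (auto simp: pd_sum pd_cmult smooth_differentiable smooth_cmult smb)
    qed
    then have "(\<Sum>k\<in>UNIV. pd k (Y ?\<rho> ?a ?b {k}) 0)
        = (\<Sum>j<69. y j * (\<Sum>k\<in>UNIV. basis_value (\<lambda>g. pd k (\<lambda>x. skew_gev x ?\<rho> ?a ?b (\<lambda>x. x $ k) g) 0) j))"
      unfolding sum_distrib_left by (simp only:) (rule sum.swap)
    also have "\<dots> = (\<Sum>j<69. y j * basis_value ?D j)"
    proof (intro sum.cong refl arg_cong[where f = "(*) _"])
      fix j
      have "(\<Sum>k\<in>UNIV. \<Sum>g\<leftarrow>G. d k g) = (\<Sum>g\<leftarrow>G. \<Sum>k\<in>UNIV. d k g)" for d :: "4 \<Rightarrow> graph \<Rightarrow> real" and G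
        by (induction G) (auto simp: sum.distrib)
      then show "(\<Sum>k\<in>UNIV. basis_value (\<lambda>g. pd k (\<lambda>x. skew_gev x ?\<rho> ?a ?b (\<lambda>x. x $ k) g) 0) j) = basis_value ?D j"
        by (simp add: basis_value_def)
    qed
    also have "\<dots> = (\<Sum>j<69. y j * of_int (\<Sum>g\<leftarrow>basis ! j. divergence_value (degrees g) g r a b - divergence_value (degrees g) g r b a))"
    proof (intro sum.cong refl arg_cong[where f = "(*) _"] basis_value_of_int)
      fix g assume g: "valid_graph g"
      have "?D g = (\<Sum>k\<in>UNIV. pd k (\<lambda>x. gev {0..9} x g (cont ?\<rho> ?a ?b (\<lambda>x. x $ k))) 0)
          - (\<Sum>k\<in>UNIV. pd k (\<lambda>x. gev {0..9} x g (cont ?\<rho> ?b ?a (\<lambda>x. x $ k))) 0)"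
        unfolding skew_gev_def sum_subtractf[symmetric] using sm
        by (intro sum.cong refl pd_diff smooth_differentiable smooth_gev smooth_cont smooth_coord)
      then show "?D g = of_int (divergence_value (degrees g) g r a b - divergence_value (degrees g) g r b a)"
        by (simp add: divergence_value_correct[OF g])
    qed auto
    finally show ?thesis .
  qed
  show "(\<Sum>j<length ?Gs. y j * of_int (sum_value t (?Gs ! j))) = 0"
  proof (cases kind)
    case True
    have "(\<Sum>j<length ?Gs. y j * of_int (sum_value t (?Gs ! j))) = Y ?\<rho> ?a ?b {dir E3} 0"
      unfolding Yx length_map length_basis by (intro sum.cong refl) (simp only: sv lessThan_iff, simp add: t' True)
    then show ?thesis using normal(1) by simp
  next
    case False
    let ?c = "\<lambda>i. const_term (der i r)"
    have tv: "test_value t (degrees g, g) = (\<Sum>i\<leftarrow>[E1, E2, E3, E4]. ?c i * skew_value (degrees g) g i r a b)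
        - (divergence_value (degrees g) g r a b - divergence_value (degrees g) g r b a)" for g
      by (simp add: t' False Let_def)
    have "(\<Sum>j<length ?Gs. y j * of_int (sum_value t (?Gs ! j)))
      = (\<Sum>i\<leftarrow>[E1, E2, E3, E4]. of_int (?c i) * Y ?\<rho> ?a ?b {dir i} 0) - (\<Sum>k\<in>UNIV. pd k (Y ?\<rho> ?a ?b {k}) 0)"
    proof -
      have lin: "(\<Sum>g\<leftarrow>G. test_value t (degrees g, g)) = (\<Sum>i\<leftarrow>[E1, E2, E3, E4]. ?c i * (\<Sum>g\<leftarrow>G. skew_value (degrees g) g i r a b))
        - (\<Sum>g\<leftarrow>G. divergence_value (degrees g) g r a b - divergence_value (degrees g) g r b a)" for G
        unfolding tv by (induction G) (simp_all add: algebra_simps)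
      have "(\<Sum>j<length ?Gs. y j * of_int (sum_value t (?Gs ! j))) = (\<Sum>j<69. y j * of_int (\<Sum>g\<leftarrow>basis ! j. test_value t (degrees g, g)))"
        unfolding length_map length_basis by (intro sum.cong refl) (simp only: sv lessThan_iff)
      then show ?thesis
        unfolding lin Yx dY by (simp add: algebra_simps sum.distrib sum_subtractf sum_distrib_left)
    qed
    also have "(\<Sum>i\<leftarrow>[E1, E2, E3, E4]. of_int (?c i) * Y ?\<rho> ?a ?b {dir i} 0) = (\<Sum>k\<in>UNIV. Y ?\<rho> ?a ?b {k} 0 * pd k ?\<rho> 0)"
      unfolding sum_dir pd_pfun pfun_0 by (simp add: mult.commute)
    finally show ?thesis using normal(2) by (simp add: sum_subtractf)
  qed
qed

theorem theorem17:
  fixes Y :: field_expr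
  assumes "Y \<in> V_minus"
    and "expr_eq (d_P Y) (\<lambda>\<rho> a1 a2 I x. 0)"
  shows "\<exists>H\<in>H_plus. expr_eq Y (d_P H)"
proof -
  obtain y where comp: "\<And>\<rho> a b i x. smooth \<rho> \<Longrightarrow> smooth a \<Longrightarrow> smooth b \<Longrightarrow>
       Y \<rho> a b {i} x = (\<Sum>j<69. y j * basis_value (skew_gev x \<rho> a b (\<lambda>x. x $ i)) j)"
    and other: "\<And>\<rho> a b I. \<nexists>i. I = {i} \<Longrightarrow> Y \<rho> a b I = (\<lambda>x. 0)"
    and sm: "\<And>\<rho> a b i. smooth \<rho> \<Longrightarrow> smooth a \<Longrightarrow> smooth b \<Longrightarrow> smooth (Y \<rho> a b {i})"
    and poly: "\<And>\<rho> a b i. smooth \<rho> \<Longrightarrow> smooth a \<Longrightarrow> smooth b \<Longrightarrow>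
       exp_poly 3 (\<lambda>t. Y (\<lambda>x. exp (t * x $ 1) * \<rho> x) a b {i})"
    by (rule V_minus_coordinates[OF assms(1)]) blast
  have closed: "schouten (nambu \<rho> a b) (Y \<rho> a b) = (\<lambda>I x. 0)" if "smooth \<rho>" "smooth a" "smooth b" for \<rho> a b
    using assms(2) that by (simp add: expr_eq_def d_P_def)
  have vf: "vector_field (Y \<rho> a b)" if "smooth \<rho>" "smooth a" "smooth b" for \<rho> a b
    using sm other that by (auto simp: vector_field_def)
  have y0: "y j = 0" if "j < 61" for j
    by (rule closed_coordinates_vanish[OF comp vf poly closed that])
  define f where "f j = sym_evaluation 2 (hamiltonian_micrograph (hamiltonians ! j))" for j
  \<comment> \<open>By \<open>hamiltonian_skew_bracket\<close>, generator \<open>61 + j\<close> is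
    twice the Hamiltonian field of \<open>f j\<close>; hence the factor 2.\<close>
  define H where "H = (\<lambda>\<rho> a b I x. \<Sum>j<8. (2 * y (61 + j)) * f j \<rho> a b I x)"
  have con: "connected_choice (hamiltonians ! j)" if "j < 8" for j
    using that by (intro hamiltonians_connected) (simp add: length_hamiltonians)
  have "H \<in> H_plus"
    unfolding H_def H_plus_def f_def
    by (intro expr_span_sum imageI hamiltonian_in_micrographs con)
  moreover have "expr_eq Y (d_P H)"
    unfolding expr_eq_def
  proof (intro allI impI ext)
    fix \<rho> a b and I :: "4 set" and x
    assume s: "smooth \<rho>" "smooth a" "smooth b"
    have smf: "smooth (f j \<rho> a b {})" if "j < 8" for j
      unfolding f_def sym_evaluation_def
      by (intro smooth_cmult smooth_add smooth_evaluation_hamiltonian con that s)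
    have H0: "H \<rho> a b I = (\<lambda>x. 0)" if "I \<noteq> {}" for I
      unfolding H_def f_def sym_evaluation_def
      by (intro ext sum.neutral) (simp add: evaluation_hamiltonian(2)[OF con that])
    show "Y \<rho> a b I x = d_P H \<rho> a b I x"
    proof (cases "\<exists>i. I = {i}")
      case False
      then show ?thesis
        using other[OF False, of \<rho> a b] schouten_nambu_function(2)[of "H \<rho> a b" I \<rho> a b x] H0 by (simp add: d_P_def)
    next
      case True
      then obtain i where I: "I = {i}" by blast
      have pdH: "pd m (H \<rho> a b {}) x = (\<Sum>j<8. (2 * y (61 + j)) * pd m (f j \<rho> a b {}) x)" for m
        unfolding H_def
        by (subst pd_sum) (auto intro!: sum.cong pd_cmult smooth_differentiable smooth_cmult smf)
      have "Y \<rho> a b {i} x = (\<Sum>j<69. y j * basis_value (skew_gev x \<rho> a b (\<lambda>x. x $ i)) j)"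
        by (rule comp[OF s])
      also have "\<dots> = (\<Sum>j\<in>{61..<69}. y j * basis_value (skew_gev x \<rho> a b (\<lambda>x. x $ i)) j)"
        by (intro sum.mono_neutral_right) (auto simp: y0)
      also have "\<dots> = (\<Sum>j<8. y (61 + j) * basis_value (skew_gev x \<rho> a b (\<lambda>x. x $ i)) (61 + j))"
        by (rule sum.reindex_bij_witness[where i = "\<lambda>j. 61 + j" and j = "\<lambda>j. j - 61"]) auto
      also have "\<dots> = (\<Sum>j<8. \<Sum>m\<in>UNIV. nambu_coeff \<rho> a b i m x * ((2 * y (61 + j)) * pd m (f j \<rho> a b {}) x))"
      proof (intro sum.cong refl)
        fix j :: nat assume "j \<in> {..<8}"
        then have j: "j < 8" by simp
        have "basis_value (skew_gev x \<rho> a b (\<lambda>x. x $ i)) (61 + j)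
            = (\<Sum>g\<leftarrow>hamiltonian_field (hamiltonians ! j). skew_gev x \<rho> a b (\<lambda>x. x $ i) g)"
          by (simp add: basis_value_def)
        also have "\<dots> = 2 * (\<Sum>m\<in>UNIV. nambu_coeff \<rho> a b i m x * pd m (f j \<rho> a b {}) x)"
          unfolding f_def by (rule hamiltonian_skew_bracket[OF con[OF j] s])
        finally show "y (61 + j) * basis_value (skew_gev x \<rho> a b (\<lambda>x. x $ i)) (61 + j)
            = (\<Sum>m\<in>UNIV. nambu_coeff \<rho> a b i m x * ((2 * y (61 + j)) * pd m (f j \<rho> a b {}) x))"
          by (simp add: sum_distrib_left mult_ac)
      qed
      also have "\<dots> = (\<Sum>m\<in>UNIV. nambu_coeff \<rho> a b i m x * pd m (H \<rho> a b {}) x)"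
        unfolding pdH sum_distrib_left by (rule sum.swap)
      also have "\<dots> = d_P H \<rho> a b {i} x"
        unfolding d_P_def using H0 by (rule schouten_nambu_function(1)[symmetric])
      finally show ?thesis by (simp only: I)
    qed
  qed
  ultimately show ?thesis by blast
qed

end
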